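(* Let $\eta$ be a positive real function on $[2,\infty)$ and let $\mathcal{A}=\{a_n\}_{n\ge1}$ be a strictly increasing sequence of positive integers such that, for some constants $K_1,\dots,K_4>0$ and all $x\ge 2$: $K_1 x/\eta(x)\le\mathcal{A}(x)\le K_2 x/\eta(x)$, $\mathcal{A}(x/2)\ge K_3\mathcal{A}(x)$, and $\mathcal{A}(x,r)\le K_4\frac{r}{\varphi(r)}\frac{x}{\eta(x)^2}$ for every positive integer $r$. Let $a\ge2$ be an integer and $f(n)=\gamma_d n^d+\dots+\gamma_0$ a polynomial with integer coefficients, $\gamma_d>0$, $\gcd(\gamma_d,\dots,\gamma_0)=1$, and $f(\mathbb{N})\subseteq\mathbb{N}$. Let $r(n)=\#\{(k,s)\in\mathbb{N}\times\mathcal{S}: a_k+a^{f(s)}=n\}$. Then there exist positive constants $x_0,c_1,c_2$ depending only on $a$, $f$ and $K_1,\dots,K_4$ such that for all $x\ge x_0$, \[ \#\Big\{n\le x: r(n)\ge c_1\frac{(\log x)^{1/d}}{\eta(x)(\log\log x)^{1/2}}\Big\}\ge c_2\,x\,\frac{(\log x)^{1/d}}{(\log x)^{1/d}+\eta(x)(\log\log x)^{1/2}}. \]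
   Context: $\mathcal{S}$ is the set of positive integers representable as a sum of two squares. $\mathcal{A}(x)=\#\{n: a_n\le x\}$, $\mathcal{A}(x,r)=\#\{n: a_n\le x,\ a_n+r\in\mathcal{A}\}$; $\varphi$ is Euler's totient function. *)

theory Defs
  imports
    Complex_Main
    "HOL-Computational_Algebra.Polynomial_Factorial"
    "HOL-Number_Theory.Totient"
begin

text \<open>The natural numbers of the source start at 1. A sequence \<open>(a\<^sub>n)\<close> with \<open>n \<ge> 1\<close> is
  represented by a function on \<^typ>\<open>nat\<close> whose value at 0 is never used.\<close>

definition sums_of_two_squares :: "nat set" where
  "sums_of_two_squares = {s. 1 \<le> s \<and> (\<exists>u v. s = u\<^sup>2 + v\<^sup>2)}"

definition seq_set :: "(nat \<Rightarrow> nat) \<Rightarrow> nat set" where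
  "seq_set \<alpha> = \<alpha> ` {1..}"

definition seq_count :: "(nat \<Rightarrow> nat) \<Rightarrow> real \<Rightarrow> nat" where
  "seq_count \<alpha> x = card {n. 1 \<le> n \<and> real (\<alpha> n) \<le> x}"

definition seq_shift_count :: "(nat \<Rightarrow> nat) \<Rightarrow> real \<Rightarrow> nat \<Rightarrow> nat" where
  "seq_shift_count \<alpha> x r = card {n. 1 \<le> n \<and> real (\<alpha> n) \<le> x \<and> \<alpha> n + r \<in> seq_set \<alpha>}"

text \<open>The conversion \<^const>\<open>nat\<close> in the exponent truncates nothing when \<open>f\<close> is positive at all
  positive integers. If moreover \<open>f\<close> is nonconstant, \<open>a \<ge> 2\<close> and \<open>\<alpha>\<close> is strictly increasing,
  the set counted here is finite.\<close>

definition rep_count :: "(nat \<Rightarrow> nat) \<Rightarrow> nat \<Rightarrow> int poly \<Rightarrow> nat \<Rightarrow> nat" where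
  "rep_count \<alpha> a f n =
    card {(k, s). 1 \<le> k \<and> s \<in> sums_of_two_squares \<and> \<alpha> k + a ^ nat (poly f (int s)) = n}"

end

theory Submission
  imports
    Defs
    "HOL-Number_Theory.Prime_Powers"
    "HOL-Number_Theory.Euler_Criterion"
    "HOL-Number_Theory.Pocklington"
    "HOL-Library.Discrete_Functions"
    "HOL-Analysis.Harmonic_Numbers"
    "HOL-Real_Asymp.Real_Asymp"
begin

text \<open>Let \<open>R(n)\<close> count only representations with exponents \<open>s\<close> from a subset \<open>T \<subseteq> \<S>\<close> of
  \<open>[1, M]\<close>, where \<open>M\<close> is a constant times \<open>(log x)\<^bsup>1/d\<^esup>\<close> and \<open>|T| \<ge> c M / (log M)\<^bsup>1/2\<^esup>\<close>. The first
  moment of \<open>R\<close> is \<open>\<ge> c |T| x / \<eta>\<close>. By the hypothesis on \<open>\<A>(x, r)\<close> the second moment is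
  \<open>\<le> C (|T| x / \<eta> + |T|\<^sup>2 x / \<eta>\<^sup>2)\<close>, provided that \<open>r / \<phi>(r)\<close> with
  \<open>r = a\<^bsup>f(s)\<^esup> - a\<^bsup>f(s')\<^esup>\<close> is bounded on average over \<open>s, s' \<in> T\<close>. Cauchy--Schwarz then gives the theorem.

  Up to a constant, \<open>r / \<phi>(r)\<close> is \<open>exp (\<Sum> 1/p)\<close> over the large primes \<open>p\<close> whose order \<open>e\<^sub>p = ord\<^sub>p a\<close> divides
  \<open>f(s) - f(s')\<close>. Jensen's inequality with weights proportional to \<open>1 / (p log e\<^sub>p)\<close>, a convergent
  series, replaces the correlations between primes by the bound \<open>C |T| e\<^bsup>-\<kappa>\<^esup>\<close> on the number of
  \<open>s \<in> T\<close> with \<open>e | f(s) - f(s')\<close>, for a single modulus \<open>e\<close>.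

  The elements of \<open>T\<close> are the products \<open>m p\<close> with \<open>m \<le> M\<^bsup>1/4\<^esup>\<close> and a prime \<open>p\<close> of size about
  \<open>M / m\<close>, all of whose prime factors are 1 modulo 4. An elementary bound of
  Brun--Titchmarsh type for \<open>p\<close> controls residue classes modulo \<open>e\<close>, and
  divided differences bound the number of solutions of the congruence.\<close>

section \<open>Chebyshev bounds and primes congruent to 1 modulo 4\<close>

text \<open>The obstacle is uniformity in the modulus \<open>e\<close>. The orders that occur divide
  f(s) - f(s') and so range up to a constant times M^d, while the sieve-type bound for
  \<open>T\<close> in residue classes reaches only a small power of \<open>M\<close>. Up to M^(1/4)
  the structure m p is used; there the lower bound for |T| and the upper bound for its residue
  classes carry the same factor, the sum of 1/m over the cofactors, which cancels. Beyond M^(1/4)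
  all integers up to \<open>M\<close> are counted: the power saving from divided differences
  outweighs the logarithm lost by forgetting \<open>T\<close>, and e <= C M^d turns a power of
  \<open>M\<close> back into a power of \<open>e\<close>. This is why kappa is small and why only
  pairs with f(s) different from f(s') are counted. The weights in Jensen's inequality are tied to
  kappa: once the primes below a bound depending only on \<open>a\<close> and \<open>f\<close> are
  set aside, the weights sum to at most kappa, so the exponential produces at most e^kappa, which is
  what the congruence count saves.\<close>

lemma sum_divisors_swap:
  fixes h :: "nat \<Rightarrow> nat \<Rightarrow> real"
  shows "(\<Sum>n\<in>{1..N}. \<Sum>d | d dvd n. h d (n div d)) = (\<Sum>d\<in>{1..N}. \<Sum>j\<in>{1..N div d}. h d j)"
proof -
  have fin: "finite {d. d dvd n}" if "n \<in> {1..N}" for n using that by auto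
  have "(\<Sum>n\<in>{1..N}. \<Sum>d | d dvd n. h d (n div d)) =
        (\<Sum>(n,d)\<in>(SIGMA n:{1..N}. {d. d dvd n}). h d (n div d))"
    by (rule sum.Sigma) (use fin in auto)
  also have "\<dots> = (\<Sum>(d,j)\<in>(SIGMA d:{1..N}. {1..N div d}). h d j)"
  proof (rule sum.reindex_bij_witness[where i = "\<lambda>(d,j). (d * j, d)" and j = "\<lambda>(n,d). (d, n div d)"], goal_cases)
    case (2 x)
    then obtain n d where x: "x = (n, d)" "1 \<le> n" "n \<le> N" "d dvd n" by auto
    then have "1 \<le> d" "d \<le> n" using dvd_imp_le[of d n] by (auto simp: Suc_le_eq intro!: Nat.gr0I)
    moreover have "1 \<le> n div d" using x \<open>1 \<le> d\<close> \<open>d \<le> n\<close> by (simp add: Suc_le_eq div_greater_zero_iff)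
    moreover have "n div d \<le> N div d" using x by (intro div_le_mono) auto
    ultimately show ?case using x by auto
  next
    case (4 x)
    then obtain d j where x: "x = (d, j)" "1 \<le> d" "1 \<le> j" "j \<le> N div d" by auto
    then have "d * j \<le> N" by (metis less_eq_div_iff_mult_less_eq mult.commute Suc_le_eq One_nat_def)
    then show ?case using x by auto
  qed (auto)
  also have "\<dots> = (\<Sum>d\<in>{1..N}. \<Sum>j\<in>{1..N div d}. h d j)"
    by (rule sum.Sigma[symmetric]) auto
  finally show ?thesis .
qed

text \<open>Rests on ln being the divisor sum of \<open>mangoldt\<close>. With g = 1 it gives
  Legendre's formula for ln N!, with g = \<open>chi4\<close> the comparison of the classes 1 and 3
  modulo 4.\<close>

lemma sum_ln_eq_sum_mangoldt:
  fixes g :: "nat \<Rightarrow> real"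
  shows "(\<Sum>n\<in>{1..N}. g n * ln n) = (\<Sum>d\<in>{1..N}. mangoldt d * (\<Sum>j\<in>{1..N div d}. g (d * j)))"
proof -
  have "(\<Sum>n\<in>{1..N}. g n * ln n) = (\<Sum>n\<in>{1..N}. \<Sum>d | d dvd n. mangoldt d * g (d * (n div d)))"
  proof (rule sum.cong[OF refl])
    fix n assume "n \<in> {1..N}"
    then have "g n * ln n = g n * (\<Sum>d | d dvd n. mangoldt d)"
      using mangoldt_sum[of n, where ?'a = real] by simp
    also have "\<dots> = (\<Sum>d | d dvd n. mangoldt d * g (d * (n div d)))"
      by (simp add: sum_distrib_left mult.commute)
    finally show "g n * ln n = (\<Sum>d | d dvd n. mangoldt d * g (d * (n div d)))" .
  qed
  then show ?thesis
    using sum_divisors_swap[where h = "\<lambda>d j. mangoldt d * g (d * j)" and N = N] by (simp add: sum_distrib_left)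
qed

definition cheb_psi :: "nat \<Rightarrow> real" where
  "cheb_psi N = (\<Sum>d\<in>{1..N}. mangoldt d)"

lemma ln_fact_eq_sum_mangoldt:
  assumes "N \<le> N'"
  shows "ln (fact N) = (\<Sum>d\<in>{1..N'}. mangoldt d * real (N div d))"
proof -
  have "ln (fact N) = (\<Sum>n\<in>{1..N}. ln (real n))"
    by (induction N) (auto simp: ln_mult add.commute)
  also have "\<dots> = (\<Sum>d\<in>{1..N}. mangoldt d * real (N div d))"
    using sum_ln_eq_sum_mangoldt[of "\<lambda>_. 1" N] by simp
  also have "\<dots> = (\<Sum>d\<in>{1..N'}. mangoldt d * real (N div d))"
    by (rule sum.mono_neutral_left) (use assms in \<open>auto simp: div_eq_0_iff\<close>)
  finally show ?thesis .
qed

lemma ln_central_binomial: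
  "ln (real ((2 * n) choose n)) = (\<Sum>d\<in>{1..2*n}. mangoldt d * (real (2 * n div d) - 2 * real (n div d)))"
proof -
  have "real ((2 * n) choose n) = fact (2 * n) / (fact n * fact n)"
    using binomial_fact[of n "2 * n", where ?'a = real] by (simp add: mult_2)
  then have "ln (real ((2 * n) choose n)) = ln (fact (2 * n)) - 2 * ln (fact n)"
    by (simp add: ln_div ln_mult)
  also have "\<dots> = (\<Sum>d\<in>{1..2*n}. mangoldt d * real (2 * n div d)) - 2 * (\<Sum>d\<in>{1..2*n}. mangoldt d * real (n div d))"
    by (subst ln_fact_eq_sum_mangoldt[of "2*n" "2*n"], simp, subst ln_fact_eq_sum_mangoldt[of n "2*n"]) auto
  finally show ?thesis by (simp add: sum_distrib_left sum_subtractf algebra_simps)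
qed

lemma double_div_bounds:
  fixes n d :: nat
  shows "2 * (n div d) \<le> 2 * n div d" "2 * n div d \<le> 2 * (n div d) + 1"
proof -
  show "2 * (n div d) \<le> 2 * n div d"
    by (cases "d = 0") (auto simp: less_eq_div_iff_mult_less_eq algebra_simps)
  show "2 * n div d \<le> 2 * (n div d) + 1"
  proof (cases "d = 0")
    case False
    have "n < d * (n div d + 1)" using False by (metis dividend_less_times_div add.commute gr0I mult_Suc_right Suc_eq_plus1)
    then have "2 * n < d * (2 * (n div d) + 2)" by (simp add: algebra_simps)
    then have "2 * n div d < 2 * (n div d) + 2" using False by (simp add: div_less_iff_less_mult mult.commute)
    then show ?thesis by simp
  qed simp
qed

text \<open>Each \<open>d\<close> in (n, 2n] has coefficient 1 in \<open>ln_central_binomial\<close>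
  and the other coefficients are nonnegative, so the difference is at most ln of the central
  binomial coefficient, itself at most 4^n.\<close>

lemma cheb_psi_double_diff: "cheb_psi (2 * n) - cheb_psi n \<le> 2 * real n * ln 2"
proof -
  have "cheb_psi (2 * n) - cheb_psi n = (\<Sum>d\<in>{n<..2*n}. mangoldt d)"
  proof -
    have "{1..2*n} = {1..n} \<union> {n<..2*n}" by auto
    then have "cheb_psi (2 * n) = cheb_psi n + (\<Sum>d\<in>{n<..2*n}. mangoldt d)"
      unfolding cheb_psi_def by (simp only:) (rule sum.union_disjoint, auto)
    then show ?thesis by simp
  qed
  also have "\<dots> \<le> (\<Sum>d\<in>{n<..2*n}. mangoldt d * (real (2 * n div d) - 2 * real (n div d)))"
  proof (rule sum_mono)
    fix d assume "d \<in> {n<..2*n}"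
    then have "n div d = 0" "2 * n div d \<ge> 1" by (auto simp: Suc_le_eq div_greater_zero_iff)
    then show "mangoldt d \<le> mangoldt d * (real (2 * n div d) - 2 * real (n div d))"
      using mangoldt_nonneg[of d] by (simp add: mult_le_cancel_left1)
  qed
  also have "\<dots> \<le> (\<Sum>d\<in>{1..2*n}. mangoldt d * (real (2 * n div d) - 2 * real (n div d)))"
  proof (rule sum_mono2)
    fix d show "0 \<le> (mangoldt d :: real) * (real (2 * n div d) - 2 * real (n div d))"
      using double_div_bounds(1)[of n d] mangoldt_nonneg[of d] by (intro mult_nonneg_nonneg) linarith+
  qed auto
  also have "\<dots> = ln (real ((2 * n) choose n))" by (rule ln_central_binomial[symmetric])
  also have "\<dots> \<le> ln (2 ^ (2 * n))"
  proof -
    have "(2 * n) choose n \<le> 2 ^ (2 * n)" using binomial_le_pow2 by blast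
    then have "real ((2 * n) choose n) \<le> 2 ^ (2 * n)" by (metis of_nat_le_iff of_nat_numeral of_nat_power)
    then show ?thesis by (subst ln_le_cancel_iff) auto
  qed
  also have "\<dots> = 2 * real n * ln 2" by (simp add: ln_realpow)
  finally show ?thesis .
qed

text \<open>With m = n div 2, doubling bounds \<open>cheb_psi (2 * m)\<close> by 4m + 2m ln 2 <= 6m,
  and an odd \<open>n\<close> adds one term of size at most ln n <= n - 1 <= 2m. The total 8m is at
  most 4n, which fixes the constant 4.\<close>

lemma cheb_psi_le: "cheb_psi n \<le> 4 * real n"
proof (induction n rule: less_induct)
  case (less n)
  show ?case
  proof (cases "n = 0")
    case True then show ?thesis by (simp add: cheb_psi_def)
  next
    case False
    define m where "m = n div 2"
    have IH: "cheb_psi m \<le> 4 * real m" using False by (intro less) (auto simp: m_def)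
    have "cheb_psi n \<le> cheb_psi (2 * m) + ln n"
    proof (cases "even n")
      case True then show ?thesis using False by (simp add: m_def)
    next
      case odd: False
      then have "n = Suc (2 * m)" by (simp add: m_def)
      then have "cheb_psi n = cheb_psi (2 * m) + mangoldt n" by (simp add: cheb_psi_def)
      also have "mangoldt n \<le> ln (real n)" using False by (intro mangoldt_le) auto
      finally show ?thesis by simp
    qed
    moreover have "ln (real n) \<le> real n - 1" using False by (intro ln_le_minus_one) auto
    moreover have "real n \<ge> 2 * real m" unfolding m_def by linarith
    moreover have "2 * real m * ln 2 \<le> 2 * real m * 1"
      by (intro mult_left_mono) (use ln_2_less_1 in auto)
    moreover have "real n \<le> 2 * real m + 1" unfolding m_def by linarith
    moreover have "real m \<ge> 0" by simp
    ultimately show ?thesis using IH cheb_psi_double_diff[of m] by linarith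
  qed
qed

lemma cheb_psi_mono: "m \<le> n \<Longrightarrow> cheb_psi m \<le> cheb_psi n"
  unfolding cheb_psi_def by (rule sum_mono2) (auto simp: mangoldt_nonneg)

text \<open>The coefficients in \<open>ln_central_binomial\<close> are at most 1, so psi(2m)
  dominates ln of the central binomial coefficient, which is at least 4^m / (2m).\<close>

lemma cheb_psi_ge:
  assumes "n \<ge> 2"
  shows "cheb_psi n \<ge> real n * ln 2 - ln 2 - ln (real n)"
proof -
  define m where "m = n div 2"
  have m: "m > 0" "2 * m \<le> n" "real n \<le> 2 * real m + 1" using assms by (auto simp: m_def)
  have "real m * ln 4 - ln (2 * real m) = ln (4 ^ m / (2 * real m))"
    using m by (subst ln_div) (auto simp: ln_realpow)
  also have "\<dots> \<le> ln (real ((2 * m) choose m))"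
    using central_binomial_lower_bound[OF m(1)] m by (subst ln_le_cancel_iff) auto
  also have "\<dots> \<le> (\<Sum>d\<in>{1..2*m}. mangoldt d * 1)" unfolding ln_central_binomial
  proof (rule sum_mono)
    fix d show "mangoldt d * (real (2 * m div d) - 2 * real (m div d)) \<le> mangoldt d * 1"
      using double_div_bounds(2)[of m d] mangoldt_nonneg[of d] by (intro mult_left_mono) linarith+
  qed
  also have "\<dots> = cheb_psi (2 * m)" by (simp add: cheb_psi_def)
  also have "\<dots> \<le> cheb_psi n" using m by (intro cheb_psi_mono) auto
  finally have *: "real m * ln 4 - ln (2 * real m) \<le> cheb_psi n" .
  have "ln 4 = 2 * ln (2::real)" using ln_realpow[of 2 2] by simp
  moreover have "ln (2 * real m) \<le> ln (real n)" using m by (subst ln_le_cancel_iff) auto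
  moreover have "(real n - 1) * ln 2 \<le> (2 * real m) * ln 2"
    using m by (intro mult_right_mono) auto
  ultimately show ?thesis using * by (simp add: algebra_simps)
qed

section \<open>Primes 1 modulo 4, by comparison with the class 3 through the character modulo
  4\<close>

definition chi4 :: "nat \<Rightarrow> real" where
  "chi4 n = (if n mod 4 = 1 then 1 else if n mod 4 = 3 then -1 else 0)"

lemma mod4_cases: "n mod 4 = 0 \<or> n mod 4 = 1 \<or> n mod 4 = 2 \<or> n mod 4 = (3::nat)"
  by linarith

lemma chi4_Suc: "chi4 (Suc N) = (if N mod 4 = 0 then 1 else if N mod 4 = 2 then - 1 else 0)"
  using mod4_cases[of N] by (auto simp: chi4_def mod_Suc)

lemma Suc_mod_4: "Suc N mod 4 = (if N mod 4 = 3 then 0 else Suc (N mod 4))"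
  by (simp add: mod_Suc)

lemma chi4_mult: "chi4 (m * n) = chi4 m * chi4 n"
  unfolding chi4_def mod_mult_eq[of m 4 n, symmetric]
  using mod4_cases[of m] mod4_cases[of n] by auto

lemma sum_chi4: "(\<Sum>j\<in>{1..N}. chi4 j) = (if N mod 4 = 1 \<or> N mod 4 = 2 then 1 else 0)"
proof (induction N)
  case (Suc N)
  show ?case using Suc mod4_cases[of N] by (auto simp: chi4_def mod_Suc)
qed simp

text \<open>The left side is ln 3 - ln 5 + ln 7 - ..., which is nonpositive each time a negative
  term has just been added. The bound with \<open>if\<close> is the induction invariant; the summand
  1 in ln (N + 1) lets the next negative term cancel it exactly.\<close>

lemma sum_chi4_ln_ge:
  "- (\<Sum>n\<in>{1..N}. chi4 n * ln n) \<le> ln (real N + 1)"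
proof -
  have "- (\<Sum>n\<in>{1..N}. chi4 n * ln n) \<le> (if N mod 4 = 1 \<or> N mod 4 = 2 then 0 else ln (real N + 1))"
  proof (induction N)
    case (Suc N)
    define S where "S = (\<Sum>n\<in>{1..N}. chi4 n * ln n)"
    have rec: "(\<Sum>n\<in>{1..Suc N}. chi4 n * ln n) = S + chi4 (Suc N) * ln (real N + 1)"
      by (simp add: S_def add.commute)
    have IH: "- S \<le> (if N mod 4 = 1 \<or> N mod 4 = 2 then 0 else ln (real N + 1))"
      using Suc by (simp add: S_def)
    define L1 L2 where "L1 = ln (real N + 1)" and "L2 = ln (real (Suc N) + 1)"
    have L: "L1 \<le> L2" "0 \<le> L1" unfolding L1_def L2_def by simp_all
    show ?case unfolding rec Suc_mod_4 chi4_Suc L1_def[symmetric] L2_def[symmetric]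
      using IH[folded L1_def] L mod4_cases[of N] by (elim disjE) simp_all
  qed simp
  also have "\<dots> \<le> ln (real N + 1)" by auto
  finally show ?thesis .
qed

definition psi_mod4 :: "nat \<Rightarrow> nat \<Rightarrow> real" where
  "psi_mod4 c N = (\<Sum>d\<in>{1..N}. mangoldt d * of_bool (d mod 4 = c))"

lemma psi_mod4_mono: "m \<le> n \<Longrightarrow> psi_mod4 c m \<le> psi_mod4 c n"
  unfolding psi_mod4_def by (rule sum_mono2) (auto simp: mangoldt_nonneg)

lemma psi_mod4_le_cheb_psi: "psi_mod4 c N \<le> cheb_psi N"
  unfolding psi_mod4_def cheb_psi_def by (rule sum_mono) (auto simp: mangoldt_nonneg)

text \<open>The partial sums \<open>E\<close> of \<open>chi4\<close> are 0 or 1, and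
  \<open>E (N div d)\<close> is 1 when N div d is 1 or 2, that is for d beyond N div 3. So in the
  sum of chi4(n) ln n the prime powers 3 modulo 4 in that range have weight exactly -1, and those 1
  modulo 4 have weight at most 1. The one-sided bound \<open>sum_chi4_ln_ge\<close> then limits the
  excess of class 3 over class 1.\<close>

lemma psi_mod4_3_le: "psi_mod4 3 N \<le> psi_mod4 3 (N div 3) + psi_mod4 1 N + ln (real N + 1)"
proof -
  define E :: "nat \<Rightarrow> real" where "E = (\<lambda>k. if k mod 4 = 1 \<or> k mod 4 = 2 then 1 else 0)"
  have "(\<Sum>n\<in>{1..N}. chi4 n * ln n) = (\<Sum>d\<in>{1..N}. mangoldt d * (chi4 d * E (N div d)))"
    unfolding sum_ln_eq_sum_mangoldt chi4_mult sum_distrib_left[symmetric] sum_chi4 E_def ..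
  then have 1: "- (\<Sum>d\<in>{1..N}. mangoldt d * (chi4 d * E (N div d))) \<le> ln (real N + 1)"
    using sum_chi4_ln_ge[of N] by simp
  have 2: "psi_mod4 3 (N div 3) = (\<Sum>d\<in>{1..N}. mangoldt d * of_bool (d mod 4 = 3 \<and> d \<le> N div 3))"
    unfolding psi_mod4_def
    by (rule sum.mono_neutral_cong_left) auto
  have "0 \<le> (\<Sum>d\<in>{1..N}. mangoldt d * (of_bool (d mod 4 = 1) - chi4 d * E (N div d)
          - of_bool (d mod 4 = 3) + of_bool (d mod 4 = 3 \<and> d \<le> N div 3)))"
  proof (intro sum_nonneg mult_nonneg_nonneg mangoldt_nonneg)
    fix d assume d: "d \<in> {1..N}"
    have "E (N div d) = 1" if "\<not> d \<le> N div 3"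
    proof -
      have "N < 3 * d" using that by linarith
      then have "N div d < 3" using d by (simp add: div_less_iff_less_mult)
      moreover have "N div d \<ge> 1" using d by (simp add: Suc_le_eq div_greater_zero_iff)
      ultimately have "N div d = 1 \<or> N div d = 2" by linarith
      then show ?thesis by (auto simp: E_def)
    qed
    moreover have "0 \<le> E (N div d)" "E (N div d) \<le> 1" by (auto simp: E_def)
    ultimately show "0 \<le> of_bool (d mod 4 = 1) - chi4 d * E (N div d)
          - of_bool (d mod 4 = 3) + of_bool (d mod 4 = 3 \<and> d \<le> N div 3)"
      by (auto simp: chi4_def)
  qed
  also have "\<dots> = psi_mod4 1 N - (\<Sum>d\<in>{1..N}. mangoldt d * (chi4 d * E (N div d))) - psi_mod4 3 N + psi_mod4 3 (N div 3)"
    unfolding 2 unfolding psi_mod4_def by (simp add: sum.distrib sum_subtractf ring_distribs)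
  finally show ?thesis using 1 by linarith
qed

lemma sum_mangoldt_not_prime_le:
  assumes "N \<ge> 1"
  shows "(\<Sum>d\<in>{1..N}. mangoldt d * of_bool (\<not> prime d)) \<le> sqrt N * (log 2 N + 1) * ln N"
proof -
  define D where "D = {d\<in>{1..N}. primepow d \<and> \<not> prime d}"
  define A where "A = {..nat \<lfloor>sqrt N\<rfloor>} - {0::nat}"
  define B where "B = {..nat \<lfloor>log 2 N\<rfloor>}"
  have "D \<subseteq> (\<lambda>(p,k). p ^ k) ` (A \<times> B)"
  proof
    fix d assume d: "d \<in> D"
    then obtain p k where pk: "prime p" "k > 0" "d = p ^ k" by (auto simp: D_def primepow_def)
    have "k \<noteq> 1" using d pk by (auto simp: D_def)
    then have "k \<ge> 2" using pk by linarith
    have p2: "p \<ge> 2" using pk prime_ge_2_nat by blast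
    have dN: "d \<le> N" using d by (auto simp: D_def)
    have "p ^ 2 \<le> p ^ k" using \<open>k \<ge> 2\<close> p2 by (intro power_increasing) auto
    then have "p ^ 2 \<le> N" using pk dN by simp
    then have "real (p ^ 2) \<le> real N" by (rule of_nat_mono)
    then have "real p \<le> sqrt N" by (simp add: real_le_rsqrt)
    then have "p \<in> A" using p2 by (auto simp: A_def le_nat_floor)
    have "2 ^ k \<le> p ^ k" using p2 by (intro power_mono) auto
    then have "2 ^ k \<le> N" using pk dN by linarith
    then have "real (2 ^ k) \<le> real N" by (rule of_nat_mono)
    then have "real k \<le> log 2 N" by (simp add: le_log_of_power)
    then have "k \<in> B" by (auto simp: B_def le_nat_floor)
    show "d \<in> (\<lambda>(p,k). p ^ k) ` (A \<times> B)" using \<open>p \<in> A\<close> \<open>k \<in> B\<close> pk by auto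
  qed
  then have "card D \<le> card ((\<lambda>(p,k). p ^ k) ` (A \<times> B))" by (intro card_mono) (auto simp: A_def B_def)
  also have "\<dots> \<le> card (A \<times> B)" by (intro card_image_le) (auto simp: A_def B_def)
  also have "\<dots> = nat \<lfloor>sqrt N\<rfloor> * (nat \<lfloor>log 2 N\<rfloor> + 1)" by (simp add: A_def B_def)
  finally have "card D \<le> nat \<lfloor>sqrt N\<rfloor> * (nat \<lfloor>log 2 N\<rfloor> + 1)" .
  then have "real (card D) \<le> real (nat \<lfloor>sqrt N\<rfloor> * (nat \<lfloor>log 2 N\<rfloor> + 1))"
    by (rule of_nat_mono)
  also have "\<dots> = real (nat \<lfloor>sqrt N\<rfloor>) * (real (nat \<lfloor>log 2 N\<rfloor>) + 1)"
    by (simp only: of_nat_mult of_nat_add of_nat_1)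
  also have "\<dots> \<le> sqrt N * (log 2 N + 1)"
    using assms by (intro mult_mono) auto
  finally have card: "real (card D) \<le> sqrt N * (log 2 N + 1)" .
  have "(\<Sum>d\<in>{1..N}. mangoldt d * of_bool (\<not> prime d)) = (\<Sum>d\<in>D. mangoldt d)"
    unfolding D_def by (rule sum.mono_neutral_cong_right) (auto simp: mangoldt_def)
  also have "\<dots> \<le> (\<Sum>d\<in>D. ln N)"
  proof (rule sum_mono)
    fix d assume "d \<in> D"
    then have "d \<ge> 1" "d \<le> N" by (auto simp: D_def)
    then have "mangoldt d \<le> ln d" "ln d \<le> ln N" by (auto intro!: mangoldt_le)
    then show "mangoldt d \<le> ln N" by linarith
  qed
  also have "\<dots> = real (card D) * ln N" by simp
  also have "\<dots> \<le> sqrt N * (log 2 N + 1) * ln N" using card assms by (intro mult_right_mono) auto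
  finally show ?thesis .
qed

lemma ln_prime_nonneg: "prime p \<Longrightarrow> 0 \<le> ln (real (p::nat))"
  using prime_ge_1_nat[of p] by simp

definition theta1 :: "nat \<Rightarrow> real" where
  "theta1 N = (\<Sum>p | prime p \<and> p \<le> N \<and> p mod 4 = 1. ln (real p))"

lemma psi_mod4_1_le_theta1:
  assumes "N \<ge> 1"
  shows "psi_mod4 1 N \<le> theta1 N + sqrt N * (log 2 N + 1) * ln N"
proof -
  have "psi_mod4 1 N \<le> (\<Sum>d\<in>{1..N}. mangoldt d * of_bool (prime d \<and> d mod 4 = 1)) + 
     (\<Sum>d\<in>{1..N}. mangoldt d * of_bool (\<not> prime d))"
    unfolding psi_mod4_def sum.distrib[symmetric] by (rule sum_mono) (auto simp: mangoldt_nonneg)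
  also have "(\<Sum>d\<in>{1..N}. mangoldt d * of_bool (prime d \<and> d mod 4 = 1)) = theta1 N"
    unfolding theta1_def by (rule sum.mono_neutral_cong_right) (auto simp: prime_ge_Suc_0_nat)
  also note sum_mangoldt_not_prime_le[OF assms]
  finally show ?thesis by simp
qed

lemma cheb_psi_le_psi_mod4:
  assumes "N \<ge> 1"
  shows "cheb_psi N \<le> psi_mod4 1 N + psi_mod4 3 N + ln 2 + sqrt N * (log 2 N + 1) * ln N"
proof -
  have "cheb_psi N \<le> psi_mod4 1 N + psi_mod4 3 N + (\<Sum>d\<in>{1..N}. mangoldt d * of_bool (d = 2)) + 
     (\<Sum>d\<in>{1..N}. mangoldt d * of_bool (\<not> prime d))"
    unfolding psi_mod4_def cheb_psi_def sum.distrib[symmetric]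
  proof (rule sum_mono)
    fix d assume "d \<in> {1..N}"
    have "d mod 4 = 1 \<or> d mod 4 = 3 \<or> d = 2 \<or> \<not> prime d"
    proof (rule ccontr)
      assume *: "\<not> (d mod 4 = 1 \<or> d mod 4 = 3 \<or> d = 2 \<or> \<not> prime d)"
      then have "odd d" using prime_odd_nat[of d] prime_ge_2_nat[of d] by (metis le_neq_implies_less)
      then show False using * mod4_cases[of d] by presburger
    qed
    then show "mangoldt d \<le> mangoldt d * of_bool (d mod 4 = 1) + mangoldt d * of_bool (d mod 4 = 3) +
         mangoldt d * of_bool (d = 2) + (mangoldt d :: real) * of_bool (\<not> prime d)"
      using mangoldt_nonneg[of d] by auto
  qed
  also have "(\<Sum>d\<in>{1..N}. mangoldt d * of_bool (d = 2)) \<le> ln (2::real)"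
  proof -
    have "(\<Sum>d\<in>{1..N}. mangoldt d * of_bool (d = 2)) = (\<Sum>d\<in>{1..N}. if d = 2 then mangoldt 2 else (0::real))"
      by (rule sum.cong) auto
    also have "\<dots> \<le> mangoldt 2" by (simp add: sum.delta mangoldt_nonneg)
    finally show ?thesis by simp
  qed
  also note sum_mangoldt_not_prime_le[OF assms]
  finally show ?thesis by simp
qed

text \<open>Three rounds of \<open>psi_mod4_3_le\<close> shrink the remainder to psi(N div 27) <=
  4N/27, well below the lower bound 2N/3 available for psi(N).\<close>

lemma psi_mod4_3_le': "psi_mod4 3 N \<le> 3 * psi_mod4 1 N + 3 * ln (real N + 1) + 4 / 27 * real N"
proof -
  have 1: "psi_mod4 3 (N div 3) \<le> psi_mod4 3 (N div 3 div 3) + psi_mod4 1 N + ln (real N + 1)"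
    using psi_mod4_3_le[of "N div 3"] psi_mod4_mono[of "N div 3" N 1] 
      ln_le_cancel_iff[of "real (N div 3) + 1" "real N + 1"] by linarith
  have 2: "psi_mod4 3 (N div 3 div 3) \<le> psi_mod4 3 (N div 3 div 3 div 3) + psi_mod4 1 N + ln (real N + 1)"
    using psi_mod4_3_le[of "N div 3 div 3"] psi_mod4_mono[of "N div 3 div 3" N 1] 
      ln_le_cancel_iff[of "real (N div 3 div 3) + 1" "real N + 1"] by linarith
  have "N div 3 div 3 div 3 = N div 27" by (simp add: div_mult2_eq[symmetric])
  then have "psi_mod4 3 (N div 3 div 3 div 3) \<le> 4 * real (N div 27)"
    using psi_mod4_le_cheb_psi[of 3 "N div 27"] cheb_psi_le[of "N div 27"] by simp
  moreover have "real (N div 27) \<le> real N / 27" by (simp add: of_nat_div_le_of_nat)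
  ultimately show ?thesis using 1 2 psi_mod4_3_le[of N] by linarith
qed

text \<open>Up to lower order terms 4 psi(N; 4, 1) >= (2/3 - 4/27) N, which exceeds N/2, so 1/10
  leaves room. The prime power error occurs five times: once in splitting psi and four times in
  passing from \<open>psi_mod4 1\<close> to \<open>theta1\<close>.\<close>

lemma theta1_ge: "eventually (\<lambda>N. theta1 N \<ge> real N / 10) at_top"
proof -
  have "eventually (\<lambda>N::nat. 2 / 3 * real N - ln 2 - ln (real N) - ln 2 - 3 * ln (real N + 1) - 4 / 27 * real N
     - 5 * (sqrt (real N) * (log 2 (real N) + 1) * ln (real N)) \<ge> 4 * real N / 10) at_top"
    by real_asymp
  moreover have "eventually (\<lambda>N::nat. N \<ge> 2) at_top" by (rule eventually_ge_at_top)
  ultimately show ?thesis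
  proof eventually_elim
    case (elim N)
    have "2 / 3 * real N \<le> ln 2 * real N" using ln2_ge_two_thirds by (intro mult_right_mono) auto
    then have "2 / 3 * real N - ln 2 - ln (real N) \<le> cheb_psi N"
      using cheb_psi_ge[OF elim(2)] by (simp add: mult.commute)
    with elim psi_mod4_3_le'[of N] cheb_psi_le_psi_mod4[of N] psi_mod4_1_le_theta1[of N]
    show ?case by linarith
  qed
qed

text \<open>The threshold is on M/m alone because \<open>m\<close> will grow with \<open>M\<close>.
  Discarding the primes up to M/(200m) costs at most 4M/(200m) = M/(50m), a fifth of the main term
  M/(10m); this is the origin of 200.\<close>

lemma card_primes_1_mod_4_ge:
  "eventually (\<lambda>Y. \<forall>M m :: nat. m \<ge> 1 \<longrightarrow> real M / real m \<ge> Y \<longrightarrow>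
     real (card {p. prime p \<and> p mod 4 = 1 \<and> M < 200 * m * p \<and> m * p \<le> M}) \<ge> real M / (20 * real m * ln (real M))) at_top"
proof -
  let ?P = "\<lambda>m M. {p. prime p \<and> p mod 4 = 1 \<and> M < 200 * m * p \<and> m * p \<le> M}"
  let ?Q = "\<lambda>m M. {p. prime p \<and> p \<le> M div (200 * m)}"
  obtain N0 where N0: "\<And>N. N \<ge> N0 \<Longrightarrow> theta1 N \<ge> real N / 10"
    using theta1_ge by (auto simp: eventually_at_top_linorder)
  have "\<forall>M m :: nat. m \<ge> 1 \<longrightarrow> real M / real m \<ge> Y \<longrightarrow>
     real (card (?P m M)) \<ge> real M / (20 * real m * ln (real M))"
    if Y: "Y \<ge> real N0 + 4" for Y
  proof (intro allI impI)
    fix M m :: nat assume m: "m \<ge> 1" and Ym: "real M / real m \<ge> Y"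
    define P where "P = ?P m M"
    have "real M \<ge> 4 * real m" 
    proof -
      have "4 \<le> real M / real m" using Y Ym by linarith
      then show ?thesis using m by (simp add: pos_le_divide_eq)
    qed
    then have M: "M \<ge> 4" using m by linarith
    have P_le: "p \<le> M" if "p \<in> P" for p
    proof -
      have "1 * p \<le> m * p" using m by (intro mult_le_mono1)
      moreover have "m * p \<le> M" using that by (simp add: P_def)
      ultimately show ?thesis by linarith
    qed
    then have fin: "finite P" by (intro finite_subset[of P "{..M}"]) auto
    have div_gt: "real M / real m - 1 \<le> real (M div m)"
    proof -
      have "M \<le> m * (M div m) + m"
        using mult_div_mod_eq[of m M] mod_less_divisor[of m M] m by linarith
      then have "real M \<le> real (m * (M div m) + m)" by (rule of_nat_mono)
      then have "real M / real m \<le> (real m * real (M div m) + real m) / real m"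
        using m by (intro divide_right_mono) simp_all
      also have "\<dots> = real (M div m) + 1" using m by (simp add: field_simps)
      finally show ?thesis by simp
    qed
    have "real N0 \<le> real (M div m)" using div_gt Y Ym by linarith
    then have "N0 \<le> M div m" by (simp only: of_nat_le_iff)
    then have "real (M div m) / 10 \<le> theta1 (M div m)" by (rule N0)
    then have th: "theta1 (M div m) \<ge> (real M / real m - 1) / 10"
      using divide_right_mono[OF div_gt, of 10] by (meson order.trans zero_le_numeral)
    have "theta1 (M div m) \<le> (\<Sum>p\<in>P. ln (real p)) + cheb_psi (M div (200 * m))"
    proof -
      have "theta1 (M div m) \<le> (\<Sum>p\<in>P \<union> ?Q m M. ln (real p))"
        unfolding theta1_def
      proof (rule sum_mono2)
        show "{p. prime p \<and> p \<le> M div m \<and> p mod 4 = 1} \<subseteq> P \<union> ?Q m M"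
        proof
          fix p assume p: "p \<in> {p. prime p \<and> p \<le> M div m \<and> p mod 4 = 1}"
          then have "m * p \<le> M" using m by (simp add: less_eq_div_iff_mult_less_eq mult.commute)
          moreover have "p \<le> M div (200 * m)" if "\<not> M < 200 * m * p"
            using that m by (simp add: less_eq_div_iff_mult_less_eq mult_ac)
          ultimately show "p \<in> P \<union> ?Q m M" using p unfolding P_def by blast
        qed
        show "finite (P \<union> ?Q m M)" using fin by simp
        show "0 \<le> ln (real p)" if "p \<in> P \<union> ?Q m M - {p. prime p \<and> p \<le> M div m \<and> p mod 4 = 1}" for p
          using that by (intro ln_prime_nonneg) (auto simp: P_def)
      qed
      also have "\<dots> \<le> (\<Sum>p\<in>P. ln (real p)) + (\<Sum>p | prime p \<and> p \<le> M div (200 * m). ln (real p))"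
      proof -
        have "0 \<le> (\<Sum>p\<in>P \<inter> ?Q m M. ln (real p))"
          by (intro sum_nonneg ln_prime_nonneg) auto
        then show ?thesis using fin by (subst sum_Un) simp_all
      qed
      also have "(\<Sum>p | prime p \<and> p \<le> M div (200 * m). ln (real p)) \<le> cheb_psi (M div (200 * m))"
      proof -
        have "(\<Sum>p | prime p \<and> p \<le> M div (200 * m). ln (real p)) = (\<Sum>p | prime p \<and> p \<le> M div (200 * m). mangoldt p)"
          by (rule sum.cong) auto
        also have "\<dots> \<le> cheb_psi (M div (200 * m))"
          unfolding cheb_psi_def by (rule sum_mono2) (auto simp: mangoldt_nonneg prime_ge_Suc_0_nat)
        finally show ?thesis .
      qed
      finally show ?thesis by simp
    qed
    also have "(\<Sum>p\<in>P. ln (real p)) \<le> (\<Sum>p\<in>P. ln (real M))"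
    proof (rule sum_mono)
      fix p assume "p \<in> P"
      have "p \<ge> 1" using \<open>p \<in> P\<close> prime_ge_1_nat unfolding P_def by blast
      moreover have "p \<le> M" using \<open>p \<in> P\<close> by (rule P_le)
      ultimately show "ln (real p) \<le> ln (real M)" by simp
    qed
    also have "\<dots> = real (card P) * ln (real M)" by simp
    also have "cheb_psi (M div (200 * m)) \<le> 4 * real (M div (200 * m))" by (rule cheb_psi_le)
    also have "real (M div (200 * m)) \<le> real M / (200 * real m)"
      using of_nat_div_le_of_nat[of M "200 * m", where ?'a = real] by simp
    finally have "(real M / real m - 1) / 10 \<le> real (card P) * ln (real M) + 4 * (real M / (200 * real m))"
      using th by linarith
    also have "4 * (real M / (200 * real m)) = real M / real m / 50" by simp
    finally have main: "(real M / real m - 1) / 10 \<le> real (card P) * ln (real M) + real M / real m / 50" .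
    have "real M / real m / 20 \<le> real (card P) * ln (real M)"
    proof -
      \<comment> \<open>Here r = M/m. The hypothesis r >= 4 pays for the 1 lost in rounding M/m
        down.\<close>
      have "r / 20 \<le> t" if "(r - 1) / 10 \<le> t + r / 50" "r \<ge> 4" for r t :: real
        using that by simp
      from this[OF main] show ?thesis using Ym Y by linarith
    qed
    moreover have "ln (real M) > 0" using M by simp
    ultimately show "real M / (20 * real m * ln (real M)) \<le> real (card P)"
      using m by (simp add: divide_simps mult_ac)
  qed
  then show ?thesis unfolding eventually_at_top_linorder by blast
qed

section \<open>Primes in arithmetic progressions\<close>

text \<open>Legendre's recursion: the exponent in n! is m plus the exponent in m!, where m = n div p
  and 2m <= n.\<close>

lemma multiplicity_fact_less:
  fixes p n :: nat
  assumes "prime p" "n > 0"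
  shows "multiplicity p (fact n :: nat) < n"
  using assms(2)
proof (induction n rule: less_induct)
  case (less n)
  have p: "p \<ge> 2" "p > 0" using assms(1) prime_ge_2_nat prime_gt_0_nat by auto
  define m where "m = n div p"
  have fin: "finite {1..n}" by simp
  have "multiplicity p (fact n :: nat) = (\<Sum>k\<in>{1..n}. multiplicity p k)"
    unfolding fact_prod of_nat_id
    by (subst prime_elem_multiplicity_prod_distrib) (use assms(1) in auto)
  also have "\<dots> = (\<Sum>k\<in>(\<lambda>j. p * j) ` {1..m}. multiplicity p k)"
  proof (rule sum.mono_neutral_right)
    show "(\<lambda>j. p * j) ` {1..m} \<subseteq> {1..n}"
      using p by (auto simp: m_def less_eq_div_iff_mult_less_eq mult.commute Suc_le_eq)
    show "\<forall>i\<in>{1..n} - (\<lambda>j. p * j) ` {1..m}. multiplicity p i = 0"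
    proof
      fix i assume i: "i \<in> {1..n} - (\<lambda>j. p * j) ` {1..m}"
      have "\<not> p dvd i"
      proof
        assume "p dvd i"
        then obtain j where j: "i = p * j" by auto
        then have "j \<in> {1..m}" using i p by (auto simp: m_def less_eq_div_iff_mult_less_eq mult.commute Suc_le_eq)
        then show False using i j by auto
      qed
      then show "multiplicity p i = 0" by (rule not_dvd_imp_multiplicity_0)
    qed
  qed auto
  also have "\<dots> = (\<Sum>j\<in>{1..m}. multiplicity p (p * j))"
    using p by (subst sum.reindex) (auto simp: inj_on_def)
  also have "\<dots> = (\<Sum>j\<in>{1..m}. 1 + multiplicity p j)"
    by (rule sum.cong) (use p assms(1) in \<open>auto simp: multiplicity_times_same prime_elem_multiplicity_mult_distrib\<close>)
  also have "\<dots> = m + multiplicity p (fact m :: nat)"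
    unfolding fact_prod of_nat_id sum.distrib
    by (subst prime_elem_multiplicity_prod_distrib) (use assms(1) in auto)
  finally have eq: "multiplicity p (fact n :: nat) = m + multiplicity p (fact m :: nat)" .
  show ?case
  proof (cases "m = 0")
    case True then show ?thesis using eq less by simp
  next
    case False
    have "2 * m \<le> p * m" using p by (intro mult_le_mono1) auto
    also have "p * m \<le> n" by (simp add: m_def)
    finally have "2 * m \<le> n" .
    moreover have "m < n" using \<open>2 * m \<le> n\<close> False by linarith
    ultimately show ?thesis using eq less.IH[of m] False by linarith
  qed
qed

text \<open>Checked prime by prime. If p divides \<open>e\<close>, then \<open>e ^ K\<close> already
  contains the full power of p in K!. Otherwise \<open>e\<close> is invertible modulo that power,
  and the progression becomes e^K times a product of K consecutive integers, which K!
  divides.\<close>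

lemma fact_dvd_power_mult_prod_progression:
  fixes e c :: nat
  shows "fact K dvd e ^ K * (\<Prod>k<K. e * k + c)"
proof (cases "e ^ K * (\<Prod>k<K. e * k + c) = 0 \<or> K = 0")
  case True then show ?thesis by (metis dvd_0_right fact_0 one_dvd)
next
  case False
  let ?R = "(\<Prod>k<K. e * k + c)"
  from False have nz: "e ^ K * ?R \<noteq> 0" and "K > 0" by auto
  then have "e > 0" by (cases e) auto
  show ?thesis
  proof (rule multiplicity_le_imp_dvd)
    fix p :: nat assume p: "prime p"
    let ?v = "multiplicity p (fact K :: nat)"
    have "p ^ ?v dvd e ^ K * ?R"
    proof (cases "p dvd e")
      case True
      have "?v \<le> K" using multiplicity_fact_less[OF p \<open>K > 0\<close>] by simp
      then have "p ^ ?v dvd p ^ K" by (rule le_imp_power_dvd)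
      also have "\<dots> dvd e ^ K" using True by (rule dvd_power_same)
      finally show ?thesis by simp
    next
      case False
      then have "coprime e (p ^ ?v)" using p by (metis coprime_commute coprime_power_left_iff prime_imp_coprime)
      then obtain x where x: "[e * x = Suc 0] (mod (p ^ ?v))" using cong_solve_coprime_nat by blast
      define c' where "c' = x * c"
      have c': "[e * c' = c] (mod (p ^ ?v))"
        using cong_scalar_right[OF x, of c] by (simp add: c'_def mult_ac)
      have "[?R = (\<Prod>k<K. e * k + e * c')] (mod (p ^ ?v))"
        by (intro cong_prod cong_add cong_refl cong_sym[OF c'])
      also have "(\<Prod>k<K. e * k + e * c') = e ^ K * (\<Prod>k<K. k + c')"
        by (simp add: prod.distrib distrib_left[symmetric])
      finally have cong: "[?R = e ^ K * (\<Prod>k<K. k + c')] (mod (p ^ ?v))" .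
      have "(fact K :: int) dvd pochhammer (int c') K" by (rule fact_dvd_pochhammer)
      also have "pochhammer (int c') K = int (\<Prod>k<K. k + c')"
        by (simp add: pochhammer_prod atLeast0LessThan add.commute)
      finally have "int (fact K) dvd int (\<Prod>k<K. k + c')" by (simp only: of_nat_fact)
      then have "fact K dvd (\<Prod>k<K. k + c')" by (simp only: int_dvd_int_iff)
      then have "p ^ ?v dvd e ^ K * (\<Prod>k<K. k + c')"
        by (rule dvd_mult[OF dvd_trans[OF multiplicity_dvd]])
      then have "p ^ ?v dvd ?R" by (simp only: cong_dvd_iff[OF cong])
      then show ?thesis by (rule dvd_mult)
    qed
    then show "?v \<le> multiplicity p (e ^ K * ?R)"
      using not_prime_unit p by (intro multiplicity_geI[OF nz]) blast+
  qed auto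
qed

lemma prod_primes_dvd:
  fixes Q :: nat
  assumes "finite P" "\<And>p. p \<in> P \<Longrightarrow> prime p \<and> p dvd Q"
  shows "\<Prod>P dvd Q"
  using assms
proof (induction P rule: finite_induct)
  case (insert p P)
  have "coprime p q" if "q \<in> P" for q
    using insert that by (intro primes_coprime) auto
  then have "coprime p (\<Prod>P)" by (intro prod_coprime_right)
  then show ?case using insert by (auto intro!: divides_mult)
qed simp

text \<open>These primes divide the quotient of \<open>e\<^sup>K (e \<cdot> 0 + c) \<dots> (e (K - 1) + c)\<close> by \<open>K!\<close>, which is at most \<open>e\<^bsup>2K\<^esup>\<close>.\<close>

lemma sum_ln_primes_progression_le:
  fixes e c K :: nat
  assumes "e \<ge> 1" "K \<ge> 1" "finite P"
    and P: "\<And>p. p \<in> P \<Longrightarrow> prime p \<and> K < p \<and> p \<le> e * K \<and> [p = c] (mod e)"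
  shows "(\<Sum>p\<in>P. ln (real p)) \<le> 2 * real K * ln (real e)"
proof -
  \<comment> \<open>The representative is taken in 1..e, not 0..e-1: all factors e k + c0 are then
    positive and at most e (k + 1), and p <= e K still forces k < K.\<close>
  define c0 where "c0 = (if c mod e = 0 then e else c mod e)"
  have c0: "1 \<le> c0" "c0 \<le> e" using assms(1) by (auto simp: c0_def less_imp_le)
  have c0_mod: "c0 mod e = c mod e" by (auto simp: c0_def)
  define R where "R = (\<Prod>k<K. e * k + c0)"
  obtain Q where Q: "e ^ K * R = fact K * Q"
    using fact_dvd_power_mult_prod_progression[of K e c0] by (auto simp: R_def dvd_def)
  have R_pos: "R > 0" using c0 by (auto simp: R_def)
  then have "Q > 0" using Q assms(1) by (metis gr0I mult_0_right mult_is_0 power_not_zero not_one_le_zero)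
  have "R \<le> (\<Prod>k<K. e * (k + 1))" unfolding R_def using c0 by (intro prod_mono) auto
  also have "\<dots> = e ^ K * fact K"
    unfolding fact_prod_Suc by (simp only: prod.distrib prod_constant card_lessThan atLeast0LessThan Suc_eq_plus1) simp
  finally have "e ^ K * R \<le> e ^ K * (e ^ K * fact K)" by simp
  also have "e ^ K * (e ^ K * fact K) = fact K * (e ^ K * e ^ K)" by (simp only: mult_ac)
  finally have "fact K * Q \<le> fact K * (e ^ K * e ^ K)" by (simp only: Q)
  then have Q_le: "Q \<le> e ^ (2 * K)" by (simp add: mult_2 power_add)
  have p_dvd: "p dvd Q" if "p \<in> P" for p
  proof -
    have p: "prime p" "K < p" "p \<le> e * K" "p mod e = c mod e"
      using P[OF that] by (simp_all add: unique_euclidean_semiring_class.cong_def)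
    have "c0 \<le> p"
    proof (cases "c mod e = 0")
      case True
      then have "e dvd p" using p by auto
      then show ?thesis using p prime_gt_0_nat[OF p(1)] True by (auto simp: c0_def dest: dvd_imp_le)
    next
      case False
      then have "c0 = p mod e" using p by (simp add: c0_def)
      then show ?thesis by simp
    qed
    then have "e dvd p - c0" using p c0_mod by (metis mod_eq_dvd_iff_nat)
    then obtain k where k: "p - c0 = e * k" by auto
    then have pk: "p = e * k + c0" using \<open>c0 \<le> p\<close> by simp
    have "e * k < e * K" using pk p c0 by linarith
    then have "k < K" by simp
    have "p dvd R" unfolding R_def pk using \<open>k < K\<close> by (intro dvd_prodI) auto
    then have "p dvd fact K * Q" using Q by (metis dvd_mult)
    \<comment> \<open>Here \<open>K < p\<close> enters: p survives the division by K!.\<close>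
    moreover have "\<not> p dvd fact K" using p by (simp add: prime_dvd_fact_iff)
    ultimately show ?thesis using p(1) prime_dvd_mult_iff by blast
  qed
  have "\<Prod>P dvd Q"
    using assms(3) P p_dvd by (intro prod_primes_dvd) auto
  then have "\<Prod>P \<le> e ^ (2 * K)" using \<open>Q > 0\<close> Q_le by (meson dvd_imp_le le_trans)
  then have "real (\<Prod>P) \<le> real (e ^ (2 * K))" by (rule of_nat_mono)
  then have "(\<Prod>p\<in>P. real p) \<le> real e ^ (2 * K)" by simp
  moreover have pos: "(\<Prod>p\<in>P. real p) > 0" using P by (intro prod_pos) (auto simp: prime_gt_0_nat)
  ultimately have "ln (\<Prod>p\<in>P. real p) \<le> ln (real e ^ (2 * K))" by (intro ln_mono) auto
  also have "ln (real e ^ (2 * K)) = 2 * real K * ln (real e)" using assms(1) by (simp add: ln_realpow)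
  also have "ln (\<Prod>p\<in>P. real p) = (\<Sum>p\<in>P. ln (real p))"
    using assms(3) P by (intro ln_prod) (auto simp: prime_gt_0_nat)
  finally show ?thesis .
qed

section \<open>Sums of two squares\<close>

text \<open>Thue's argument. With r^2 = -1 modulo p, more than p pairs (u, v) have entries at most
  sqrt p, so two of them agree in u + r v modulo p. Their difference (x, y) makes x^2 + y^2 a
  multiple of p strictly between 0 and 2p.\<close>

lemma prime_1_mod_4_sum_of_two_squares:
  fixes p :: nat
  assumes "prime p" "p mod 4 = 1"
  shows "\<exists>u v. p = u\<^sup>2 + v\<^sup>2"
proof -
  have p2: "p > 2" using assms prime_ge_2_nat[of p] by (cases "p = 2") auto
  have "QuadRes (int p) (-1)"
  proof (rule ccontr)
    assume nq: "\<not> QuadRes (int p) (-1)"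
    have "\<not> [-1 = 0] (mod int p)" using p2 by (simp add: cong_iff_dvd_diff)
    then have "Legendre (-1) (int p) = -1" using nq by (simp add: Legendre_def)
    moreover have "[Legendre (-1) (int p) = (-1) ^ ((p - 1) div 2)] (mod int p)"
      using assms p2 by (intro euler_criterion) auto
    moreover have "even ((p - 1) div 2)" using assms(2) by presburger
    ultimately have "[-1 = 1] (mod int p)" by simp
    then have "int p dvd 2" by (simp add: cong_iff_dvd_diff)
    then show False using p2 by (auto dest: zdvd_imp_le)
  qed
  then obtain r where r: "[r\<^sup>2 = -1] (mod int p)" by (auto simp: QuadRes_def)
  define k where "k = floor_sqrt p"
  have k1: "k\<^sup>2 \<le> p" and k2: "p < (k + 1)\<^sup>2" using Suc_floor_sqrt_power2_gt[of p] by (auto simp: k_def)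
  have "k\<^sup>2 \<noteq> p" using assms(1) by (auto simp: prime_power_iff)
  then have k1': "k\<^sup>2 < p" using k1 by simp
  define A where "A = {0..k} \<times> {0..k}"
  define h where "h = (\<lambda>(u::nat, v::nat). nat ((int u + r * int v) mod int p))"
  have "h ` A \<subseteq> {..<p}" using p2 by (auto simp: h_def nat_less_iff)
  then have "card (h ` A) \<le> p" by (metis card_lessThan card_mono finite_lessThan)
  also have "p < card A" using k2 by (simp add: A_def power2_eq_square)
  finally have "\<not> inj_on h A" using pigeonhole by blast
  then obtain u v u' v' where uv: "(u, v) \<in> A" "(u', v') \<in> A" "h (u, v) = h (u', v')" "(u, v) \<noteq> (u', v')"
    by (auto simp: inj_on_def)
  define x y where "x = int u - int u'" and "y = int v - int v'"
  have "(int u + r * int v) mod int p = (int u' + r * int v') mod int p"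
    using uv(3) p2 by (simp add: h_def eq_nat_nat_iff)
  then have "[int u + r * int v = int u' + r * int v'] (mod int p)" by (simp add: unique_euclidean_semiring_class.cong_def)
  then have "int p dvd x + r * y" by (simp add: cong_iff_dvd_diff x_def y_def algebra_simps)
  then have "int p dvd (x + r * y) * (x - r * y)" by (rule dvd_mult2)
  then have "int p dvd x\<^sup>2 - r\<^sup>2 * y\<^sup>2" by (simp add: algebra_simps power2_eq_square)
  moreover have "int p dvd (r\<^sup>2 + 1) * y\<^sup>2" using r by (intro dvd_mult2) (simp add: cong_iff_dvd_diff)
  ultimately have "int p dvd (x\<^sup>2 - r\<^sup>2 * y\<^sup>2) + (r\<^sup>2 + 1) * y\<^sup>2" by (rule dvd_add)
  then have dvd: "int p dvd x\<^sup>2 + y\<^sup>2" by (simp add: algebra_simps)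
  have "\<bar>x\<bar> \<le> int k" "\<bar>y\<bar> \<le> int k" using uv by (auto simp: A_def x_def y_def)
  then have "x\<^sup>2 \<le> (int k)\<^sup>2" "y\<^sup>2 \<le> (int k)\<^sup>2"
    by (metis abs_le_square_iff abs_of_nat)+
  moreover have "(int k)\<^sup>2 < int p" using k1' by (metis of_nat_less_iff of_nat_power)
  ultimately have lt: "x\<^sup>2 + y\<^sup>2 < 2 * int p" by linarith
  have "x \<noteq> 0 \<or> y \<noteq> 0" using uv by (auto simp: x_def y_def)
  then have pos: "x\<^sup>2 + y\<^sup>2 > 0" by (simp add: sum_power2_gt_zero_iff)
  obtain j where j: "x\<^sup>2 + y\<^sup>2 = int p * j" using dvd by (auto simp: dvd_def)
  have "j > 0" using j pos p2 by (simp add: zero_less_mult_iff)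
  moreover have "j < 2" using j lt p2 by simp
  ultimately have "j = 1" by simp
  then have "int p = int ((nat \<bar>x\<bar>)\<^sup>2 + (nat \<bar>y\<bar>)\<^sup>2)" using j by simp
  then show ?thesis by (metis of_nat_eq_iff)
qed

lemma sums_of_two_squares_mult:
  assumes "m \<in> sums_of_two_squares" "n \<in> sums_of_two_squares"
  shows "m * n \<in> sums_of_two_squares"
proof -
  obtain u v w z where m: "m \<ge> 1" "m = u\<^sup>2 + v\<^sup>2" and n: "n \<ge> 1" "n = w\<^sup>2 + z\<^sup>2"
    using assms by (auto simp: sums_of_two_squares_def)
  have "int (m * n) = (int u * int w + int v * int z)\<^sup>2 + (int u * int z - int v * int w)\<^sup>2"
    unfolding m n by (simp add: power2_eq_square algebra_simps)
  also have "\<dots> = int ((u * w + v * z)\<^sup>2 + (nat \<bar>int u * int z - int v * int w\<bar>)\<^sup>2)" by simp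
  finally have "m * n = (u * w + v * z)\<^sup>2 + (nat \<bar>int u * int z - int v * int w\<bar>)\<^sup>2"
    by (simp only: of_nat_eq_iff)
  moreover have "m * n \<ge> 1" using m n by simp
  ultimately show ?thesis unfolding sums_of_two_squares_def by blast
qed

text \<open>Unlike the sums of two squares, this set is closed under divisors (9 = 3^2 + 0^2, but 3
  is not a sum of two squares); \<open>sum_gcd_over_split_le\<close> divides common factors out of
  its elements.\<close>

definition split_nats :: "nat set" where
  "split_nats = {m. m \<ge> 1 \<and> (\<forall>p. prime p \<longrightarrow> p dvd m \<longrightarrow> p mod 4 = 1)}"

lemma one_in_split_nats [simp]: "1 \<in> split_nats" "Suc 0 \<in> split_nats"
  by (auto simp: split_nats_def)

lemma split_nats_ge_1: "m \<in> split_nats \<Longrightarrow> m \<ge> 1"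
  by (auto simp: split_nats_def)

lemma split_nats_dvd: "m \<in> split_nats \<Longrightarrow> k dvd m \<Longrightarrow> k \<in> split_nats"
  by (auto simp: split_nats_def Suc_le_eq intro!: Nat.gr0I intro: dvd_trans)

lemma split_nats_mult: "m \<in> split_nats \<Longrightarrow> n \<in> split_nats \<Longrightarrow> m * n \<in> split_nats"
  by (auto simp: split_nats_def prime_dvd_mult_iff)

lemma prime_in_split_nats: "prime p \<Longrightarrow> p mod 4 = 1 \<Longrightarrow> p \<in> split_nats"
  by (auto simp: split_nats_def prime_ge_Suc_0_nat dest: primes_dvd_imp_eq)

lemma split_nats_power: "m \<in> split_nats \<Longrightarrow> m ^ k \<in> split_nats"
  by (induction k) (auto intro: split_nats_mult)

lemma split_nats_subset: "split_nats \<subseteq> sums_of_two_squares"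
proof
  fix m assume "m \<in> split_nats"
  then show "m \<in> sums_of_two_squares"
  proof (induction m rule: less_induct)
    case (less m)
    show ?case
    proof (cases "m = 1")
      case True
      then have "m = 1\<^sup>2 + 0\<^sup>2" by simp
      then show ?thesis using True unfolding sums_of_two_squares_def by (metis (mono_tags, lifting) mem_Collect_eq order_refl)
    next
      case False
      then obtain p where p: "prime p" "p dvd m" using prime_factor_nat by blast
      then obtain k where k: "m = p * k" by auto
      have m: "m \<ge> 1" "p mod 4 = 1" using less.prems p by (auto simp: split_nats_def)
      have "k > 0" using k m by (intro Nat.gr0I) auto
      moreover have "p > 1" using p prime_gt_1_nat by blast
      ultimately have "k < m" using k by simp
      then have "k \<in> sums_of_two_squares" using less split_nats_dvd[of m k] k by auto
      moreover have "p \<in> sums_of_two_squares"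
        using prime_1_mod_4_sum_of_two_squares[OF p(1) m(2)] \<open>p > 1\<close> by (auto simp: sums_of_two_squares_def)
      ultimately show ?thesis using k sums_of_two_squares_mult by simp
    qed
  qed
qed

section \<open>Integers with all prime factors 1 modulo 4\<close>

text \<open>For n >= 1 this is a quarter of the number of integer pairs (x, y) with x^2 + y^2 =
  n.\<close>

definition chi4_conv :: "nat \<Rightarrow> real" where
  "chi4_conv n = (\<Sum>d | d dvd n. chi4 (n div d))"

lemma chi4_1 [simp]: "chi4 1 = 1" "chi4 (Suc 0) = 1" by (auto simp: chi4_def)

lemma chi4_power: "chi4 (p ^ k) = chi4 p ^ k"
  by (induction k) (auto simp: chi4_mult)

lemma divisors_prime_power_mult:
  fixes p n :: nat
  assumes "prime p" "\<not> p dvd n"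
  shows "bij_betw (\<lambda>(i, d). p ^ i * d) ({..k} \<times> {d. d dvd n}) {d. d dvd p ^ k * n}"
proof -
  have p0: "p > 1" using assms(1) prime_gt_1_nat by blast
  have "inj_on (\<lambda>(i, d). p ^ i * d) ({..k} \<times> {d. d dvd n})"
  proof (rule inj_onI, clarify)
    fix i d j d' assume d: "d dvd n" "d' dvd n" and eq: "p ^ i * d = p ^ j * d'"
    have nd: "\<not> p dvd d" "\<not> p dvd d'" using d assms(2) dvd_trans by blast+
    have nz: "d \<noteq> 0" "d' \<noteq> 0" using nd by (metis dvd_0_right)+
    have "multiplicity p (p ^ i * d) = i" "multiplicity p (p ^ j * d') = j"
      using assms(1) nd nz p0
      by (auto simp: prime_elem_multiplicity_mult_distrib not_dvd_imp_multiplicity_0 multiplicity_prime_power)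
    then have "i = j" using eq by simp
    then show "i = j \<and> d = d'" using eq p0 by simp
  qed
  moreover have "(\<lambda>(i, d). p ^ i * d) ` ({..k} \<times> {d. d dvd n}) = {d. d dvd p ^ k * n}"
  proof (intro equalityI subsetI)
    fix x assume "x \<in> (\<lambda>(i, d). p ^ i * d) ` ({..k} \<times> {d. d dvd n})"
    then show "x \<in> {d. d dvd p ^ k * n}" by (auto intro!: mult_dvd_mono le_imp_power_dvd)
  next
    fix x assume "x \<in> {d. d dvd p ^ k * n}"
    then obtain y d where "x = y * d" "y dvd p ^ k" "d dvd n"
      by (auto dest!: division_decomp)
    moreover then obtain i where "i \<le> k" "y = p ^ i" using assms(1) by (auto simp: divides_primepow_nat)
    ultimately show "x \<in> (\<lambda>(i, d). p ^ i * d) ` ({..k} \<times> {d. d dvd n})" by auto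
  qed
  ultimately show ?thesis by (simp add: bij_betw_def)
qed

lemma chi4_conv_prime_power_mult:
  assumes "prime p" "\<not> p dvd n"
  shows "chi4_conv (p ^ k * n) = (\<Sum>i\<le>k. chi4 p ^ i) * chi4_conv n"
proof -
  have p0: "p > 0" using assms(1) prime_gt_0_nat by blast
  have fin: "finite {d. d dvd n}" using assms(2) by (intro finite_divisors_nat) (auto intro!: Nat.gr0I)
  have "chi4_conv (p ^ k * n) = (\<Sum>(i,d)\<in>{..k} \<times> {d. d dvd n}. chi4 (p ^ k * n div (p ^ i * d)))"
    unfolding chi4_conv_def
    by (subst sum.reindex_bij_betw[OF divisors_prime_power_mult[OF assms, of k], symmetric]) (simp add: case_prod_unfold)
  also have "\<dots> = (\<Sum>(i,d)\<in>{..k} \<times> {d. d dvd n}. chi4 p ^ (k - i) * chi4 (n div d))"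
  proof (rule sum.cong[OF refl])
    fix x assume "x \<in> {..k} \<times> {d. d dvd n}"
    then obtain i d where x: "x = (i, d)" and i: "i \<in> {..k}" and d: "d dvd n" by auto
    from i have "p ^ k = p ^ i * p ^ (k - i)" by (simp add: power_add[symmetric])
    then have "p ^ k * n div (p ^ i * d) = (p ^ i * (p ^ (k - i) * n)) div (p ^ i * d)" by (simp add: mult_ac)
    also have "\<dots> = p ^ (k - i) * n div d" using p0 by simp
    also have "\<dots> = p ^ (k - i) * (n div d)" using d by (simp add: div_mult_swap)
    finally show "(case x of (i, d) \<Rightarrow> chi4 (p ^ k * n div (p ^ i * d))) = (case x of (i, d) \<Rightarrow> chi4 p ^ (k - i) * chi4 (n div d))"
      by (simp add: x chi4_mult chi4_power)
  qed
  also have "\<dots> = (\<Sum>i\<le>k. chi4 p ^ (k - i)) * chi4_conv n"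
    unfolding chi4_conv_def by (simp add: sum_product sum.cartesian_product)
  also have "(\<Sum>i\<le>k. chi4 p ^ (k - i)) = (\<Sum>i\<le>k. chi4 p ^ i)"
    by (rule sum.reindex_bij_witness[of _ "\<lambda>i. k - i" "\<lambda>i. k - i"]) auto
  finally show ?thesis .
qed

text \<open>The Dirichlet convolution of 1 and \<open>\<chi>\<^sub>4\<close> has average order \<open>\<pi>/4\<close>, and these decompositions bound it by a
  convolution square; whence the square root in the bound for \<open>split_harm\<close>.\<close>

definition split_decomps :: "nat \<Rightarrow> (nat \<times> nat \<times> nat \<times> nat) set" where
  "split_decomps n = {(k, q, m1, m2). 2 ^ k * q\<^sup>2 * m1 * m2 = n \<and> m1 \<in> split_nats \<and> m2 \<in> split_nats}"

lemma split_decomps_dvd: "(k, q, m1, m2) \<in> split_decomps n \<Longrightarrow> m1 dvd n"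
  by (auto simp: split_decomps_def)

lemma split_decomps_bounds:
  assumes "(k, q, m1, m2) \<in> split_decomps n" "n > 0"
  shows "k < n" "q \<in> {1..n}" "m1 \<in> {1..n}" "m2 \<in> {1..n}"
proof -
  have eq: "2 ^ k * q\<^sup>2 * m1 * m2 = n" using assms by (auto simp: split_decomps_def)
  then have pos: "q > 0" "m1 > 0" "m2 > 0" using assms(2) by (auto intro!: Nat.gr0I)
  have "2 ^ k dvd n" "q dvd n" "m1 dvd n" "m2 dvd n"
    unfolding eq[symmetric] by (auto simp: power2_eq_square)
  then have le: "2 ^ k \<le> n" "q \<le> n" "m1 \<le> n" "m2 \<le> n" using assms(2) by (auto dest: dvd_imp_le)
  then show "k < n" by (meson less_exp le_trans less_le_trans)
  show "q \<in> {1..n}" "m1 \<in> {1..n}" "m2 \<in> {1..n}" using le pos by auto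
qed

lemma finite_split_decomps: "n > 0 \<Longrightarrow> finite (split_decomps n)"
  by (rule finite_subset[of _ "{..<n} \<times> {1..n} \<times> {1..n} \<times> {1..n}"])
     (auto dest: split_decomps_bounds)

lemma card_split_decomps_mono:
  assumes "inj_on g (split_decomps n)" "g ` split_decomps n \<subseteq> split_decomps n'" "n' > 0"
  shows "real (card (split_decomps n)) \<le> real (card (split_decomps n'))"
  using card_inj_on_le[OF assms(1,2) finite_split_decomps[OF assms(3)]] by simp

text \<open>A full prime power p^a is split off. For p = 2 the local factor is 1 and p^a goes into
  2^k. For p = 1 modulo 4 it is a + 1, the number of ways to share p^a between m1 and m2. For p = 3
  modulo 4 it is 0 if a is odd, and 1 if a is even, when p^(a/2) goes into q.\<close>

lemma chi4_conv_le_card_split_decomps: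
  assumes "n > 0"
  shows "chi4_conv n \<le> real (card (split_decomps n))"
  using assms
proof (induction n rule: less_induct)
  case (less n)
  show ?case
  proof (cases "n = 1")
    case True
    have "(0, 1, 1, 1) \<in> split_decomps 1" by (auto simp: split_decomps_def)
    then have "card (split_decomps 1) \<noteq> 0" using finite_split_decomps[of 1] by auto
    then show ?thesis using True by (simp add: chi4_conv_def)
  next
    case False
    then obtain p where p: "prime p" "p dvd n" using prime_factor_nat by blast
    define a where "a = multiplicity p n"
    obtain n' where n': "n = p ^ a * n'" "\<not> p dvd n'"
      using multiplicity_decompose'[of n p] less.prems p(1) unfolding a_def by (metis not_prime_unit gr_implies_not0)
    have "a > 0" using n' p(2) by (intro Nat.gr0I) auto
    have n'0: "n' > 0" using n' by (intro Nat.gr0I) auto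
    let ?c = "\<lambda>n. real (card (split_decomps n))"
    have p1: "p > 1" using p(1) prime_gt_1_nat by blast
    then have "p ^ a > 1" using \<open>a > 0\<close> by (rule one_less_power)
    then have "n' < n" using n' n'0 by simp
    then have IH: "chi4_conv n' \<le> ?c n'" using less.IH n'0 by blast
    have rec: "chi4_conv n = (\<Sum>i\<le>a. chi4 p ^ i) * chi4_conv n'"
      unfolding n'(1) by (rule chi4_conv_prime_power_mult[OF p(1) n'(2)])
    consider "p = 2" | "p mod 4 = 1" | "p mod 4 = 3"
    proof -
      have "p = 2 \<or> odd p" using p(1) prime_odd_nat[of p] p1 by (metis le_neq_implies_less Suc_1 Suc_leI)
      then have "p = 2 \<or> p mod 4 = 1 \<or> p mod 4 = 3" using mod4_cases[of p] by presburger
      then show ?thesis using that by blast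
    qed
    then show ?thesis
    proof cases
      case 1
      have "(\<Sum>i\<le>a. chi4 p ^ i) = 1" using 1 by (simp add: chi4_def power_0_left)
      moreover have "?c n' \<le> ?c n"
        by (rule card_split_decomps_mono[of "\<lambda>(k, q, m1, m2). (k + a, q, m1, m2)"])
          (use 1 n' less.prems in \<open>auto simp: split_decomps_def inj_on_def power_add\<close>)
      ultimately show ?thesis using rec IH by simp
    next
      case 2
      have "(\<Sum>i\<le>a. chi4 p ^ i) = real (a + 1)" using 2 by (simp add: chi4_def)
      moreover have "(a + 1) * card (split_decomps n') \<le> card (split_decomps n)"
      proof -
        define g where "g = (\<lambda>(i, k::nat, q::nat, m1, m2). (k, q, p ^ i * m1, p ^ (a - i) * m2))"
        have "card (g ` ({..a} \<times> split_decomps n')) \<le> card (split_decomps n)"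
        proof (rule card_mono)
          show "g ` ({..a} \<times> split_decomps n') \<subseteq> split_decomps n"
          proof
            fix x assume "x \<in> g ` ({..a} \<times> split_decomps n')"
            then obtain i k q m1 m2 where x: "x = g (i, k, q, m1, m2)" and i: "i \<in> {..a}"
              and "(k, q, m1, m2) \<in> split_decomps n'" by auto
            then have m: "2 ^ k * q\<^sup>2 * m1 * m2 = n'" "m1 \<in> split_nats" "m2 \<in> split_nats"
              by (auto simp: split_decomps_def)
            have "p ^ a = p ^ i * p ^ (a - i)" using i by (simp add: power_add[symmetric])
            then have "2 ^ k * q\<^sup>2 * (p ^ i * m1) * (p ^ (a - i) * m2) = n"
              unfolding n'(1) m(1)[symmetric] by (simp add: mult_ac)
            then show "x \<in> split_decomps n"
              using x m prime_in_split_nats[OF p(1) 2]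
              by (auto simp: g_def split_decomps_def intro!: split_nats_mult split_nats_power)
          qed
        qed (rule finite_split_decomps[OF less.prems])
        moreover have "inj_on g ({..a} \<times> split_decomps n')"
        proof (rule inj_onI)
          fix x y assume xy: "x \<in> {..a} \<times> split_decomps n'" "y \<in> {..a} \<times> split_decomps n'" "g x = g y"
          then obtain i k q m1 m2 i' k' q' m1' m2'
            where x: "x = (i, k, q, m1, m2)" and y: "y = (i', k', q', m1', m2')"
              and i: "i \<in> {..a}" "i' \<in> {..a}"
              and m: "(k, q, m1, m2) \<in> split_decomps n'" "(k', q', m1', m2') \<in> split_decomps n'"
            by (metis SigmaE prod.exhaust)
          have eq: "g (i, k, q, m1, m2) = g (i', k', q', m1', m2')" using xy x y by simp
          have dvd: "m1 dvd n'" "m1' dvd n'" using m by (auto dest: split_decomps_dvd)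
          have "inj_on (\<lambda>(i, d). p ^ i * d) ({..a} \<times> {d. d dvd n'})"
            using divisors_prime_power_mult[OF p(1) n'(2)] by (auto simp: bij_betw_def)
          then have "(i, m1) = (i', m1')"
            by (rule inj_onD) (use i dvd eq in \<open>auto simp: g_def\<close>)
          then show "x = y"
            using eq p1 by (auto simp: g_def x y)
        qed
        ultimately show ?thesis by (simp add: card_image card_cartesian_product)
      qed
      then have "real (a + 1) * ?c n' \<le> ?c n"
        by (metis of_nat_le_iff of_nat_mult)
      moreover have "real (a + 1) * chi4_conv n' \<le> real (a + 1) * ?c n'"
        using IH by (intro mult_left_mono) auto
      ultimately show ?thesis using rec by (metis order.trans)
    next
      case 3
      then have chi: "chi4 p = -1" by (simp add: chi4_def)
      have geo: "(\<Sum>i\<le>a. chi4 p ^ i) = of_bool (even a)" unfolding chi by (induction a) auto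
      show ?thesis
      proof (cases "even a")
        case True
        then obtain b where b: "a = 2 * b" by auto
        have "?c n' \<le> ?c n"
          by (rule card_split_decomps_mono[of "\<lambda>(k, q, m1, m2). (k, p ^ b * q, m1, m2)"])
            (use p1 b n' less.prems in \<open>auto simp: split_decomps_def inj_on_def power_mult_distrib power_mult[symmetric] mult.commute[of b]\<close>)
        then show ?thesis using rec IH geo True by simp
      next
        case False
        then show ?thesis using rec geo by simp
      qed
    qed
  qed
qed

definition split_harm :: "nat \<Rightarrow> real" where
  "split_harm z = (\<Sum>m\<in>split_nats \<inter> {1..z}. 1 / real m)"

lemma split_harm_nonneg: "split_harm z \<ge> 0"
  unfolding split_harm_def by (intro sum_nonneg) auto

text \<open>The partial sums of 1 - 1/3 + 1/5 - ... stay at or above 2/3. The invariant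
  \<open>B N\<close> is the size of the negative term still due before the next positive one, or 0
  if it has been paid.\<close>

lemma sum_chi4_over_id_ge:
  assumes "N \<ge> 1"
  shows "(\<Sum>j\<in>{1..N}. chi4 j / real j) \<ge> 2 / 3"
proof -
  define B where "B = (\<lambda>N. if N mod 4 = 1 then 1 / (real N + 2) else if N mod 4 = 2 then 1 / (real N + 1) else 0)"
  have "(\<Sum>j\<in>{1..N}. chi4 j / real j) \<ge> 2 / 3 + B N"
    using assms
  proof (induction N rule: dec_induct)
    case base
    then show ?case by (simp add: B_def)
  next
    case (step N)
    have rec: "(\<Sum>j\<in>{1..Suc N}. chi4 j / real j) = (\<Sum>j\<in>{1..N}. chi4 j / real j) + chi4 (Suc N) / (real N + 1)"
      by (simp add: add.commute)
    have frac: "1 / (real N + 3) \<le> 1 / (real N + 1)" by (simp add: frac_le)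
    have "B (Suc N) \<le> B N + chi4 (Suc N) / (real N + 1)"
      unfolding B_def Suc_mod_4 chi4_Suc using mod4_cases[of N] frac by (elim disjE) (auto simp: add_ac)
    then show ?case unfolding rec using step.IH by linarith
  qed
  moreover have "B N \<ge> 0" by (simp add: B_def)
  ultimately show ?thesis by linarith
qed

lemma sum_chi4_conv_ge: "(\<Sum>n\<in>{1..z}. chi4_conv n / real n) \<ge> 2 / 3 * harm z"
proof -
  have "(\<Sum>n\<in>{1..z}. chi4_conv n / real n) = (\<Sum>n\<in>{1..z}. \<Sum>d | d dvd n. chi4 (n div d) / (real d * real (n div d)))"
    unfolding chi4_conv_def sum_divide_distrib
    by (intro sum.cong refl) (auto simp flip: of_nat_mult)
  also have "\<dots> = (\<Sum>d\<in>{1..z}. \<Sum>j\<in>{1..z div d}. chi4 j / (real d * real j))"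
    by (rule sum_divisors_swap)
  also have "\<dots> = (\<Sum>d\<in>{1..z}. (1 / real d) * (\<Sum>j\<in>{1..z div d}. chi4 j / real j))"
    by (simp add: sum_distrib_left mult.commute)
  also have "\<dots> \<ge> (\<Sum>d\<in>{1..z}. (1 / real d) * (2 / 3))"
    by (intro sum_mono mult_left_mono sum_chi4_over_id_ge) (auto simp: Suc_le_eq div_greater_zero_iff)
  also have "(\<Sum>d\<in>{1..z}. (1 / real d) * (2 / 3)) = 2 / 3 * harm z"
    by (simp add: harm_def sum_distrib_left field_simps)
  finally show ?thesis .
qed

lemma sum_inverse_power2_le: "(\<Sum>k\<in>{..z}. 1 / 2 ^ k) \<le> (2::real)"
proof -
  have "(\<Sum>k\<in>{..z}. 1 / 2 ^ k) = 2 - 1 / (2::real) ^ z"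
    by (induction z) (auto simp: field_simps)
  then show ?thesis by simp
qed

lemma sum_inverse_squares_le: "(\<Sum>q\<in>{1..z}. 1 / (real q)\<^sup>2) \<le> 2"
proof -
  have "(\<Sum>q\<in>{1..z}. 1 / (real q)\<^sup>2) \<le> 2 - 1 / real z"
  proof (induction z)
    case (Suc z)
    show ?case
    proof (cases "z = 0")
      case False
      then have "1 / (real (Suc z))\<^sup>2 \<le> 1 / real z - 1 / real (Suc z)"
        by (simp add: divide_simps power2_eq_square)
      then show ?thesis using Suc by simp
    qed simp
  qed simp
  also have "\<dots> \<le> 2" by simp
  finally show ?thesis .
qed

text \<open>The weight 1/n of a decomposition is the product of the weights of its components, so
  dropping the constraint n <= z leaves four independent sums. Those over 2^k and q^2 are at most 2
  each; the other two are \<open>split_harm z\<close>.\<close>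

lemma sum_chi4_conv_le: "(\<Sum>n\<in>{1..z}. chi4_conv n / real n) \<le> 4 * (split_harm z)\<^sup>2"
proof -
  define w where "w = (\<lambda>(k, q, m1, m2). 1 / 2 ^ k * (1 / (real q)\<^sup>2 * (1 / real m1 * (1 / real m2))))"
  define S where "S = split_nats \<inter> {1..z}"
  have w: "w x = 1 / real n" if "x \<in> split_decomps n" for x n
  proof -
    obtain k q m1 m2 where x: "x = (k, q, m1, m2)" by (metis prod.exhaust)
    then have "n = 2 ^ k * q\<^sup>2 * m1 * m2" using that by (simp add: split_decomps_def)
    then have "real n = 2 ^ k * (real q)\<^sup>2 * real m1 * real m2" by simp
    then show ?thesis by (simp add: x w_def mult_ac)
  qed
  have "(\<Sum>n\<in>{1..z}. chi4_conv n / real n) \<le> (\<Sum>n\<in>{1..z}. real (card (split_decomps n)) / real n)"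
    by (intro sum_mono divide_right_mono chi4_conv_le_card_split_decomps) auto
  also have "\<dots> = (\<Sum>n\<in>{1..z}. \<Sum>x\<in>split_decomps n. w x)"
    by (rule sum.cong[OF refl]) (simp add: w)
  also have "\<dots> = (\<Sum>x\<in>(\<Union>n\<in>{1..z}. split_decomps n). w x)"
  proof (rule sum.UNION_disjoint[symmetric])
    show "\<forall>n\<in>{1..z}. finite (split_decomps n)" by (simp add: finite_split_decomps)
    show "\<forall>n\<in>{1..z}. \<forall>n'\<in>{1..z}. n \<noteq> n' \<longrightarrow> split_decomps n \<inter> split_decomps n' = {}"
      by (auto simp: split_decomps_def)
  qed simp
  also have "\<dots> \<le> (\<Sum>x\<in>{..z} \<times> {1..z} \<times> S \<times> S. w x)"
  proof (rule sum_mono2)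
    show "(\<Union>n\<in>{1..z}. split_decomps n) \<subseteq> {..z} \<times> {1..z} \<times> S \<times> S"
    proof
      fix x assume "x \<in> (\<Union>n\<in>{1..z}. split_decomps n)"
      then obtain n k q m1 m2 where x: "x = (k, q, m1, m2)" and n: "n \<in> {1..z}"
        and m: "(k, q, m1, m2) \<in> split_decomps n" by (metis UN_E prod.exhaust)
      from split_decomps_bounds[OF m] n m 
      show "x \<in> {..z} \<times> {1..z} \<times> S \<times> S" by (auto simp: x S_def split_decomps_def)
    qed
  qed (auto simp: w_def S_def)
  also have "\<dots> = (\<Sum>k\<in>{..z}. 1 / 2 ^ k) * ((\<Sum>q\<in>{1..z}. 1 / (real q)\<^sup>2) * (split_harm z * split_harm z))"
    unfolding w_def split_harm_def S_def[symmetric] sum_product sum.cartesian_product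
    by (simp add: case_prod_unfold)
  also have "\<dots> \<le> 2 * (2 * (split_harm z * split_harm z))"
    by (intro mult_mono sum_inverse_power2_le sum_inverse_squares_le mult_nonneg_nonneg sum_nonneg order.refl)
      (auto simp: split_harm_nonneg)
  finally show ?thesis by (simp add: power2_eq_square)
qed

lemma split_harm_ge:
  assumes "z \<ge> 1"
  shows "split_harm z \<ge> sqrt (ln (real z)) / 3"
proof -
  have "ln (real z) \<le> ln (real z + 1)" using assms by simp
  also have "\<dots> \<le> harm z" using ln_le_harm[of z] by simp
  finally have "2 / 3 * ln (real z) \<le> 2 / 3 * harm z" by simp
  also have "\<dots> \<le> 4 * (split_harm z)\<^sup>2" using sum_chi4_conv_ge[of z] sum_chi4_conv_le[of z] by linarith
  finally have "ln (real z) / 9 \<le> (split_harm z)\<^sup>2"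
    using zero_le_power2[of "split_harm z"] by linarith
  then have "sqrt (ln (real z) / 9) \<le> split_harm z"
    using split_harm_nonneg by (intro real_le_lsqrt) auto
  then show ?thesis by (simp add: real_sqrt_divide)
qed

section \<open>Polynomial congruences\<close>

text \<open>Replacing \<open>f\<close> by the divided difference \<open>(f - f(n\<^sub>0)) / (x - n\<^sub>0)\<close> lowers the degree; the product
  \<open>D\<close> of the differences to the remaining points clears the factors \<open>n - n\<^sub>0\<close> modulo \<open>e\<close>.\<close>

lemma dvd_lead_coeff_mult_differences:
  fixes f :: "int poly" and A :: "int set" and e X L :: int
  assumes "card A = Suc d" "A \<subseteq> {X..<X + L}" "degree f \<le> d" "\<And>n. n \<in> A \<Longrightarrow> e dvd poly f n"
  shows "\<exists>V. V \<noteq> 0 \<and> \<bar>V\<bar> \<le> L ^ (d\<^sup>2) \<and> e dvd Polynomial.coeff f d * V"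
  using assms
proof (induction d arbitrary: f A)
  case 0
  then obtain n where n: "A = {n}" by (metis card_1_singletonE One_nat_def)
  obtain c where "f = [:c:]" using 0 by (auto elim: degree_eq_zeroE)
  then show ?case using 0(4)[of n] n by (intro exI[of _ 1]) auto
next
  case (Suc d)
  have fin: "finite A" using Suc.prems(1) by (metis card.infinite nat.distinct(1))
  obtain n0 where n0: "n0 \<in> A" using Suc.prems(1) by fastforce
  define A' where "A' = A - {n0}"
  have A': "card A' = Suc d" "A' \<subseteq> {X..<X + L}" "finite A'"
    using Suc.prems n0 fin by (auto simp: A'_def)
  define g where "g = synthetic_div f n0"
  have fg: "[:- n0, 1:] * g + [:poly f n0:] = f" unfolding g_def by (rule synthetic_div_correct')
  have deg: "degree g \<le> d" using Suc.prems(3) by (simp add: g_def degree_synthetic_div)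
  have "Polynomial.coeff f (Suc d) = Polynomial.coeff g d - n0 * Polynomial.coeff g (Suc d)"
    by (subst fg[symmetric]) (simp add: mult_pCons_left)
  also have "Polynomial.coeff g (Suc d) = 0" using deg by (intro coeff_eq_0) auto
  finally have lead: "Polynomial.coeff f (Suc d) = Polynomial.coeff g d" by simp
  define D where "D = (\<Prod>n\<in>A'. n - n0)"
  have D0: "D \<noteq> 0" using A' by (auto simp: D_def A'_def)
  have "L \<ge> 0" using n0 Suc.prems(2) by fastforce
  have "\<bar>D\<bar> = (\<Prod>n\<in>A'. \<bar>n - n0\<bar>)" by (simp add: D_def abs_prod)
  also have "\<dots> \<le> (\<Prod>n\<in>A'. L)"
    using A'(2) n0 Suc.prems(2) by (intro prod_mono) (auto simp: abs_le_iff subset_iff, (smt (verit))+)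
  also have "\<dots> = L ^ Suc d" using A' by simp
  finally have D_le: "\<bar>D\<bar> \<le> L ^ Suc d" .
  have "e dvd poly (Polynomial.smult D g) n" if n: "n \<in> A'" for n
  proof -
    have "poly f n - poly f n0 = (n - n0) * poly g n"
      by (subst fg[symmetric]) (simp add: algebra_simps)
    moreover have "e dvd poly f n - poly f n0" using Suc.prems(4) n n0 by (auto simp: A'_def)
    ultimately have "e dvd (n - n0) * poly g n" by simp
    also have "(n - n0) * poly g n dvd D * poly g n"
      using n A'(3) by (intro mult_dvd_mono) (auto simp: D_def intro: dvd_prodI)
    finally show ?thesis by simp
  qed
  moreover have "degree (Polynomial.smult D g) \<le> d" using deg by (meson degree_smult_le le_trans)
  ultimately obtain V where V: "V \<noteq> 0" "\<bar>V\<bar> \<le> L ^ (d\<^sup>2)" "e dvd Polynomial.coeff (Polynomial.smult D g) d * V"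
    using Suc.IH[OF A'(1,2), of "Polynomial.smult D g"] by blast
  have "\<bar>D * V\<bar> \<le> L ^ Suc d * L ^ (d\<^sup>2)" unfolding abs_mult
    using D_le V(2) \<open>L \<ge> 0\<close> by (intro mult_mono) auto
  also have "\<dots> = L ^ (Suc d + d\<^sup>2)" by (rule power_add[symmetric])
  \<comment> \<open>\<open>D\<close> contributes d + 1 factors and the induction hypothesis d^2. The
    resulting exponent d^2 is what later limits the saving to the power 1/d^2.\<close>
  also have "\<dots> \<le> L ^ ((Suc d)\<^sup>2)"
  proof (rule power_increasing)
    show "1 \<le> L" using n0 Suc.prems(2) by fastforce
  qed (simp add: power2_eq_square)
  finally have "\<bar>D * V\<bar> \<le> L ^ ((Suc d)\<^sup>2)" .
  then show ?case using V D0 lead by (intro exI[of _ "D * V"]) (auto simp: mult_ac)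
qed

text \<open>One solution more than the degree would produce a nonzero multiple of \<open>e\<close>
  of absolute value at most lead_coeff f * L^(d^2) < e. Subtracting the constant \<open>c\<close>
  leaves the leading coefficient alone because f is not constant.\<close>

lemma card_poly_cong_short_interval:
  fixes f :: "int poly" and e X L c :: int
  assumes "degree f \<ge> 1" "lead_coeff f > 0" "lead_coeff f * L ^ ((degree f)\<^sup>2) < e"
  shows "card {n \<in> {X..<X + L}. e dvd poly f n - c} \<le> degree f"
proof (rule ccontr)
  assume "\<not> ?thesis"
  then have "Suc (degree f) \<le> card {n \<in> {X..<X + L}. e dvd poly f n - c}" by simp
  then obtain A where A: "A \<subseteq> {n \<in> {X..<X + L}. e dvd poly f n - c}" "card A = Suc (degree f)"
    by (meson obtain_subset_with_card_n)
  have "Polynomial.coeff (f - [:c:]) (degree f) = lead_coeff f" using assms(1) by (cases "degree f") auto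
  moreover have "degree (f - [:c:]) \<le> degree f" by (intro degree_diff_le) auto
  moreover have "A \<subseteq> {X..<X + L}" using A(1) by auto
  moreover have "e dvd poly (f - [:c:]) n" if "n \<in> A" for n using A(1) that by auto
  ultimately obtain V where V: "V \<noteq> 0" "\<bar>V\<bar> \<le> L ^ ((degree f)\<^sup>2)" "e dvd lead_coeff f * V"
    using dvd_lead_coeff_mult_differences[OF A(2), of X L "f - [:c:]" e] by metis
  have "\<bar>e\<bar> \<le> \<bar>lead_coeff f * V\<bar>" using V assms(2) by (intro dvd_imp_le_int) auto
  also have "\<dots> \<le> lead_coeff f * L ^ ((degree f)\<^sup>2)"
    using V(2) assms(2) by (simp add: abs_mult)
  finally show False using assms(3) by linarith
qed

lemma card_poly_cong_le:
  fixes f :: "int poly" and e c :: int and L N :: nat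
  assumes "degree f \<ge> 1" "lead_coeff f > 0" "lead_coeff f * int L ^ ((degree f)\<^sup>2) < e" "L \<ge> 1"
  shows "card {n. n < N \<and> e dvd poly f (int n) - c} \<le> degree f * (N div L + 1)"
proof -
  define B where "B = (\<lambda>i. {n::nat. i * L \<le> n \<and> n < i * L + L \<and> e dvd poly f (int n) - c})"
  have fin: "finite (B i)" for i by (rule finite_subset[of _ "{..<i * L + L}"]) (auto simp: B_def)
  have B: "card (B i) \<le> degree f" for i
  proof -
    have "card (B i) = card (int ` B i)" by (simp add: card_image)
    also have "\<dots> \<le> card {n \<in> {int (i * L)..<int (i * L) + int L}. e dvd poly f n - c}"
    proof (rule card_mono)
      show "finite {n \<in> {int (i * L)..<int (i * L) + int L}. e dvd poly f n - c}"
        by (rule finite_subset[of _ "{int (i * L)..<int (i * L) + int L}"]) auto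
    qed (auto simp: B_def simp flip: of_nat_mult of_nat_add)
    also have "\<dots> \<le> degree f" by (rule card_poly_cong_short_interval[OF assms(1-3)])
    finally show ?thesis .
  qed
  have "{n. n < N \<and> e dvd poly f (int n) - c} \<subseteq> (\<Union>i\<in>{..N div L}. B i)"
  proof clarify
    fix n assume n: "n < N" "e dvd poly f (int n) - c"
    have "n div L * L \<le> n" by simp
    moreover have "n < n div L * L + L"
      using div_mult_mod_eq[of n L] mod_less_divisor[of L n] assms(4) by linarith
    ultimately have "n \<in> B (n div L)" using n by (simp add: B_def)
    moreover have "n div L \<le> N div L" using n by (intro div_le_mono) auto
    ultimately show "n \<in> (\<Union>i\<in>{..N div L}. B i)" by auto
  qed
  then have "card {n. n < N \<and> e dvd poly f (int n) - c} \<le> card (\<Union>i\<in>{..N div L}. B i)"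
    by (intro card_mono) (auto simp: fin)
  also have "\<dots> \<le> (\<Sum>i\<in>{..N div L}. card (B i))" by (rule card_UN_le) auto
  also have "\<dots> \<le> (\<Sum>i\<in>{..N div L}. degree f)" using B by (intro sum_mono) auto
  finally show ?thesis by (simp add: mult.commute)
qed

section \<open>A thin set of sums of two squares\<close>

text \<open>The rounded down fourth root. With cofactors m of this size the prime is at least of
  order M^(3/4), and m e <= sqrt M for every modulus with e^4 <= M, so the progressions modulo e
  stay long.\<close>

definition quart :: "nat \<Rightarrow> nat" where
  "quart M = floor_sqrt (floor_sqrt M)"

lemma le_quart_iff: "m \<le> quart M \<longleftrightarrow> m ^ 4 \<le> M"
proof -
  have "m ^ 4 = (m\<^sup>2)\<^sup>2" by (simp flip: power_mult)
  then show ?thesis by (simp add: quart_def le_floor_sqrt_iff)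
qed

text \<open>The lower cut keeps p above M/(200m): for large \<open>M\<close> this makes p larger
  than every cofactor, larger than sqrt M, and coprime to each modulus e with e^4 <= M.\<close>

definition thin_primes :: "nat \<Rightarrow> nat \<Rightarrow> nat set" where
  "thin_primes M m = {p. prime p \<and> p mod 4 = 1 \<and> M < 200 * m * p \<and> m * p \<le> M}"

definition thin_set :: "nat \<Rightarrow> nat set" where
  "thin_set M = (\<lambda>(m, p). m * p) ` (SIGMA m:split_nats \<inter> {1..quart M}. thin_primes M m)"

lemma thin_primes_le: "m \<ge> 1 \<Longrightarrow> p \<in> thin_primes M m \<Longrightarrow> p \<le> M"
proof -
  assume "m \<ge> 1" and p: "p \<in> thin_primes M m"
  then have "1 * p \<le> m * p" by (intro mult_le_mono1)
  also have "\<dots> \<le> M" using p by (simp add: thin_primes_def)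
  finally show ?thesis by simp
qed

lemma finite_thin_primes: "m \<ge> 1 \<Longrightarrow> finite (thin_primes M m)"
  using thin_primes_le by (intro finite_subset[of "thin_primes M m" "{..M}"]) auto

lemma finite_thin_Sigma: "finite (SIGMA m:split_nats \<inter> {1..quart M}. thin_primes M m)"
  by (intro finite_SigmaI finite_thin_primes) auto

lemma finite_thin_set: "finite (thin_set M)"
  unfolding thin_set_def by (intro finite_imageI finite_thin_Sigma)

lemma thin_set_le: "s \<in> thin_set M \<Longrightarrow> s \<le> M"
  by (auto simp: thin_set_def thin_primes_def)

lemma thin_set_ge: "s \<in> thin_set M \<Longrightarrow> M < 200 * s"
  by (auto simp: thin_set_def thin_primes_def mult_ac)

lemma thin_set_subset: "thin_set M \<subseteq> sums_of_two_squares"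
  using split_nats_subset
  by (auto simp: thin_set_def thin_primes_def intro!: sums_of_two_squares_mult dest: prime_in_split_nats)

text \<open>The prime factor of an element exceeds its cofactor, so the pair is determined.\<close>

lemma inj_on_thin:
  assumes "M \<ge> 40000"
  shows "inj_on (\<lambda>(m, p). m * p) (SIGMA m:split_nats \<inter> {1..quart M}. thin_primes M m)"
proof (rule inj_onI)
  fix x y
  assume "x \<in> (SIGMA m:split_nats \<inter> {1..quart M}. thin_primes M m)"
    "y \<in> (SIGMA m:split_nats \<inter> {1..quart M}. thin_primes M m)"
    and eq0: "(\<lambda>(m, p). m * p) x = (\<lambda>(m, p). m * p) y"
  then obtain m p m' p' where x: "x = (m, p)" and y: "y = (m', p')"
    and m: "m \<in> {1..quart M}" "m' \<in> {1..quart M}" and p: "p \<in> thin_primes M m" "p' \<in> thin_primes M m'"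
    by auto
  have eq: "m * p = m' * p'" using eq0 x y by simp
  have "p = p'"
  proof (rule ccontr)
    assume "p \<noteq> p'"
    then have "coprime p p'" using p by (intro primes_coprime) (auto simp: thin_primes_def)
    moreover have "p dvd m' * p'" using eq by (metis dvd_triv_right)
    ultimately have "p dvd m'" using coprime_dvd_mult_left_iff by blast
    then have "p \<le> m'" using m by (auto dest: dvd_imp_le)
    \<comment> \<open>Since m m' <= sqrt M, this inequality fails once M >= 40000 = 200^2. The
      squarings below derive this without leaving the naturals.\<close>
    then have "M < 200 * (m * m')"
      using p(1) by (auto simp: thin_primes_def mult.assoc intro: less_le_trans)
    then have "M\<^sup>2 < (200 * (m * m'))\<^sup>2" by (intro power_strict_mono) auto
    also have "\<dots> = 40000 * (m * m')\<^sup>2" by (simp add: power_mult_distrib)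
    finally have "M\<^sup>2 < 40000 * (m * m')\<^sup>2" .
    then have "M * M < M * (m * m')\<^sup>2" using assms
      by (metis power2_eq_square less_le_trans mult_le_mono1)
    then have "M < (m * m')\<^sup>2" by simp
    then have "M\<^sup>2 < ((m * m')\<^sup>2)\<^sup>2" by (intro power_strict_mono) auto
    also have "\<dots> = m ^ 4 * m' ^ 4" by (simp add: power_mult_distrib flip: power_mult)
    also have "\<dots> \<le> M * M" using m le_quart_iff by (intro mult_le_mono) auto
    finally show False by (simp add: power2_eq_square)
  qed
  moreover have "p > 0" using p by (auto simp: thin_primes_def prime_gt_0_nat)
  ultimately show "x = y" using eq x y by simp
qed

lemma quart_sq_le:
  assumes "m \<le> quart M"
  shows "real m \<le> sqrt (real M)" "m\<^sup>2 \<le> M"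
proof -
  have "m \<le> m ^ 2" by (simp add: power2_eq_square)
  also have le: "m ^ 2 \<le> m ^ 4" by (cases "m = 0") (auto intro: power_increasing)
  finally show "m\<^sup>2 \<le> M" using assms le by (simp add: le_quart_iff)
  then have "real (m\<^sup>2) \<le> real M" by (rule of_nat_mono)
  then show "real m \<le> sqrt (real M)" by (simp add: real_le_rsqrt)
qed

text \<open>For m <= \<open>quart M\<close> the ratio M/m is at least sqrt M, so the prime count
  applies uniformly. The factor \<open>split_harm\<close> is left unevaluated because
  \<open>card_thin_set_class_le\<close> carries the same factor.\<close>

lemma card_thin_set_ge:
  "eventually (\<lambda>M. real M * split_harm (quart M) / (20 * ln (real M)) \<le> real (card (thin_set M))) at_top"
proof -
  obtain Y where Y: "\<And>M m :: nat. m \<ge> 1 \<Longrightarrow> real M / real m \<ge> Y \<Longrightarrow>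
     real M / (20 * real m * ln (real M)) \<le> real (card {p. prime p \<and> p mod 4 = 1 \<and> M < 200 * m * p \<and> m * p \<le> M})"
    using card_primes_1_mod_4_ge unfolding eventually_at_top_linorder by blast
  have "eventually (\<lambda>M::nat. sqrt (real M) \<ge> Y) at_top" by real_asymp
  moreover have "eventually (\<lambda>M::nat. M \<ge> 40000) at_top" by (rule eventually_ge_at_top)
  ultimately show ?thesis
  proof eventually_elim
    case (elim M)
    have "real M * split_harm (quart M) / (20 * ln (real M)) =
        (\<Sum>m\<in>split_nats \<inter> {1..quart M}. real M / (20 * real m * ln (real M)))"
      unfolding split_harm_def by (simp add: sum_distrib_left sum_divide_distrib mult_ac)
    also have "\<dots> \<le> (\<Sum>m\<in>split_nats \<inter> {1..quart M}. real (card (thin_primes M m)))"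
    proof (rule sum_mono)
      fix m assume m: "m \<in> split_nats \<inter> {1..quart M}"
      have "real m * sqrt (real M) \<le> sqrt (real M) * sqrt (real M)"
        using quart_sq_le(1)[of m M] m by (intro mult_right_mono) auto
      then have "sqrt (real M) \<le> real M / real m" using m by (simp add: field_simps)
      then show "real M / (20 * real m * ln (real M)) \<le> real (card (thin_primes M m))"
        unfolding thin_primes_def using m elim by (intro Y) auto
    qed
    also have "\<dots> = real (card (SIGMA m:split_nats \<inter> {1..quart M}. thin_primes M m))"
      by (subst card_SigmaI) (auto intro!: finite_thin_primes)
    also have "\<dots> = real (card (thin_set M))"
      unfolding thin_set_def using inj_on_thin[OF elim(2)] by (simp add: card_image)
    finally show ?case .
  qed
qed

text \<open>The class modulo e is cut into 400 classes modulo 400 e, to each of which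
  \<open>sum_ln_primes_progression_le\<close> applies. Refining the modulus makes \<open>K\<close>
  about M/(400 m e), below the smallest prime even when e = 1. Since p >= sqrt M, each prime weighs
  at least ln M / 2; the constant is 2 * 400 * 2 * 2 / 400 = 8. The factor ln (400 e) is the loss
  against Brun--Titchmarsh, harmless beside a power of e.\<close>

lemma card_thin_primes_class_le:
  assumes P: "P \<subseteq> thin_primes M m" "\<And>p. p \<in> P \<Longrightarrow> p mod e = c" "\<And>p. p \<in> P \<Longrightarrow> M \<le> p\<^sup>2"
    and "e \<ge> 1" "m \<ge> 1" "400 * m * e \<le> M"
  shows "real (card P) * ln (real M) \<le> 8 * (real M / (real m * real e)) * ln (400 * real e)"
proof -
  define Y where "Y = M div m"
  define K where "K = Y div (400 * e) + 1"
  have fin: "finite P" using P(1) finite_thin_primes[OF assms(5)] by (rule finite_subset)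
  have M: "M \<ge> 400"
  proof -
    have "400 * 1 * 1 \<le> 400 * m * e" using assms by (intro mult_le_mono) auto
    then show ?thesis using assms(6) by linarith
  qed
  have p: "prime p \<and> K < p \<and> p \<le> 400 * e * K" if "p \<in> P" for p
  proof -
    have pr: "prime p" "M < 200 * m * p" "m * p \<le> M" using P(1) that by (auto simp: thin_primes_def)
    have "p \<le> Y" using pr(3) assms(5) by (simp add: Y_def less_eq_div_iff_mult_less_eq mult.commute)
    moreover have "Y < 400 * e * K"
      unfolding K_def using assms(4) by (metis Suc_eq_plus1 dividend_less_times_div mult_Suc_right add.commute
          mult_pos_pos zero_less_numeral less_le_trans zero_less_one)
    ultimately have "p \<le> 400 * e * K" by linarith
    have "Y < 200 * p" using pr(2) assms(5) by (simp add: Y_def div_less_iff_less_mult mult_ac)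
    moreover have "400 * (Y div 400) \<le> Y" by simp
    moreover have "Y div (400 * e) \<le> Y div 400" using assms(4) by (simp add: div_le_mono2)
    moreover have "p > 1" using pr(1) by (rule prime_gt_1_nat)
    ultimately have "K < p" unfolding K_def by linarith
    then show ?thesis using pr(1) \<open>p \<le> 400 * e * K\<close> by blast
  qed
  have "(\<Sum>p\<in>P. ln (real p)) = (\<Sum>j\<in>{..<400}. \<Sum>p | p \<in> P \<and> p div e mod 400 = j. ln (real p))"
    by (rule sum.group[symmetric]) (auto simp: fin)
  also have "\<dots> \<le> (\<Sum>j\<in>{..<400::nat}. 2 * real K * ln (real (400 * e)))"
  proof (rule sum_mono)
    fix j :: nat
    show "(\<Sum>p | p \<in> P \<and> p div e mod 400 = j. ln (real p)) \<le> 2 * real K * ln (real (400 * e))"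
    proof (rule sum_ln_primes_progression_le)
      fix q assume q: "q \<in> {p \<in> P. p div e mod 400 = j}"
      have "q mod (400 * e) = e * (q div e mod 400) + q mod e"
        using mod_mult2_eq[of q e 400] by (simp add: mult.commute)
      then have "q mod (400 * e) = e * j + c" using q P(2) by simp
      then have "[q = e * j + c] (mod (400 * e))"
        by (metis mod_mod_trivial unique_euclidean_semiring_class.cong_def)
      then show "prime q \<and> K < q \<and> q \<le> 400 * e * K \<and> [q = e * j + c] (mod (400 * e))"
        using p q by simp
    qed (use fin assms in \<open>auto simp: K_def\<close>)
  qed
  also have "\<dots> = 800 * real K * ln (400 * real e)" by simp
  finally have sum_le: "(\<Sum>p\<in>P. ln (real p)) \<le> 800 * real K * ln (400 * real e)" .
  have "(\<Sum>p\<in>P. ln (real M) / 2) \<le> (\<Sum>p\<in>P. ln (real p))"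
  proof (rule sum_mono)
    fix q assume q: "q \<in> P"
    then have "q > 0" using p prime_gt_0_nat by blast
    have "real M \<le> real (q\<^sup>2)" using P(3)[OF q] by (rule of_nat_mono)
    then have "ln (real M) \<le> ln (real q ^ 2)" using M by (intro ln_mono) auto
    also have "\<dots> = 2 * ln (real q)" using \<open>q > 0\<close> by (simp add: ln_realpow)
    finally show "ln (real M) / 2 \<le> ln (real q)" by simp
  qed
  then have "real (card P) * ln (real M) \<le> 2 * (\<Sum>p\<in>P. ln (real p))" by simp
  also have "\<dots> \<le> 2 * (800 * real K * ln (400 * real e))" using sum_le by simp
  also have "real K \<le> 2 * (real M / (400 * (real m * real e)))"
  proof -
    have "real (Y div (400 * e)) \<le> real Y / real (400 * e)" by (rule of_nat_div_le_of_nat)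
    also have "\<dots> \<le> (real M / real m) / real (400 * e)"
      unfolding Y_def by (intro divide_right_mono of_nat_div_le_of_nat) auto
    also have "\<dots> = real M / (400 * (real m * real e))" by simp
    finally have "real K \<le> real M / (400 * (real m * real e)) + 1" by (simp add: K_def)
    moreover have "1 \<le> real M / (400 * (real m * real e))"
    proof -
      have "real (400 * m * e) \<le> real M" using assms(6) by (rule of_nat_mono)
      then show ?thesis using assms by (simp add: field_simps)
    qed
    ultimately show ?thesis by linarith
  qed
  finally show ?thesis using assms(4) by (simp add: mult_ac divide_right_mono)
qed

text \<open>A cofactor sharing the factor g with the modulus weakens the bound for its primes by g;
  restricted to multiples of g, the sum pays this back.\<close>

lemma sum_gcd_over_split_le:
  assumes "g \<ge> 1"
  shows "(\<Sum>m | m \<in> split_nats \<inter> {1..z} \<and> g dvd m. real g / real m) \<le> split_harm z"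
proof -
  define A where "A = {m. m \<in> split_nats \<inter> {1..z} \<and> g dvd m}"
  have fin: "finite A" by (rule finite_subset[of _ "{1..z}"]) (auto simp: A_def)
  have inj: "inj_on (\<lambda>m. m div g) A" by (auto simp: inj_on_def A_def dvd_div_eq_iff)
  have "(\<Sum>m\<in>A. real g / real m) = (\<Sum>m\<in>A. 1 / real (m div g))"
    by (rule sum.cong) (use assms in \<open>auto simp: A_def real_of_nat_div\<close>)
  also have "\<dots> = (\<Sum>k\<in>(\<lambda>m. m div g) ` A. 1 / real k)" using inj by (simp add: sum.reindex)
  also have "\<dots> \<le> split_harm z"
    unfolding split_harm_def
  proof (rule sum_mono2)
    show "(\<lambda>m. m div g) ` A \<subseteq> split_nats \<inter> {1..z}"
    proof
      fix k assume "k \<in> (\<lambda>m. m div g) ` A"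
      then obtain m where m: "m \<in> A" "k = m div g" by auto
      then have "m = g * k" by (auto simp: A_def)
      then have "k dvd m" by simp
      then have "k \<in> split_nats" using m split_nats_dvd by (auto simp: A_def)
      moreover have "k \<le> z" using m(1) le_trans[OF div_le_dividend[of m g], of z] unfolding m(2) by (simp add: A_def)
      ultimately show "k \<in> split_nats \<inter> {1..z}" using split_nats_ge_1 by auto
    qed
  qed auto
  finally show ?thesis by (simp add: A_def)
qed

text \<open>p > M/(200m) >= M^(3/4)/200, which is at least sqrt M once M >= 200^4 =
  1600000000.\<close>

lemma thin_primes_large:
  assumes "p \<in> thin_primes M m" "m \<in> {1..quart M}" "M \<ge> 1600000000"
  shows "M \<le> p\<^sup>2"
proof (rule ccontr)
  assume "\<not> M \<le> p\<^sup>2"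
  then have lt: "p\<^sup>2 \<le> M" by simp
  have "M < 200 * m * p" using assms(1) by (simp add: thin_primes_def)
  then have "M\<^sup>2 < (200 * m * p)\<^sup>2" by (intro power_strict_mono) auto
  also have "\<dots> = 40000 * m\<^sup>2 * p\<^sup>2" by (simp add: power_mult_distrib)
  also have "\<dots> \<le> 40000 * m\<^sup>2 * M" using lt by (intro mult_left_mono) auto
  finally have "M < 40000 * m\<^sup>2" by (simp add: power2_eq_square)
  then have "M\<^sup>2 < (40000 * m\<^sup>2)\<^sup>2" by (intro power_strict_mono) auto
  also have "\<dots> = 1600000000 * m ^ 4" by (simp add: power_mult_distrib flip: power_mult)
  also have "\<dots> \<le> M * M" using assms le_quart_iff by (intro mult_le_mono) auto
  finally show False by (simp add: power2_eq_square)
qed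

text \<open>For fixed m the prime p is coprime to e, so m p = c modulo e forces gcd(m, e) = gcd(c,
  e) = g and then confines p to one class modulo e/g. Only multiples m of g contribute, each with an
  extra factor g, and \<open>sum_gcd_over_split_le\<close> absorbs it; the bound is thus uniform
  even for classes not coprime to e.\<close>

lemma card_thin_set_class_le:
  assumes M: "M \<ge> 1600000000" and e: "e \<ge> 1" "e ^ 4 \<le> M"
  shows "real (card {s \<in> thin_set M. s mod e = c mod e}) \<le>
     8 * (real M / real e) * ln (400 * real e) / ln (real M) * split_harm (quart M)"
proof -
  let ?S = "\<lambda>e c. {s \<in> thin_set M. s mod e = c mod e}"
  define G where "G = split_nats \<inter> {1..quart M}"
  define g where "g = gcd c e"
  define P where "P = (\<lambda>m. {p \<in> thin_primes M m. (m * p) mod e = c mod e})"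
  define B where "B = 8 * (real M / real e) * ln (400 * real e) / ln (real M)"
  have g: "g \<ge> 1" "g dvd e" using e by (auto simp: g_def Suc_le_eq)
  have lnM: "ln (real M) > 0" using M by simp
  have finG: "finite G" by (simp add: G_def)
  have finP: "finite (P m)" if "m \<in> G" for m
    using that finite_thin_primes[of m M] by (auto simp: P_def G_def)
  have P_le: "real (card (P m)) \<le> B * (if g dvd m then real g / real m else 0)" if m: "m \<in> G" for m
  proof (cases "P m = {}")
    case True
    have "B \<ge> 0" unfolding B_def using e lnM by (intro divide_nonneg_pos mult_nonneg_nonneg) auto
    then show ?thesis using True by simp
  next
    case False
    have m1: "m \<ge> 1" "m \<in> {1..quart M}" using m by (auto simp: G_def)
    have large: "M \<le> p\<^sup>2" if "p \<in> P m" for p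
      using that m1 M by (intro thin_primes_large) (auto simp: P_def)
    obtain p0 where p0: "p0 \<in> P m" using False by auto
    have prime0: "prime p0" using p0 by (auto simp: P_def thin_primes_def)
    have "(e\<^sup>2)\<^sup>2 = e ^ 4" by (simp flip: power_mult)
    also have "\<dots> \<le> p0\<^sup>2" using large[OF p0] e by linarith
    \<comment> \<open>From e^4 <= M <= p0^2. So p0 exceeds e and, being prime, is coprime to
      it.\<close>
    finally have "e\<^sup>2 \<le> p0" by (rule power2_le_imp_le) simp
    then have "e < p0" using prime_gt_1_nat[OF prime0] e
    proof (cases "e = 1")
      case False
      then have "e * 1 < e * e" using e by (intro mult_strict_left_mono) auto
      then show ?thesis using \<open>e\<^sup>2 \<le> p0\<close> unfolding power2_eq_square mult_1_right by (rule less_le_trans)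
    qed simp
    then have "\<not> p0 dvd e" using e by (auto dest: dvd_imp_le)
    then have cop: "coprime p0 e" using prime0 prime_imp_coprime by blast
    have "gcd (m * p0) e = gcd e ((m * p0) mod e)" by (rule gcd_red_nat)
    also have "\<dots> = gcd e (c mod e)" using p0 by (simp add: P_def)
    also have "\<dots> = g" unfolding g_def by (rule gcd_red_nat[symmetric])
    finally have "gcd (m * p0) e = g" .
    moreover have "gcd (m * p0) e = gcd m e"
      using cop by (simp add: gcd_mult_left_right_cancel coprime_commute)
    ultimately have gm: "gcd m e = g" by simp
    have "g dvd m" unfolding gm[symmetric] by (rule gcd_dvd1)
    define e1 where "e1 = e div g"
    have e1: "e = g * e1" using g by (simp add: e1_def)
    then have e1_ge: "e1 \<ge> 1" using e by (cases e1) auto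
    obtain m1' where m1': "m = g * m1'" using \<open>g dvd m\<close> by auto
    have cop1: "coprime e1 m1'"
    proof (rule gcd_coprime)
      show "gcd e m \<noteq> 0" using e by simp
      show "e = e1 * gcd e m" "m = m1' * gcd e m"
        using gm e1 m1' by (simp_all add: gcd.commute mult.commute)
    qed
    have cls: "p mod e1 = p0 mod e1" if "p \<in> P m" for p
    proof -
      have "(m * p) mod e = (m * p0) mod e" using that p0 by (simp add: P_def)
      then have "int (m * p) mod int e = int (m * p0) mod int e" by (simp only: zmod_int[symmetric])
      then have "int e dvd int (m * p) - int (m * p0)" by (simp only: mod_eq_dvd_iff)
      also have "int (m * p) - int (m * p0) = int g * (int m1' * (int p - int p0))"
        by (simp add: m1' right_diff_distrib mult.assoc)
      also have "int e = int g * int e1" by (simp add: e1)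
      finally have "int e1 dvd int m1' * (int p - int p0)" using g by simp
      then have "int e1 dvd int p - int p0"
        using cop1 by (simp add: coprime_dvd_mult_right_iff)
      then have "int p mod int e1 = int p0 mod int e1" by (simp only: mod_eq_dvd_iff)
      then show ?thesis by (simp only: zmod_int[symmetric] of_nat_eq_iff)
    qed
    \<comment> \<open>Both m^4 and e^4 are at most \<open>M\<close>, so m e <= sqrt M, and sqrt M is
      at least 400.\<close>
    have "400 * m * e1 \<le> M"
    proof -
      have "((m * e)\<^sup>2)\<^sup>2 = m ^ 4 * e ^ 4" by (simp add: power_mult_distrib flip: power_mult)
      also have "\<dots> \<le> M * M" using e m1 le_quart_iff by (intro mult_le_mono) auto
      finally have "((m * e)\<^sup>2)\<^sup>2 \<le> M\<^sup>2" by (simp only: power2_eq_square)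
      then have "(m * e)\<^sup>2 \<le> M" by (rule power2_le_imp_le) simp
      then have "(400 * (m * e))\<^sup>2 \<le> 160000 * M" by (simp add: power_mult_distrib)
      also have "\<dots> \<le> M\<^sup>2" using M by (simp add: power2_eq_square)
      finally have "400 * (m * e) \<le> M" by (rule power2_le_imp_le) simp
      moreover have "1 * e1 \<le> g * e1" using g by (intro mult_le_mono1)
      then have "400 * m * e1 \<le> 400 * m * e" unfolding e1 by (intro mult_left_mono) auto
      ultimately show ?thesis by linarith
    qed
    moreover have "P m \<subseteq> thin_primes M m" by (auto simp: P_def)
    ultimately have "real (card (P m)) * ln (real M) \<le> 8 * (real M / (real m * real e1)) * ln (400 * real e1)"
      using card_thin_primes_class_le[OF _ cls large e1_ge m1(1)] by blast
    also have "\<dots> \<le> 8 * (real M / (real m * real e1)) * ln (400 * real e)"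
    proof (intro mult_left_mono ln_mono)
      have "1 * e1 \<le> g * e1" using g by (intro mult_le_mono1)
      then have "real (1 * e1) \<le> real (g * e1)" by (rule of_nat_mono)
      then show "real e1 \<le> real e" unfolding e1 by simp
    qed (use e1_ge in auto)
    also have "real M / (real m * real e1) = (real M / real e) * (real g / real m)"
      unfolding e1 using g by simp
    finally have "real (card (P m)) \<le> 8 * ((real M / real e) * (real g / real m)) * ln (400 * real e) / ln (real M)"
      using lnM by (simp only: pos_le_divide_eq)
    also have "\<dots> = B * (real g / real m)" by (simp add: B_def mult_ac)
    finally show ?thesis using \<open>g dvd m\<close> by simp
  qed
  have "?S e c \<subseteq> (\<Union>m\<in>G. (\<lambda>p. m * p) ` P m)"
    unfolding thin_set_def P_def G_def by auto
  then have "card (?S e c) \<le> card (\<Union>m\<in>G. (\<lambda>p. m * p) ` P m)"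
    using finG finP by (intro card_mono) auto
  also have "\<dots> \<le> (\<Sum>m\<in>G. card ((\<lambda>p. m * p) ` P m))" using finG by (rule card_UN_le)
  also have "\<dots> \<le> (\<Sum>m\<in>G. card (P m))" using finP by (intro sum_mono card_image_le)
  finally have "real (card (?S e c)) \<le> real (\<Sum>m\<in>G. card (P m))"
    by (rule of_nat_mono)
  also have "\<dots> = (\<Sum>m\<in>G. real (card (P m)))" by (rule of_nat_sum)
  also have "\<dots> \<le> (\<Sum>m\<in>G. B * (if g dvd m then real g / real m else 0))"
    by (intro sum_mono P_le)
  also have "\<dots> = B * (\<Sum>m | m \<in> G \<and> g dvd m. real g / real m)"
    unfolding sum_distrib_left[symmetric] using finG by (simp add: sum.inter_filter)
  also have "\<dots> \<le> B * split_harm (quart M)"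
    using sum_gcd_over_split_le[OF g(1), of "quart M"] e lnM unfolding G_def B_def
    by (intro mult_left_mono divide_nonneg_pos mult_nonneg_nonneg) auto
  finally show ?thesis by (simp add: B_def)
qed

text \<open>Intervals are taken as long as \<open>card_poly_cong_le\<close> permits. The parameter
  \<open>t\<close> may be smaller than e: it is e itself for counting roots over one period, and
  M^(1/4) when e is too large for residue classes to help.\<close>

lemma card_poly_cong_powr_le:
  fixes f :: "int poly"
  assumes "degree f \<ge> 1" "lead_coeff f > 0"
  defines "\<delta> \<equiv> 1 / real ((degree f)\<^sup>2)"
  shows "\<exists>C>0. \<forall>(t::real) (e::int) c (N::nat). t \<ge> 1 \<longrightarrow> t \<le> of_int e \<longrightarrow>
     real (card {n. n < N \<and> e dvd poly f (int n) - c}) \<le> C * (real N * t powr (- \<delta>) + 1)"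
proof -
  let ?S = "\<lambda>e c N. {n. n < N \<and> e dvd poly f (int n) - c}"
  define d where "d = degree f"
  define \<gamma> where "\<gamma> = real_of_int (lead_coeff f)"
  define C where "C = 2 * real d * (2 * \<gamma>) powr \<delta> + real d + (2 * \<gamma>) powr \<delta>"
  have d: "d \<ge> 1" and \<gamma>: "\<gamma> \<ge> 1" using assms by (auto simp: d_def \<gamma>_def)
  have \<delta>: "\<delta> > 0" and d\<delta>: "real (d\<^sup>2) * \<delta> = 1" using assms(1) by (auto simp: \<delta>_def d_def)
  have main: "real (card (?S e c N)) \<le> C * (real N * t powr (- \<delta>) + 1)"
    if t: "t \<ge> 1" "t \<le> of_int e" for t :: real and e c :: int and N :: nat
  proof (cases "t < 2 * \<gamma>")
    case True
    have "card (?S e c N) \<le> card {..<N}" by (intro card_mono) auto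
    then have "real (card (?S e c N)) \<le> real N * 1" by simp
    also have "\<dots> \<le> real N * ((2 * \<gamma>) powr \<delta> * t powr (- \<delta>))"
    proof (rule mult_left_mono)
      have "t powr \<delta> \<le> (2 * \<gamma>) powr \<delta>" using t True \<delta> by (intro powr_mono2) auto
      then show "1 \<le> (2 * \<gamma>) powr \<delta> * t powr (- \<delta>)" using t by (simp add: powr_minus field_simps)
    qed simp
    also have "\<dots> = (2 * \<gamma>) powr \<delta> * (real N * t powr (- \<delta>))" by simp
    also have "\<dots> \<le> C * (real N * t powr (- \<delta>) + 1)"
      by (rule mult_mono) (auto simp: C_def)
    finally show ?thesis .
  next
    case False
    \<comment> \<open>Chosen so that gamma u^(d^2) = t/2 < e. The case t < 2 gamma was separated to
      have u >= 1, hence a nonempty interval.\<close>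
    define u where "u = (t / (2 * \<gamma>)) powr \<delta>"
    define L where "L = nat \<lfloor>u\<rfloor>"
    have u1: "u \<ge> 1" unfolding u_def using False \<gamma> \<delta> by (intro ge_one_powr_ge_zero) auto
    have realL: "real L = of_int \<lfloor>u\<rfloor>" using u1 by (simp add: L_def)
    have "\<lfloor>u\<rfloor> \<ge> 1" using u1 by simp
    then have L: "L \<ge> 1" unfolding L_def by linarith
    have L: "L \<ge> 1" "real L \<le> u" "u \<le> 2 * real L"
    proof -
      show "real L \<le> u" using realL by simp
      have "u < real L + 1" using realL by (simp add: real_of_int_floor_add_one_gt)
      then show "u \<le> 2 * real L" using L by linarith
    qed (rule L)
    have "real L ^ (d\<^sup>2) \<le> u ^ (d\<^sup>2)" using L by (intro power_mono) auto
    also have "\<dots> = u powr real (d\<^sup>2)" using u1 by (intro powr_realpow[symmetric]) linarith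
    also have "\<dots> = t / (2 * \<gamma>)" using t \<gamma> d\<delta> by (simp add: u_def powr_powr mult.commute)
    finally have "\<gamma> * real L ^ (d\<^sup>2) \<le> t / 2" using \<gamma> by (simp add: field_simps)
    also have "\<dots> < of_int e" using t by linarith
    finally have "real_of_int (lead_coeff f * int L ^ (d\<^sup>2)) < of_int e" by (simp add: \<gamma>_def)
    then have "lead_coeff f * int L ^ (d\<^sup>2) < e" by (simp only: of_int_less_iff)
    then have "card (?S e c N) \<le> d * (N div L + 1)"
      using card_poly_cong_le[OF assms(1,2) _ L(1), of e N c] by (simp add: d_def)
    then have "real (card (?S e c N)) \<le> real (d * (N div L + 1))" by (rule of_nat_mono)
    also have "\<dots> = real d * (real (N div L) + 1)" by (simp add: distrib_left)
    also have "\<dots> \<le> real d * (real N / real L + 1)"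
      by (intro mult_left_mono add_right_mono of_nat_div_le_of_nat) auto
    also have "\<dots> \<le> real d * (2 * (2 * \<gamma>) powr \<delta> * (real N * t powr (- \<delta>)) + 1)"
    proof (intro mult_left_mono add_right_mono)
      have "real N / real L \<le> real N / (u / 2)"
        using L u1 by (intro divide_left_mono) auto
      also have "\<dots> = real N * (2 / u)" by simp
      also have "2 / u = 2 * (2 * \<gamma>) powr \<delta> * t powr (- \<delta>)"
        using t \<gamma> by (simp add: u_def powr_divide powr_minus field_simps)
      finally show "real N / real L \<le> 2 * (2 * \<gamma>) powr \<delta> * (real N * t powr (- \<delta>))" by (simp add: mult_ac)
    qed auto
    also have "\<dots> = (2 * real d * (2 * \<gamma>) powr \<delta>) * (real N * t powr (- \<delta>)) + real d * 1"
      by (simp add: algebra_simps)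
    also have "\<dots> \<le> C * (real N * t powr (- \<delta>)) + C * 1"
      by (intro add_mono mult_right_mono) (use \<gamma> in \<open>auto simp: C_def\<close>)
    finally show ?thesis by (simp add: distrib_left)
  qed
  have "C > 0" using d by (simp add: C_def add_pos_nonneg add_nonneg_pos)
  then show ?thesis using main by blast
qed

section \<open>Polynomial congruences on the thin set\<close>

lemma abs_poly_le:
  fixes f :: "int poly"
  shows "\<exists>\<Gamma>>0. \<forall>n::nat. n \<ge> 1 \<longrightarrow> \<bar>poly f (int n)\<bar> \<le> int \<Gamma> * int n ^ degree f"
proof -
  define S where "S = (\<Sum>i\<le>degree f. \<bar>Polynomial.coeff f i\<bar>)"
  have "\<bar>poly f (int n)\<bar> \<le> int (nat S + 1) * int n ^ degree f" if "n \<ge> 1" for n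
  proof -
    have "\<bar>poly f (int n)\<bar> \<le> (\<Sum>i\<le>degree f. \<bar>Polynomial.coeff f i * int n ^ i\<bar>)"
      unfolding poly_altdef by (rule sum_abs)
    also have "\<dots> \<le> (\<Sum>i\<le>degree f. \<bar>Polynomial.coeff f i\<bar> * int n ^ degree f)"
      using that by (intro sum_mono) (auto simp: abs_mult intro!: mult_left_mono power_increasing)
    also have "\<dots> = S * int n ^ degree f" by (simp add: S_def sum_distrib_right)
    also have "\<dots> \<le> int (nat S + 1) * int n ^ degree f" by (intro mult_right_mono) auto
    finally show ?thesis .
  qed
  then show ?thesis by (intro exI[of _ "nat S + 1"]) auto
qed

lemma split_harm_ge_1: "z \<ge> 1 \<Longrightarrow> split_harm z \<ge> 1"
proof -
  assume "z \<ge> 1"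
  then have "(\<Sum>m\<in>{1::nat}. 1 / real m) \<le> split_harm z"
    unfolding split_harm_def by (intro sum_mono2) auto
  then show ?thesis by simp
qed

lemma quart_ge_1: "M \<ge> 1 \<Longrightarrow> quart M \<ge> 1"
  by (simp only: le_quart_iff) simp

lemma poly_mod_dvd:
  fixes f :: "int poly" and e :: nat
  shows "int e dvd poly f (int (s mod e)) - poly f (int s)"
proof -
  have dvd: "x - y dvd poly f x - poly f y" for x y :: int
  proof -
    have "poly f x - poly f y = (x - y) * poly (synthetic_div f y) x"
      using arg_cong[OF synthetic_div_correct'[of y f], of "\<lambda>p. poly p x"] by (simp add: algebra_simps)
    then show ?thesis by simp
  qed
  have "int e dvd int (s mod e) - int s"
    by (simp add: zmod_int flip: mod_eq_dvd_iff)
  then show ?thesis using dvd by (rule dvd_trans)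
qed

text \<open>For e <= M^(1/4) there are O(e^(1 - delta)) roots modulo e, and each class holds O(ln
  (400 e) / e) of the thin set. For larger e all n <= M are counted, giving O(M^(1 - delta/4)), and
  the thin set has at least M/(20 ln M) elements. In both ranges the logarithm is paid with half of
  the power saving.\<close>

lemma card_thin_set_poly_cong_le:
  fixes f :: "int poly"
  assumes "degree f \<ge> 1" "lead_coeff f > 0"
  shows "\<exists>C \<kappa> :: real. C > 0 \<and> \<kappa> > 0 \<and> (\<forall>\<^sub>F M in at_top. \<forall>e::nat. \<forall>s'\<in>thin_set M. e \<ge> 1 \<longrightarrow>
     real (card {s \<in> thin_set M. poly f (int s) \<noteq> poly f (int s') \<and> int e dvd poly f (int s) - poly f (int s')})
       \<le> C * real e powr (- \<kappa>) * real (card (thin_set M)))"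
proof -
  let ?S = "\<lambda>M e c. {s \<in> thin_set M. int e dvd poly f (int s) - c}"
  define d where "d = degree f"
  define \<delta> where "\<delta> = 1 / real (d\<^sup>2)"
  have d: "d \<ge> 1" using assms by (simp add: d_def)
  then have \<delta>: "\<delta> > 0" by (simp add: \<delta>_def)
  have \<delta>1: "\<delta> \<le> 1" using d by (simp add: \<delta>_def)
  obtain C1 where C1: "C1 > 0" and count: "\<And>(t::real) (e::int) c (N::nat). t \<ge> 1 \<Longrightarrow> t \<le> of_int e \<Longrightarrow>
     real (card {n. n < N \<and> e dvd poly f (int n) - c}) \<le> C1 * (real N * t powr (- \<delta>) + 1)"
    using card_poly_cong_powr_le[OF assms] unfolding \<delta>_def d_def by blast
  obtain \<Gamma> :: nat where \<Gamma>: "\<Gamma> > 0" and poly_le: "\<And>n::nat. n \<ge> 1 \<Longrightarrow> \<bar>poly f (int n)\<bar> \<le> int \<Gamma> * int n ^ d"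
    using abs_poly_le[of f] unfolding d_def by blast
  \<comment> \<open>The saving M^(-delta/8) for large moduli, rewritten through e <= 2 Gamma M^d, is
    e^(-kappa) up to a constant; kappa <= delta/2 covers small moduli.\<close>
  define \<kappa> where "\<kappa> = \<delta> / (8 * real d)"
  have \<kappa>: "\<kappa> > 0" using \<delta> d by (simp add: \<kappa>_def)
  have \<kappa>_le: "\<kappa> \<le> \<delta> / 2" unfolding \<kappa>_def using d \<delta> by (intro divide_left_mono) auto
  \<comment> \<open>320 = 8 * 20 * 2 collects the class bound, the lower bound for the thin set and
    the root count; 60 = 3 * 20 does the same for large moduli. The remaining factors come from
    bounding a logarithm by a power.\<close>
  define B1 where "B1 = 320 * C1 * (2 / \<delta>) * 400 powr (\<delta> / 2)"
  define B2 where "B2 = 60 * C1 * (8 / \<delta>)"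
  define C where "C = B1 + B2 * (2 * real \<Gamma>) powr \<kappa>"
  have B1: "B1 > 0" and B2: "B2 > 0" using C1 \<delta> by (auto simp: B1_def B2_def)
  have C: "C > 0" using B1 B2 by (auto simp: C_def intro: add_pos_nonneg)
  have "eventually (\<lambda>M::nat. M \<ge> 1600000000) at_top" by (rule eventually_ge_at_top)
  with card_thin_set_ge have "\<forall>\<^sub>F M in at_top. \<forall>e::nat. \<forall>s'\<in>thin_set M. e \<ge> 1 \<longrightarrow>
     real (card {s \<in> thin_set M. poly f (int s) \<noteq> poly f (int s') \<and> int e dvd poly f (int s) - poly f (int s')})
       \<le> C * real e powr (- \<kappa>) * real (card (thin_set M))"
  proof eventually_elim
    case (elim M)
    define F where "F = split_harm (quart M)"
    define N where "N = real (card (thin_set M))"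
    have lnM: "ln (real M) > 0" using elim by simp
    have F: "F \<ge> 1" unfolding F_def using elim by (intro split_harm_ge_1 quart_ge_1) auto
    have N_ge: "real M * F / ln (real M) \<le> 20 * N" using elim lnM by (simp add: F_def N_def field_simps)
    have "real M * 1 / ln (real M) \<le> real M * F / ln (real M)"
      using F lnM by (intro divide_right_mono mult_left_mono) auto
    then have N_ge': "real M / ln (real M) \<le> 20 * N" using N_ge by simp
    have small: "real (card (?S M e c)) \<le> B1 * real e powr (- (\<delta> / 2)) * N"
      if e: "e \<ge> 1" "e ^ 4 \<le> M" for e c
    proof -
      define R where "R = {n. n < e \<and> int e dvd poly f (int n) - c}"
      let ?w = "real e * real e powr (- \<delta>)"
      have "?S M e c \<subseteq> (\<Union>r\<in>R. {s \<in> thin_set M. s mod e = r mod e})"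
      proof
        fix s assume s: "s \<in> ?S M e c"
        then have "int e dvd (poly f (int (s mod e)) - poly f (int s)) + (poly f (int s) - c)"
          by (intro dvd_add poly_mod_dvd) auto
        then have "s mod e \<in> R" using e by (simp add: R_def)
        then show "s \<in> (\<Union>r\<in>R. {s \<in> thin_set M. s mod e = r mod e})"
          using s by (intro UN_I[of "s mod e"]) auto
      qed
      then have "card (?S M e c) \<le> card (\<Union>r\<in>R. {s \<in> thin_set M. s mod e = r mod e})"
        by (intro card_mono) (auto simp: R_def finite_thin_set)
      also have "\<dots> \<le> (\<Sum>r\<in>R. card {s \<in> thin_set M. s mod e = r mod e})" by (rule card_UN_le) (simp add: R_def)
      finally have "real (card (?S M e c)) \<le> real (\<Sum>r\<in>R. card {s \<in> thin_set M. s mod e = r mod e})"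
        by (rule of_nat_mono)
      also have "\<dots> = (\<Sum>r\<in>R. real (card {s \<in> thin_set M. s mod e = r mod e}))" by (rule of_nat_sum)
      also have "\<dots> \<le> (\<Sum>r\<in>R. 8 * (real M / real e) * ln (400 * real e) / ln (real M) * F)"
        unfolding F_def using elim e by (intro sum_mono card_thin_set_class_le) auto
      also have "\<dots> = (8 * ln (400 * real e) / real e) * (real M * F / ln (real M)) * real (card R)" by simp
      also have "\<dots> \<le> (8 * ln (400 * real e) / real e) * (20 * N) * real (card R)"
        using e by (intro mult_right_mono mult_left_mono N_ge) auto
      also have "\<dots> \<le> (8 * ln (400 * real e) / real e) * (20 * N) * (2 * C1 * (?w))"
      proof (rule mult_left_mono)
        have "real (card R) \<le> C1 * (?w + 1)"
          unfolding R_def using e by (intro count) auto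
        \<comment> \<open>Since delta <= 1, the last incomplete interval is no worse than the main
          term.\<close>
        also have "1 \<le> ?w"
        proof -
          have "?w = real e powr (1 - \<delta>)" using e by (simp add: powr_diff powr_minus field_simps)
          also have "\<dots> \<ge> 1" using e \<delta>1 by (intro ge_one_powr_ge_zero) auto
          finally show ?thesis .
        qed
        then have "C1 * (?w + 1) \<le> C1 * (?w + ?w)"
          using C1 by (intro mult_left_mono) auto
        finally show "real (card R) \<le> 2 * C1 * (?w)" by (simp add: algebra_simps)
      qed (use e in \<open>auto simp: N_def\<close>)
      also have "\<dots> = 320 * C1 * N * ln (400 * real e) * real e powr (- \<delta>)" using e by simp
      also have "\<dots> \<le> 320 * C1 * N * ((400 * real e) powr (\<delta> / 2) / (\<delta> / 2)) * real e powr (- \<delta>)"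
        using e \<delta> C1 by (intro mult_right_mono mult_left_mono ln_powr_bound) (auto simp: N_def)
      also have "\<dots> = B1 * (real e powr (\<delta> / 2) * real e powr (- \<delta>)) * N"
        using e by (simp add: B1_def powr_mult)
      also have "real e powr (\<delta> / 2) * real e powr (- \<delta>) = real e powr (- (\<delta> / 2))"
        by (simp flip: powr_add)
      finally show ?thesis .
    qed
    have large: "real (card (?S M e c)) \<le> B2 * real M powr (- (\<delta> / 8)) * N"
      if e: "\<not> e ^ 4 \<le> M" for e c
    proof -
      let ?w = "real M * real M powr (- (\<delta> / 4))"
      have "real M powr (1 / 4) \<le> real e"
      proof -
        have "real M \<le> real (e ^ 4)" using e by (intro of_nat_mono) auto
        then have "real M powr (1 / 4) \<le> real (e ^ 4) powr (1 / 4)" by (intro powr_mono2) auto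
        also have "real (e ^ 4) = real e powr 4" by (cases "e = 0") (auto simp: powr_numeral)
        also have "(real e powr 4) powr (1 / 4) = real e" unfolding powr_powr by simp
        finally show ?thesis .
      qed
      moreover have "real M powr (1 / 4) \<ge> 1" using elim by (intro ge_one_powr_ge_zero) auto
      ultimately have cnt: "real (card {n. n < M + 1 \<and> int e dvd poly f (int n) - c})
         \<le> C1 * (real (M + 1) * (real M powr (1 / 4)) powr (- \<delta>) + 1)"
        by (intro count) auto
      have "card (?S M e c) \<le> card {n. n < M + 1 \<and> int e dvd poly f (int n) - c}"
        using thin_set_le by (intro card_mono) fastforce+
      then have "real (card (?S M e c)) \<le> real (card {n. n < M + 1 \<and> int e dvd poly f (int n) - c})"
        by (rule of_nat_mono)
      also note cnt
      also have "(real M powr (1 / 4)) powr (- \<delta>) = real M powr (- (\<delta> / 4))" by (simp add: powr_powr)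
      also have "C1 * (real (M + 1) * real M powr (- (\<delta> / 4)) + 1) \<le> C1 * (3 * (?w))"
      proof (rule mult_left_mono)
        have "1 \<le> real M powr (1 - \<delta> / 4)" using elim \<delta>1 by (intro ge_one_powr_ge_zero) auto
        also have "\<dots> = ?w" using powr_add[of "real M" 1 "- (\<delta> / 4)"] elim(2) by simp
        finally have "1 \<le> ?w" .
        moreover have "real M powr (- (\<delta> / 4)) \<le> ?w"
          using elim by (intro mult_le_cancel_right1[THEN iffD2]) auto
        ultimately show "real (M + 1) * real M powr (- (\<delta> / 4)) + 1 \<le> 3 * (?w)"
          by (simp add: distrib_right)
      qed (use C1 in auto)
      also have "\<dots> = 3 * C1 * (real M / ln (real M)) * (ln (real M) * real M powr (- (\<delta> / 4)))"
        using lnM by simp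
      also have "\<dots> \<le> 3 * C1 * (20 * N) * (ln (real M) * real M powr (- (\<delta> / 4)))"
        using N_ge' C1 lnM by (intro mult_right_mono mult_left_mono) auto
      also have "\<dots> \<le> 3 * C1 * (20 * N) * ((real M powr (\<delta> / 8) / (\<delta> / 8)) * real M powr (- (\<delta> / 4)))"
        using elim \<delta> C1 by (intro mult_right_mono mult_left_mono ln_powr_bound) (auto simp: N_def)
      also have "\<dots> = B2 * (real M powr (\<delta> / 8) * real M powr (- (\<delta> / 4))) * N" by (simp add: B2_def)
      also have "real M powr (\<delta> / 8) * real M powr (- (\<delta> / 4)) = real M powr (- (\<delta> / 8))"
        by (simp flip: powr_add)
      finally show ?thesis .
    qed
    show ?case
    proof (intro allI ballI impI)
      fix e :: nat and s' assume s': "s' \<in> thin_set M" and e: "1 \<le> e"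
      define S where "S = {s \<in> thin_set M. poly f (int s) \<noteq> poly f (int s') \<and> int e dvd poly f (int s) - poly f (int s')}"
      have "S \<subseteq> {s \<in> thin_set M. int e dvd poly f (int s) - poly f (int s')}" by (auto simp: S_def)
      then have cardS: "real (card S) \<le> real (card {s \<in> thin_set M. int e dvd poly f (int s) - poly f (int s')})"
        by (intro of_nat_mono card_mono) (auto simp: finite_thin_set)
      have "real (card S) \<le> C * real e powr (- \<kappa>) * N"
      proof (cases "e ^ 4 \<le> M")
        case True
        have "real (card S) \<le> B1 * real e powr (- (\<delta> / 2)) * N" using cardS small[OF e True] by (rule order.trans)
        also have "\<dots> \<le> C * real e powr (- \<kappa>) * N"
          using e \<kappa>_le B1 B2 by (intro mult_right_mono mult_mono powr_mono) (auto simp: C_def N_def)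
        finally show ?thesis .
      next
        case False
        show ?thesis
        proof (cases "S = {}")
          case True
          then show ?thesis using C by (auto simp: N_def)
        next
          case nonempty: False
          then obtain s where s: "s \<in> thin_set M" "poly f (int s) \<noteq> poly f (int s')" "int e dvd poly f (int s) - poly f (int s')"
            by (auto simp: S_def)
          have bnd: "\<bar>poly f (int n)\<bar> \<le> int \<Gamma> * int M ^ d" if "n \<in> thin_set M" for n
          proof -
            have "n \<ge> 1" using thin_set_ge[OF that] by (cases n) auto
            then have "\<bar>poly f (int n)\<bar> \<le> int \<Gamma> * int n ^ d" by (rule poly_le)
            also have "\<dots> \<le> int \<Gamma> * int M ^ d" using thin_set_le[OF that] by (intro mult_left_mono power_mono) auto
            finally show ?thesis .
          qed
          \<comment> \<open>A nonzero multiple of e: this is where the condition that the two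
            polynomial values differ is indispensable.\<close>
          have "int e \<le> \<bar>poly f (int s) - poly f (int s')\<bar>" using s by (intro zdvd_imp_le) auto
          also have "\<dots> \<le> 2 * int \<Gamma> * int M ^ d" using bnd[OF s(1)] bnd[OF s'] by linarith
          finally have "real_of_int (int e) \<le> real_of_int (2 * int \<Gamma> * int M ^ d)" by (simp only: of_int_le_iff)
          then have "real e \<le> 2 * real \<Gamma> * real M ^ d" by simp
          then have "real e powr \<kappa> \<le> (2 * real \<Gamma> * real M ^ d) powr \<kappa>" using \<kappa> by (intro powr_mono2) auto
          also have "\<dots> = (2 * real \<Gamma>) powr \<kappa> * (real M powr real d) powr \<kappa>"
            using elim by (simp add: powr_mult powr_realpow)
          also have "(real M powr real d) powr \<kappa> = real M powr (\<delta> / 8)"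
            using d by (simp add: powr_powr \<kappa>_def)
          finally have "real e powr \<kappa> \<le> (2 * real \<Gamma>) powr \<kappa> * real M powr (\<delta> / 8)" .
          then have key: "real M powr (- (\<delta> / 8)) \<le> (2 * real \<Gamma>) powr \<kappa> * real e powr (- \<kappa>)"
            using e elim by (simp add: powr_minus field_simps)
          have "real (card S) \<le> B2 * real M powr (- (\<delta> / 8)) * N" using cardS large[OF False] by (rule order.trans)
          also have "\<dots> \<le> B2 * ((2 * real \<Gamma>) powr \<kappa> * real e powr (- \<kappa>)) * N"
            using B2 key by (intro mult_right_mono mult_left_mono) (auto simp: N_def)
          also have "\<dots> = (B2 * (2 * real \<Gamma>) powr \<kappa>) * real e powr (- \<kappa>) * N" by simp
          also have "\<dots> \<le> C * real e powr (- \<kappa>) * N"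
            using B1 by (intro mult_right_mono) (auto simp: C_def N_def)
          finally show ?thesis .
        qed
      qed
      then show "real (card {s \<in> thin_set M. poly f (int s) \<noteq> poly f (int s') \<and> int e dvd poly f (int s) - poly f (int s')})
       \<le> C * real e powr (- \<kappa>) * real (card (thin_set M))"
        by (simp add: S_def N_def)
    qed
  qed
  then show ?thesis using C \<kappa> by blast
qed

section \<open>Multiplicative orders and Romanoff sums\<close>

text \<open>Each Euler factor is 1 + 1/(p - 1) <= exp (1/p + 1/(p (p - 1))), and the sum of 1/(k (k
  - 1)) telescopes to at most 1.\<close>

lemma divide_totient_le:
  assumes "n > 0"
  shows "real n / real (totient n) \<le> exp (1 + (\<Sum>p\<in>prime_factors n. 1 / real p))"
proof -
  have tel: "(\<Sum>k\<in>{2..N}. 1 / (real k * (real k - 1))) \<le> 1" for N :: nat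
  proof -
    have "(\<Sum>k\<in>{2..N}. 1 / (real k * (real k - 1))) \<le> 1 - 1 / real N" if "N \<ge> 1"
      using that
    proof (induction N rule: dec_induct)
      case (step N)
      have "{2..Suc N} = insert (Suc N) {2..N}" using step by auto
      then have "(\<Sum>k\<in>{2..Suc N}. 1 / (real k * (real k - 1))) =
          1 / (real (Suc N) * real N) + (\<Sum>k\<in>{2..N}. 1 / (real k * (real k - 1)))" by simp
      moreover have "1 / (real (Suc N) * real N) = 1 / real N - 1 / real (Suc N)"
        using step by (simp add: field_simps)
      ultimately show ?case using step.IH by linarith
    qed simp
    moreover have "1 - 1 / real N \<le> 1" by simp
    ultimately show ?thesis by (cases "N \<ge> 1") (linarith, simp)
  qed
  have "(\<Sum>p\<in>prime_factors n. 1 / (real p * (real p - 1))) \<le> (\<Sum>k\<in>{2..n}. 1 / (real k * (real k - 1)))"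
    by (rule sum_mono2) (use assms in \<open>auto simp: prime_factors_dvd prime_ge_2_nat dvd_imp_le\<close>)
  then have extra: "(\<Sum>p\<in>prime_factors n. 1 / (real p * (real p - 1))) \<le> 1" using tel[of n] by linarith
  have "real n / real (totient n) = (\<Prod>p\<in>prime_factors n. 1 / (1 - 1 / real p))"
    unfolding totient_formula2 using assms by (simp add: prod_dividef)
  also have "\<dots> \<le> (\<Prod>p\<in>prime_factors n. exp (1 / (real p * (real p - 1)) + 1 / real p))"
  proof (rule prod_mono)
    fix p assume "p \<in> prime_factors n"
    then have "p \<ge> 2" using in_prime_factors_imp_prime prime_ge_2_nat by blast
    then have p: "real p \<ge> 2" by simp
    have "1 / (1 - 1 / real p) = 1 + (1 / (real p * (real p - 1)) + 1 / real p)"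
      using p by (simp add: field_simps)
    also have "\<dots> \<le> exp (1 / (real p * (real p - 1)) + 1 / real p)" by (rule exp_ge_add_one_self)
    finally show "0 \<le> 1 / (1 - 1 / real p) \<and> 1 / (1 - 1 / real p) \<le> exp (1 / (real p * (real p - 1)) + 1 / real p)"
      using p by simp
  qed
  also have "\<dots> = exp ((\<Sum>p\<in>prime_factors n. 1 / (real p * (real p - 1))) + (\<Sum>p\<in>prime_factors n. 1 / real p))"
    by (simp add: exp_sum sum.distrib[symmetric])
  also have "\<dots> \<le> exp (1 + (\<Sum>p\<in>prime_factors n. 1 / real p))" using extra by simp
  finally show ?thesis .
qed

text \<open>Jensen's inequality for exp, by the tangent line at the weighted mean
  \<open>Y\<close>.\<close>

lemma exp_sum_le_sum_exp:
  fixes y w :: "'a \<Rightarrow> real"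
  assumes "\<And>i. i \<in> I \<Longrightarrow> w i \<ge> 0" "sum w I = 1"
  shows "exp (\<Sum>i\<in>I. w i * y i) \<le> (\<Sum>i\<in>I. w i * exp (y i))"
proof -
  define Y where "Y = (\<Sum>i\<in>I. w i * y i)"
  have "exp Y = (\<Sum>i\<in>I. w i * (exp Y * (1 + (y i - Y))))"
  proof -
    have "(\<Sum>i\<in>I. w i * (exp Y * (1 + (y i - Y)))) = exp Y * (\<Sum>i\<in>I. w i * (1 - Y) + w i * y i)"
      by (simp add: sum_distrib_left algebra_simps)
    also have "(\<Sum>i\<in>I. w i * (1 - Y) + w i * y i) = 1"
      using assms(2) by (simp add: sum.distrib sum_distrib_right[symmetric] Y_def[symmetric])
    finally show ?thesis by simp
  qed
  also have "\<dots> \<le> (\<Sum>i\<in>I. w i * exp (y i))"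
  proof (intro sum_mono mult_left_mono)
    fix i
    have "exp Y * (1 + (y i - Y)) \<le> exp Y * exp (y i - Y)"
      by (intro mult_left_mono exp_ge_add_one_self) auto
    then show "exp Y * (1 + (y i - Y)) \<le> exp (y i)" by (simp flip: exp_add)
  qed (use assms in auto)
  finally show ?thesis by (simp add: Y_def)
qed

section \<open>Convergence of the sum of 1 / (p log ord_p a)\<close>

lemma ord_prime_ge_2:
  fixes a p :: nat
  assumes "prime p" "a \<ge> 2" "a < p"
  shows "ord p a \<ge> 2"
proof -
  have "\<not> p dvd a" using assms by (auto dest: dvd_imp_le)
  then have "coprime p a" using assms(1) prime_imp_coprime by blast
  then have "ord p a \<noteq> 0" by (simp add: ord_eq_0)
  moreover have "ord p a \<noteq> 1"
  proof
    assume "ord p a = 1"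
    then have "[a ^ 1 = 1] (mod p)" by (simp only: ord_divides) simp
    then have "a mod p = 1 mod p" by (simp add: unique_euclidean_semiring_class.cong_def)
    then show False using assms by simp
  qed
  ultimately show ?thesis by linarith
qed

text \<open>All these primes divide a^e - 1 < 2^(a e), and each is at least 2.\<close>

lemma card_primes_with_ord_le:
  fixes a e :: nat
  assumes "a \<ge> 2" "e \<ge> 1" "finite P" "\<And>p. p \<in> P \<Longrightarrow> prime p \<and> ord p a = e"
  shows "card P \<le> a * e"
proof -
  have "\<Prod>P dvd a ^ e - 1"
  proof (rule prod_primes_dvd)
    fix p assume p: "p \<in> P"
    then have "ord p a dvd e" using assms(4) by simp
    then have "[a ^ e = 1] (mod p)" by (simp only: ord_divides)
    then have "p dvd a ^ e - 1"
      using assms(1) by (metis cong_to_1_nat)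
    then show "prime p \<and> p dvd a ^ e - 1" using p assms(4) by blast
  qed (rule assms(3))
  moreover have "a ^ e > 1" using assms by (intro one_less_power) auto
  ultimately have "\<Prod>P \<le> a ^ e - 1" by (intro dvd_imp_le) auto
  then have "\<Prod>P \<le> a ^ e" by simp
  have "2 ^ card P = (\<Prod>p\<in>P. 2)" by simp
  also have "\<dots> \<le> \<Prod>P" using assms(4) by (intro prod_mono) (auto simp: prime_ge_2_nat)
  also have "\<dots> \<le> a ^ e" by fact
  also have "\<dots> \<le> (2 ^ a) ^ e" by (intro power_mono less_imp_le[OF less_exp]) auto
  also have "\<dots> = 2 ^ (a * e)" by (simp add: power_mult)
  finally show ?thesis by simp
qed

lemma card_primes_with_small_ord_le:
  fixes a E :: nat
  assumes "a \<ge> 2" "finite P" "\<And>p. p \<in> P \<Longrightarrow> prime p \<and> 1 \<le> ord p a \<and> ord p a < E"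
  shows "card P \<le> a * E\<^sup>2"
proof -
  have "(\<Union>e\<in>{1..<E}. {p \<in> P. ord p a = e}) = P" using assms(3) by auto
  then have "card P = card (\<Union>e\<in>{1..<E}. {p \<in> P. ord p a = e})" by simp
  also have "\<dots> \<le> (\<Sum>e\<in>{1..<E}. card {p \<in> P. ord p a = e})" by (rule card_UN_le) simp
  also have "\<dots> \<le> (\<Sum>e\<in>{1..<E}. a * E)"
  proof (rule sum_mono)
    fix e assume e: "e \<in> {1..<E}"
    have "card {p \<in> P. ord p a = e} \<le> a * e"
      using assms e by (intro card_primes_with_ord_le) auto
    also have "\<dots> \<le> a * E" using e by auto
    finally show "card {p \<in> P. ord p a = e} \<le> a * E" .
  qed
  also have "\<dots> = (E - 1) * (a * E)" by simp
  also have "\<dots> \<le> E * (a * E)" by (intro mult_le_mono1) simp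
  finally show ?thesis by (simp add: power2_eq_square mult_ac)
qed

lemma card_dyadic_primes_le:
  assumes "i \<ge> 1"
  shows "real (card {p::nat. prime p \<and> 2 ^ i \<le> p \<and> p < 2 ^ (i + 1)}) \<le> 8 * 2 ^ i / (real i * ln 2)"
proof -
  define B where "B = {p::nat. prime p \<and> 2 ^ i \<le> p \<and> p < 2 ^ (i + 1)}"
  have fin: "finite B" by (rule finite_subset[of _ "{..<2 ^ (i + 1)}"]) (auto simp: B_def)
  have "(\<Sum>p\<in>B. real i * ln 2) \<le> (\<Sum>p\<in>B. mangoldt p)"
  proof (rule sum_mono)
    fix p assume p: "p \<in> B"
    then have "real (2 ^ i) \<le> real p" unfolding B_def by (intro of_nat_mono) auto
    then have "ln (2 ^ i) \<le> ln (real p)" by (intro ln_mono) auto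
    then show "real i * ln 2 \<le> mangoldt p" using p by (simp add: B_def ln_realpow)
  qed
  also have "\<dots> \<le> cheb_psi (2 ^ (i + 1))"
    unfolding cheb_psi_def by (rule sum_mono2) (auto simp: B_def mangoldt_nonneg prime_ge_Suc_0_nat)
  also have "\<dots> \<le> 4 * real (2 ^ (i + 1))" by (rule cheb_psi_le)
  finally have "real (card B) * (real i * ln 2) \<le> 8 * 2 ^ i" by simp
  moreover have "real i * ln 2 > 0" using assms by simp
  ultimately have "real (card B) \<le> 8 * 2 ^ i / (real i * ln 2)" by (simp only: pos_le_divide_eq)
  then show ?thesis by (simp add: B_def)
qed

text \<open>Split at order 2^(i div 3). Above it ln of the order is at least (i/6) ln 2, and
  Chebyshev's O(2^i / i) primes give O(1/i^2). Below it there are at most a 4^(i div 3) primes, each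
  of weight at most 1/(2^i ln 2).\<close>

lemma sum_dyadic_inverse_ln_ord_le:
  fixes a i :: nat
  assumes "a \<ge> 2" "i \<ge> 6" "a < 2 ^ i"
    and P: "\<And>p. p \<in> P \<Longrightarrow> prime p \<and> 2 ^ i \<le> p \<and> p < 2 ^ (i + 1)"
  shows "(\<Sum>p\<in>P. 1 / (real p * ln (real (ord p a)))) \<le>
     48 / (ln 2)\<^sup>2 / (real i)\<^sup>2 + real a / ln 2 / 2 ^ (i div 3)"
proof -
  let ?w = "\<lambda>p. 1 / (real p * ln (real (ord p a)))"
  define k where "k = i div 3"
  define P1 where "P1 = {p \<in> P. 2 ^ k \<le> ord p a}"
  define P2 where "P2 = {p \<in> P. ord p a < 2 ^ k}"
  let ?B = "{p::nat. prime p \<and> 2 ^ i \<le> p \<and> p < 2 ^ (i + 1)}"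
  have finP: "finite P" by (rule finite_subset[of _ "{..<2 ^ (i + 1)}"]) (use P in auto)
  have ge2: "ord p a \<ge> 2" if "p \<in> P" for p
    using P[OF that] assms by (intro ord_prime_ge_2) auto
  have p_ge: "(2::real) ^ i \<le> real p" if "p \<in> P" for p
    using of_nat_mono[of "2 ^ i" p, where ?'a = real] P[OF that] by simp
  have i6: "real i / 6 \<le> real k" "k \<ge> 1" using assms(2) unfolding k_def by linarith+
  have split: "(\<Sum>p\<in>P. ?w p) =
     (\<Sum>p\<in>P1. ?w p) + (\<Sum>p\<in>P2. ?w p)"
    by (subst sum.union_disjoint[symmetric]) (auto simp: P1_def P2_def finP intro!: sum.cong)
  have "(\<Sum>p\<in>P1. ?w p) \<le> (\<Sum>p\<in>P1. 1 / (2 ^ i * (real i / 6 * ln 2)))"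
  proof (rule sum_mono)
    fix p assume p: "p \<in> P1"
    then have "real (2 ^ k) \<le> real (ord p a)" unfolding P1_def by (intro of_nat_mono) auto
    then have "ln (2 ^ k) \<le> ln (real (ord p a))" by (intro ln_mono) auto
    moreover have "real i / 6 * ln 2 \<le> real k * ln 2" using i6 by (intro mult_right_mono) auto
    moreover have "ln (2 ^ k) = real k * ln (2::real)" by (simp add: ln_realpow)
    ultimately have "real i / 6 * ln 2 \<le> ln (real (ord p a))" by linarith
    then have "2 ^ i * (real i / 6 * ln 2) \<le> real p * ln (real (ord p a))"
      using p p_ge by (intro mult_mono) (auto simp: P1_def)
    moreover have "2 ^ i * (real i / 6 * ln 2) > 0" using assms by simp
    ultimately show "?w p \<le> 1 / (2 ^ i * (real i / 6 * ln 2))"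
      by (intro frac_le) auto
  qed
  also have "\<dots> = real (card P1) * (1 / (2 ^ i * (real i / 6 * ln 2)))" by simp
  also have "\<dots> \<le> 8 * 2 ^ i / (real i * ln 2) * (1 / (2 ^ i * (real i / 6 * ln 2)))"
  proof (rule mult_right_mono)
    have "card P1 \<le> card ?B"
    proof (rule card_mono)
      show "finite ?B"
        by (rule finite_subset[of _ "{..<2 ^ (i + 1)}"]) auto
      show "P1 \<subseteq> ?B" using P by (auto simp: P1_def)
    qed
    then show "real (card P1) \<le> 8 * 2 ^ i / (real i * ln 2)"
      using card_dyadic_primes_le[of i] assms by linarith
  qed auto
  also have "\<dots> = 48 / (ln 2)\<^sup>2 / (real i)\<^sup>2" by (simp add: power2_eq_square)
  finally have 1: "(\<Sum>p\<in>P1. ?w p) \<le> 48 / (ln 2)\<^sup>2 / (real i)\<^sup>2" .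
  have "(\<Sum>p\<in>P2. ?w p) \<le> (\<Sum>p\<in>P2. 1 / (2 ^ i * ln 2))"
  proof (rule sum_mono)
    fix p assume p: "p \<in> P2"
    have "ln 2 \<le> ln (real (ord p a))" using ge2[of p] p by (intro ln_mono) (auto simp: P2_def)
    then have "2 ^ i * ln 2 \<le> real p * ln (real (ord p a))"
      using p p_ge by (intro mult_mono) (auto simp: P2_def)
    moreover have "2 ^ i * ln (2::real) > 0" by simp
    ultimately show "?w p \<le> 1 / (2 ^ i * ln 2)"
      by (intro frac_le) auto
  qed
  also have "\<dots> = real (card P2) * (1 / (2 ^ i * ln 2))" by simp
  also have "\<dots> \<le> real (a * (2 ^ k)\<^sup>2) * (1 / (2 ^ i * ln 2))"
  proof (rule mult_right_mono)
    have "card P2 \<le> a * (2 ^ k)\<^sup>2"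
    proof (rule card_primes_with_small_ord_le[OF assms(1)])
      fix p assume "p \<in> P2"
      then show "prime p \<and> 1 \<le> ord p a \<and> ord p a < 2 ^ k"
        using P[of p] ge2[of p] unfolding P2_def by auto
    qed (use finP in \<open>simp add: P2_def\<close>)
    then show "real (card P2) \<le> real (a * (2 ^ k)\<^sup>2)" by (rule of_nat_mono)
  qed auto
  also have "\<dots> = real a / ln 2 * ((2 ^ k)\<^sup>2 / 2 ^ i)" by simp
  also have "\<dots> \<le> real a / ln 2 * (1 / 2 ^ k)"
  proof (rule mult_left_mono)
    have "(2::real) ^ (3 * k) \<le> 2 ^ i" by (intro power_increasing) (auto simp: k_def)
    moreover have "(2::real) ^ (3 * k) = (2 ^ k)\<^sup>2 * 2 ^ k"
      by (simp add: power_mult[symmetric] power_add[symmetric] mult.commute)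
    ultimately have "(2 ^ k)\<^sup>2 * (2::real) ^ k \<le> 2 ^ i" by linarith
    then show "(2 ^ k)\<^sup>2 / 2 ^ i \<le> 1 / (2::real) ^ k" by (simp add: divide_simps)
  qed auto
  finally have 2: "(\<Sum>p\<in>P2. ?w p) \<le> real a / ln 2 / 2 ^ k" by simp
  show ?thesis using 1 2 split unfolding k_def by linarith
qed

text \<open>Convergence in the form of a tail bound uniform over finite sets of primes: the set of
  primes dividing the differences will depend on M, but \<open>I\<close> must not.\<close>

lemma sum_inverse_ln_ord_small:
  fixes a :: nat and \<epsilon> :: real
  assumes "a \<ge> 2" "\<epsilon> > 0"
  shows "\<exists>I. a < 2 ^ I \<and> (\<forall>P. finite P \<longrightarrow> (\<forall>p\<in>P. prime p \<and> 2 ^ I \<le> p) \<longrightarrow>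
     (\<Sum>p\<in>P. 1 / (real p * ln (real (ord p a)))) \<le> \<epsilon>)"
proof -
  let ?w = "\<lambda>p. 1 / (real p * ln (real (ord p a)))"
  \<comment> \<open>The ratio 2^(-1/3) replaces 2^(-(i div 3)) by a geometric term; the factor 2
    covers the rounding in i div 3.\<close>
  define b where "b = (\<lambda>i::nat. 48 / (ln 2)\<^sup>2 * (1 / (real i)\<^sup>2) + real a / ln 2 * (2 * (2 powr (-1/3)) ^ i))"
  have b_nonneg: "b i \<ge> 0" for i unfolding b_def by (intro add_nonneg_nonneg mult_nonneg_nonneg) auto
  have "2 powr (-1/3) < (1::real)" by (simp add: powr_less_one)
  then have "summable b" unfolding b_def
    by (intro summable_add summable_mult summable_geometric) (use inverse_power_summable[of 2, where ?'a = real] in \<open>auto simp: inverse_eq_divide\<close>)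
  then obtain I0 where I0: "\<And>n. norm (sum b {I0..<n}) < \<epsilon>"
    using assms(2) unfolding summable_Cauchy
    by (metis (no_types, lifting) order_refl)
  define I where "I = Max {I0, 6, a}"
  have I: "I \<ge> I0" "I \<ge> 6" "I \<ge> a" by (auto simp: I_def)
  have aI: "a < 2 ^ I" using I(3) less_exp[of I] by linarith
  have "(\<Sum>p\<in>P. ?w p) \<le> \<epsilon>"
    if P: "finite P" "\<forall>p\<in>P. prime p \<and> 2 ^ I \<le> p" for P
  proof -
    define n where "n = Suc (Max (insert I (floor_log ` P)))"
    have fl: "floor_log p \<in> {I..<n}" if "p \<in> P" for p
    proof -
      have "floor_log (2 ^ I) \<le> floor_log p" using P that by (intro floor_log_le_iff) auto
      moreover have "floor_log p \<le> Max (insert I (floor_log ` P))" using P that by (intro Max_ge) auto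
      ultimately show ?thesis by (simp add: n_def less_Suc_eq_le)
    qed
    have "(\<Sum>p\<in>P. ?w p) =
       (\<Sum>i\<in>{I..<n}. \<Sum>p | p \<in> P \<and> floor_log p = i. ?w p)"
      using P fl by (intro sum.group[symmetric]) auto
    also have "\<dots> \<le> (\<Sum>i\<in>{I..<n}. b i)"
    proof (rule sum_mono)
      fix i assume i: "i \<in> {I..<n}"
      have "a < 2 ^ i" using aI i by (intro less_le_trans[OF aI] power_increasing) auto
      then have "(\<Sum>p | p \<in> P \<and> floor_log p = i. ?w p) \<le>
        48 / (ln 2)\<^sup>2 / (real i)\<^sup>2 + real a / ln 2 / 2 ^ (i div 3)"
      proof (intro sum_dyadic_inverse_ln_ord_le)
        fix p assume p: "p \<in> {p. p \<in> P \<and> floor_log p = i}"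
        then have "p > 0" using P prime_gt_0_nat by blast
        then show "prime p \<and> 2 ^ i \<le> p \<and> p < 2 ^ (i + 1)"
          using p P floor_log_exp2_le[of p] floor_log_exp2_gt[of p] by auto
      qed (use assms i I in auto)
      also have "\<dots> \<le> b i"
      proof -
        have "1 / 2 ^ (i div 3) \<le> 2 * (2 powr (-1/3) :: real) ^ i"
        proof -
          have "1 / 2 ^ (i div 3) = 2 powr (- real (i div 3))" by (simp add: powr_minus powr_realpow field_simps)
          also have "\<dots> \<le> 2 powr (1 + (-1/3) * real i)" by (intro powr_mono) linarith+
          also have "\<dots> = 2 * 2 powr ((-1/3) * real i)" unfolding powr_add by simp
          also have "2 powr ((-1/3) * real i) = (2 powr (-1/3)) powr real i" by (simp add: powr_powr)
          also have "\<dots> = (2 powr (-1/3)) ^ i" by (simp add: powr_realpow)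
          finally show ?thesis .
        qed
        then have "real a / ln 2 * (1 / 2 ^ (i div 3)) \<le> real a / ln 2 * (2 * (2 powr (-1/3)) ^ i)"
          by (intro mult_left_mono) auto
        then show ?thesis by (simp add: b_def)
      qed
      finally show "(\<Sum>p | p \<in> P \<and> floor_log p = i. ?w p) \<le> b i" .
    qed
    also have "\<dots> \<le> (\<Sum>i\<in>{I0..<n}. b i)" using I by (intro sum_mono2) (auto simp: b_nonneg)
    also have "\<dots> \<le> \<epsilon>" using I0[of n] by simp
    finally show ?thesis .
  qed
  then show ?thesis using aI by blast
qed

text \<open>Small primes are bounded crudely, since 2^I depends only on \<open>a\<close> and
  \<open>f\<close>. A prime p >= 2^I exceeds a, so it does not divide a^v and must divide a^(u - v)
  - 1.\<close>

lemma sum_inverse_prime_factors_difference_le: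
  fixes a u v I :: nat
  assumes "a \<ge> 2" "a < 2 ^ I" "v < u"
  shows "(\<Sum>p\<in>prime_factors (a ^ u - a ^ v). 1 / real p) \<le>
     2 ^ I + (\<Sum>p | p \<in> prime_factors (a ^ u - a ^ v) \<and> 2 ^ I \<le> p. 1 / real p)"
    (is "?S \<le> _ + ?T")
    and "p \<in> prime_factors (a ^ u - a ^ v) \<Longrightarrow> 2 ^ I \<le> p \<Longrightarrow> ord p a dvd u - v"
proof -
  define r where "r = a ^ u - a ^ v"
  define A where "A = {p \<in> prime_factors r. p < 2 ^ I}"
  have "(\<Sum>p\<in>A. 1 / real p) \<le> (\<Sum>p\<in>A. 1)"
  proof (rule sum_mono)
    fix p assume "p \<in> A"
    then have "p \<ge> 1" unfolding A_def using in_prime_factors_imp_prime prime_ge_1_nat by blast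
    then show "1 / real p \<le> 1" by simp
  qed
  also have "\<dots> \<le> real (card {..<(2::nat) ^ I})"
    unfolding sum_constant mult_1_right by (intro of_nat_mono card_mono) (auto simp: A_def)
  finally have A: "(\<Sum>p\<in>A. 1 / real p) \<le> 2 ^ I" by simp
  have "prime_factors r = A \<union> {p \<in> prime_factors r. 2 ^ I \<le> p}" by (auto simp: A_def)
  then have "(\<Sum>p\<in>prime_factors r. 1 / real p) = (\<Sum>p\<in>A \<union> {p \<in> prime_factors r. 2 ^ I \<le> p}. 1 / real p)" by simp
  also have "\<dots> = (\<Sum>p\<in>A. 1 / real p) + (\<Sum>p | p \<in> prime_factors r \<and> 2 ^ I \<le> p. 1 / real p)"
    by (rule sum.union_disjoint) (auto simp: A_def)
  finally show "?S \<le> 2 ^ I + ?T" using A by (simp add: r_def)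
  assume p: "p \<in> prime_factors (a ^ u - a ^ v)" "2 ^ I \<le> p"
  have pp: "prime p" "p dvd a ^ u - a ^ v"
    using in_prime_factors_imp_prime[OF p(1)] in_prime_factors_imp_dvd[OF p(1)] .
  have "\<not> p dvd a" using p(2) assms by (auto dest: dvd_imp_le)
  have "a ^ v * a ^ (u - v) = a ^ u" using assms by (simp flip: power_add)
  then have "a ^ u - a ^ v = a ^ v * (a ^ (u - v) - 1)" by (simp only: diff_mult_distrib2 mult_1_right)
  then have "p dvd a ^ v \<or> p dvd a ^ (u - v) - 1" using pp by (simp add: prime_dvd_mult_iff)
  then have "p dvd a ^ (u - v) - 1" using \<open>\<not> p dvd a\<close> pp(1) prime_dvd_power by blast
  moreover have "a ^ (u - v) \<ge> 1" using assms by simp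
  ultimately have "[a ^ (u - v) = 1] (mod p)" by (metis cong_altdef_nat)
  then show "ord p a dvd u - v" by (simp only: ord_divides)
qed

lemma sum_divide_totient_thin_set_le:
  fixes f :: "int poly" and a :: nat
  assumes "degree f \<ge> 1" "lead_coeff f > 0" "a \<ge> 2"
    and pos: "\<forall>m::nat. m \<ge> 1 \<longrightarrow> poly f (int m) \<ge> 1"
  defines "h \<equiv> (\<lambda>s. nat (poly f (int s)))"
  shows "\<exists>C>0. \<forall>\<^sub>F M in at_top. \<forall>s'\<in>thin_set M.
     (\<Sum>s | s \<in> thin_set M \<and> h s' < h s. real (a ^ h s - a ^ h s') / real (totient (a ^ h s - a ^ h s')))
       \<le> C * real (card (thin_set M))"
proof -
  let ?t = "\<lambda>s s'. real (a ^ h s - a ^ h s') / real (totient (a ^ h s - a ^ h s'))"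
  obtain C0 \<kappa> :: real where C0: "C0 > 0" and \<kappa>: "\<kappa> > 0" and
    ev: "\<forall>\<^sub>F M in at_top. \<forall>e::nat. \<forall>s'\<in>thin_set M. e \<ge> 1 \<longrightarrow>
     real (card {s \<in> thin_set M. poly f (int s) \<noteq> poly f (int s') \<and> int e dvd poly f (int s) - poly f (int s')})
       \<le> C0 * real e powr (- \<kappa>) * real (card (thin_set M))"
    using card_thin_set_poly_cong_le[OF assms(1,2)] by (elim exE conjE) (rule that; assumption)
  \<comment> \<open>The tail bound is requested with epsilon = kappa, the saving in the congruence
    count.\<close>
  obtain I where I: "a < 2 ^ I" and small0: "\<forall>P. finite P \<longrightarrow> (\<forall>p\<in>P. prime p \<and> 2 ^ I \<le> p) \<longrightarrow>
     (\<Sum>p\<in>P. 1 / (real p * ln (real (ord p a)))) \<le> \<kappa>"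
    using sum_inverse_ln_ord_small[OF assms(3) \<kappa>] by (elim exE conjE) (rule that; assumption)
  have small: "\<And>P. finite P \<Longrightarrow> (\<And>p. p \<in> P \<Longrightarrow> prime p \<and> 2 ^ I \<le> p) \<Longrightarrow>
     (\<Sum>p\<in>P. 1 / (real p * ln (real (ord p a)))) \<le> \<kappa>" for P
    using small0 by simp
  define C where "C = exp (1 + 2 ^ I) * (1 + C0)"
  have C: "C > 0" using C0 by (simp add: C_def add_pos_pos)
  have "\<forall>\<^sub>F M in at_top. \<forall>s'\<in>thin_set M.
     (\<Sum>s | s \<in> thin_set M \<and> h s' < h s. ?t s s')
       \<le> C * real (card (thin_set M))"
    using ev
  proof eventually_elim
    case (elim M)
    show ?case
    proof
      fix s' assume s': "s' \<in> thin_set M"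
      let ?X = "\<lambda>s p. of_bool (ord p a dvd h s - h s') :: real"
      let ?o = "\<lambda>p. real (ord p a)"
      define N where "N = real (card (thin_set M))"
      define S where "S = {s \<in> thin_set M. h s' < h s}"
      define Q where "Q = (\<lambda>s. {p \<in> prime_factors (a ^ h s - a ^ h s'). 2 ^ I \<le> p})"
      define P where "P = (\<Union>s\<in>S. Q s)"
      define w where "w = (\<lambda>p. 1 / (real p * ln (?o p)))"
      define W where "W = sum w P"
      have finS: "finite S" by (simp add: S_def finite_thin_set)
      have finP: "finite P" using finS by (auto simp: P_def Q_def)
      have P: "prime p \<and> 2 ^ I \<le> p" if "p \<in> P" for p using that by (auto simp: P_def Q_def)
      have ord2: "ord p a \<ge> 2" if "p \<in> P" for p
        using P[OF that] I assms(3) by (intro ord_prime_ge_2) auto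
      have lnord: "ln (?o p) > 0" if "p \<in> P" for p
      proof -
        have "?o p \<ge> 2" using of_nat_mono[OF ord2[OF that], where ?'a = real] by simp
        then show ?thesis by (intro ln_gt_zero) linarith
      qed
      have pgt0: "real p > 0" if "p \<in> P" for p using P[OF that] prime_gt_0_nat by auto
      have w_pos: "w p > 0" if "p \<in> P" for p
        using lnord[OF that] pgt0[OF that] unfolding w_def by (intro divide_pos_pos mult_pos_pos) auto
      have W_le: "W \<le> \<kappa>" unfolding W_def w_def using finP P by (rule small)
      have NS: "real (card S) \<le> N" unfolding N_def by (intro of_nat_mono card_mono) (auto simp: S_def finite_thin_set)
      have sum_exp: "(\<Sum>s\<in>S. exp (\<Sum>p\<in>Q s. 1 / real p)) \<le> (1 + C0) * N"
      \<comment> \<open>Without large primes the total weight \<open>W\<close> is 0 and normalising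
        by it would be meaningless.\<close>
      proof (cases "P = {}")
        case True
        then have "Q s = {}" if "s \<in> S" for s using that by (auto simp: P_def)
        then have "(\<Sum>s\<in>S. exp (\<Sum>p\<in>Q s. 1 / real p)) = real (card S)" by simp
        also have "\<dots> \<le> (1 + C0) * N" using NS C0 by (simp add: N_def distrib_right add_increasing2)
        finally show ?thesis .
      next
        case False
        have W_pos: "W > 0" unfolding W_def using finP False w_pos by (intro sum_pos) auto
        have ptw: "exp (\<Sum>p\<in>Q s. 1 / real p) \<le> 1 + (\<Sum>p\<in>P. w p / W * (?o p powr \<kappa> * ?X s p))"
          if s: "s \<in> S" for s
        proof -
          have "(\<Sum>p\<in>Q s. 1 / real p) \<le> (\<Sum>p\<in>P. 1 / real p * ?X s p)"
          proof -
            have dvd: "ord p a dvd h s - h s'" if "p \<in> Q s" for p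
              using that s sum_inverse_prime_factors_difference_le(2)[OF assms(3) I, of "h s'" "h s" p]
              by (auto simp: Q_def S_def)
            have "(\<Sum>p\<in>Q s. 1 / real p) = (\<Sum>p\<in>Q s. 1 / real p * ?X s p)"
              by (rule sum.cong) (auto simp: dvd)
            also have "\<dots> \<le> (\<Sum>p\<in>P. 1 / real p * ?X s p)"
              by (rule sum_mono2) (use finP s in \<open>auto simp: P_def\<close>)
            finally show ?thesis .
          qed
          \<comment> \<open>By the choice of \<open>w\<close>, the factor ln of the order restores
            1/p. Dividing by \<open>W\<close> makes the weights sum to 1 and moves \<open>W\<close>
            into the exponent.\<close>
          also have "\<dots> = (\<Sum>p\<in>P. w p / W * (W * (ln (?o p) * ?X s p)))"
          proof (rule sum.cong[OF refl])
            fix p assume "p \<in> P"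
            then show "1 / real p * ?X s p = w p / W * (W * (ln (?o p) * ?X s p))"
              using W_pos lnord[of p] by (simp add: w_def)
          qed
          finally have "exp (\<Sum>p\<in>Q s. 1 / real p) \<le> exp (\<Sum>p\<in>P. w p / W * (W * (ln (?o p) * ?X s p)))"
            by simp
          also have "\<dots> \<le> (\<Sum>p\<in>P. w p / W * exp (W * (ln (?o p) * ?X s p)))"
          proof (rule exp_sum_le_sum_exp)
            show "(\<Sum>p\<in>P. w p / W) = 1" using W_pos by (simp add: W_def sum_divide_distrib[symmetric])
            show "0 \<le> w p / W" if "p \<in> P" for p using w_pos[OF that] W_pos by simp
          qed
          also have "\<dots> \<le> (\<Sum>p\<in>P. w p / W * (1 + ?o p powr \<kappa> * ?X s p))"
          proof (intro sum_mono mult_left_mono)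
            fix p assume p: "p \<in> P"
            show "0 \<le> w p / W" using w_pos[OF p] W_pos by simp
            \<comment> \<open>The indicator is 0 or 1: the exponential is 1 in the first case and
              ord^W <= ord^kappa in the second, so a sum bounds both.\<close>
            have "exp (W * ln (?o p)) = ?o p powr W" using ord2[OF p] by (simp add: powr_def)
            also have "\<dots> \<le> ?o p powr \<kappa>" using ord2[OF p] W_le by (intro powr_mono) auto
            finally show "exp (W * (ln (?o p) * ?X s p)) \<le> 1 + ?o p powr \<kappa> * ?X s p"
              by auto
          qed
          also have "\<dots> = (\<Sum>p\<in>P. w p / W) + (\<Sum>p\<in>P. w p / W * (?o p powr \<kappa> * ?X s p))"
            by (simp only: distrib_left mult_1_right sum.distrib)
          also have "(\<Sum>p\<in>P. w p / W) = 1" using W_pos by (simp add: W_def sum_divide_distrib[symmetric])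
          finally show ?thesis .
        qed
        have "(\<Sum>s\<in>S. exp (\<Sum>p\<in>Q s. 1 / real p)) \<le>
           (\<Sum>s\<in>S. 1 + (\<Sum>p\<in>P. w p / W * (?o p powr \<kappa> * ?X s p)))"
          by (intro sum_mono ptw)
        also have "\<dots> = real (card S) + (\<Sum>p\<in>P. \<Sum>s\<in>S. w p / W * (?o p powr \<kappa> * ?X s p))"
          unfolding sum.distrib by (simp add: sum.swap[of _ P S])
        also have "(\<Sum>p\<in>P. \<Sum>s\<in>S. w p / W * (?o p powr \<kappa> * ?X s p))
           \<le> (\<Sum>p\<in>P. w p / W * (C0 * N))"
        proof (rule sum_mono)
          fix p assume p: "p \<in> P"
          let ?D = "{s \<in> thin_set M. poly f (int s) \<noteq> poly f (int s') \<and> int (ord p a) dvd poly f (int s) - poly f (int s')}"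
          have sub: "{s \<in> S. ord p a dvd h s - h s'} \<subseteq>
             ?D"
          proof
            fix s assume s: "s \<in> {s \<in> S. ord p a dvd h s - h s'}"
            then have "s \<in> thin_set M" "h s' < h s" by (auto simp: S_def)
            then have "poly f (int s) \<ge> 1" using pos thin_set_ge[of s M] by (cases s) auto
            moreover have "poly f (int s') \<ge> 1" using pos s' thin_set_ge[of s' M] by (cases s') auto
            ultimately have diff: "int (h s - h s') = poly f (int s) - poly f (int s')"
              and "int (h s) = poly f (int s)" "int (h s') = poly f (int s')"
              using \<open>h s' < h s\<close> by (simp_all add: h_def of_nat_diff)
            then have neq: "poly f (int s) \<noteq> poly f (int s')" using \<open>h s' < h s\<close> by linarith
            have "int (ord p a) dvd int (h s - h s')" using s by (simp only: int_dvd_int_iff) simp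
            then have "int (ord p a) dvd poly f (int s) - poly f (int s')" by (simp only: diff)
            then show "s \<in> ?D"
              using \<open>s \<in> thin_set M\<close> neq by simp
          qed
          have "(\<Sum>s\<in>S. ?X s p) = real (card {s \<in> S. ord p a dvd h s - h s'})"
            using finS by (simp add: of_bool_def sum.If_cases Int_def)
          also have "\<dots> \<le> real (card ?D)"
            using sub by (intro of_nat_mono card_mono) (auto simp: finite_thin_set)
          also have "\<dots> \<le> C0 * ?o p powr (- \<kappa>) * N"
            unfolding N_def using elim s' ord2[OF p] by auto
          finally have cnt: "(\<Sum>s\<in>S. ?X s p) \<le> C0 * ?o p powr (- \<kappa>) * N" .
          have "(\<Sum>s\<in>S. w p / W * (?o p powr \<kappa> * ?X s p)) =
              w p / W * (?o p powr \<kappa> * (\<Sum>s\<in>S. ?X s p))"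
            by (simp only: sum_distrib_left)
          also have "\<dots> \<le> w p / W * (?o p powr \<kappa> * (C0 * ?o p powr (- \<kappa>) * N))"
            using cnt w_pos[OF p] W_pos by (intro mult_left_mono) auto
          \<comment> \<open>The two powers of the order cancel, so what remains is an average over p
            of the same constant.\<close>
          also have "?o p powr \<kappa> * (C0 * ?o p powr (- \<kappa>) * N) = C0 * N"
            using ord2[OF p] by (simp add: powr_minus)
          finally show "(\<Sum>s\<in>S. w p / W * (?o p powr \<kappa> * ?X s p)) \<le> w p / W * (C0 * N)" .
        qed
        also have "(\<Sum>p\<in>P. w p / W * (C0 * N)) = C0 * N"
          using W_pos by (simp add: W_def sum_divide_distrib[symmetric] sum_distrib_right[symmetric])
        finally show ?thesis using NS by (simp add: distrib_right)
      qed
      have "(\<Sum>s\<in>S. ?t s s')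
          \<le> (\<Sum>s\<in>S. exp (1 + 2 ^ I) * exp (\<Sum>p\<in>Q s. 1 / real p))"
      proof (rule sum_mono)
        fix s assume "s \<in> S"
        then have lt: "h s' < h s" by (simp add: S_def)
        then have "a ^ h s' < a ^ h s" using assms(3) by (intro power_strict_increasing) auto
        then have "?t s s' \<le> exp (1 + (\<Sum>p\<in>prime_factors (a ^ h s - a ^ h s'). 1 / real p))"
          by (intro divide_totient_le) auto
        also have "\<dots> \<le> exp (1 + (2 ^ I + (\<Sum>p\<in>Q s. 1 / real p)))"
          using sum_inverse_prime_factors_difference_le(1)[OF assms(3) I lt] by (simp add: Q_def)
        also have "\<dots> = exp (1 + 2 ^ I) * exp (\<Sum>p\<in>Q s. 1 / real p)" by (simp add: exp_add)
        finally show "?t s s' \<le> exp (1 + 2 ^ I) * exp (\<Sum>p\<in>Q s. 1 / real p)" .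
      qed
      also have "\<dots> = exp (1 + 2 ^ I) * (\<Sum>s\<in>S. exp (\<Sum>p\<in>Q s. 1 / real p))" by (rule sum_distrib_left[symmetric])
      also have "\<dots> \<le> exp (1 + 2 ^ I) * ((1 + C0) * N)" using sum_exp by (intro mult_left_mono) auto
      finally show "(\<Sum>s | s \<in> thin_set M \<and> h s' < h s. ?t s s')
       \<le> C * real (card (thin_set M))" by (simp add: S_def N_def C_def)
    qed
  qed
  then show ?thesis using C by blast
qed

section \<open>Size of the thin set and choice of the exponents for given x\<close>

lemma ln_quart_ge:
  "eventually (\<lambda>M. ln (real (quart M)) \<ge> ln (real M) / 8) at_top"
proof -
  have "eventually (\<lambda>M::nat. real M powr (1/8) \<ge> 2) at_top" by real_asymp
  moreover have "eventually (\<lambda>M::nat. M \<ge> 1) at_top" by (rule eventually_ge_at_top)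
  ultimately show ?thesis
  proof eventually_elim
    case (elim M)
    have "\<not> Suc (quart M) \<le> quart M" by simp
    then have "M < Suc (quart M) ^ 4" unfolding le_quart_iff by simp
    then have "real M \<le> real (Suc (quart M) ^ 4)" by (intro of_nat_mono) simp
    then have "real M powr (1/4) \<le> real (Suc (quart M) ^ 4) powr (1/4)" by (intro powr_mono2) auto
    also have "real (Suc (quart M) ^ 4) = real (Suc (quart M)) powr 4" by (simp add: powr_numeral)
    also have "(real (Suc (quart M)) powr 4) powr (1/4) = real (Suc (quart M))" unfolding powr_powr by simp
    also have "\<dots> \<le> 2 * real (quart M)" using quart_ge_1[OF elim(2)] by simp
    finally have "real M powr (1/4) / 2 \<le> real (quart M)" by simp
    moreover have "real M powr (1/4) = real M powr (1/8) * real M powr (1/8)" by (simp flip: powr_add)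
    moreover have "real M powr (1/8) * 2 \<le> real M powr (1/8) * real M powr (1/8)"
      using elim by (intro mult_left_mono) auto
    ultimately have "real M powr (1/8) \<le> real (quart M)" by linarith
    then have "ln (real M powr (1/8)) \<le> ln (real (quart M))" using elim by (intro ln_mono) auto
    then show ?case using elim by (simp add: ln_powr)
  qed
qed

text \<open>One factor 3 comes from sqrt (1/8) >= 1/3 in passing to \<open>quart M\<close>, another
  from \<open>split_harm_ge\<close>; 180 = 20 * 9.\<close>

lemma card_thin_set_ge':
  "eventually (\<lambda>M. real M / (180 * sqrt (ln (real M))) \<le> real (card (thin_set M))) at_top"
proof -
  have "eventually (\<lambda>M::nat. M \<ge> 2) at_top" by (rule eventually_ge_at_top)
  with card_thin_set_ge ln_quart_ge show ?thesis
  proof eventually_elim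
    case (elim M)
    let ?q = "sqrt (ln (real M))"
    have lnM: "ln (real M) > 0" using elim by simp
    have "?q / 3 \<le> sqrt (ln (real M) / 8)"
    proof (rule real_le_rsqrt)
      show "(?q / 3)\<^sup>2 \<le> ln (real M) / 8" using lnM by (simp add: power_divide)
    qed
    also have "\<dots> \<le> sqrt (ln (real (quart M)))" using elim by (intro real_sqrt_le_mono)
    finally have "?q / 9 \<le> sqrt (ln (real (quart M))) / 3" by simp
    also have "\<dots> \<le> split_harm (quart M)" using elim by (intro split_harm_ge quart_ge_1) auto
    finally have F: "?q / 9 \<le> split_harm (quart M)" .
    have frac: "r / (180 * q) = r * (q / 9) / (20 * (q * q))" if "q > 0" for r q :: real
      using that by (simp add: field_simps)
    have "real M / (180 * ?q) = real M * (?q / 9) / (20 * (?q * ?q))"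
      using lnM by (intro frac) simp
    also have "\<dots> = real M * (?q / 9) / (20 * ln (real M))" using lnM by simp
    also have "\<dots> \<le> real M * split_harm (quart M) / (20 * ln (real M))"
      using F lnM by (intro divide_right_mono mult_left_mono) auto
    also have "\<dots> \<le> real (card (thin_set M))" using elim by simp
    finally show ?case .
  qed
qed

lemma card_poly_fibre_le:
  fixes f :: "int poly"
  assumes "degree f \<ge> 1"
  shows "finite {s::nat. poly f (int s) = v}" "card {s::nat. poly f (int s) = v} \<le> degree f"
proof -
  define q where "q = f - [:v:]"
  have deg: "degree q \<le> degree f" unfolding q_def by (intro degree_diff_le) auto
  have q0: "q \<noteq> 0"
  proof
    assume "q = 0"
    then have "f = [:v:]" by (simp add: q_def)
    then show False using assms by simp
  qed
  have im: "int ` {s::nat. poly f (int s) = v} \<subseteq> {x. poly q x = 0}" by (auto simp: q_def)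
  have fin: "finite {x. poly q x = 0}" using q0 by (rule poly_roots_finite)
  show "finite {s::nat. poly f (int s) = v}"
    using finite_subset[OF im fin] by (rule finite_imageD) simp
  have "card {s::nat. poly f (int s) = v} = card (int ` {s::nat. poly f (int s) = v})"
    by (simp add: card_image)
  also have "\<dots> \<le> card {x. poly q x = 0}" using fin im by (rule card_mono)
  also have "\<dots> \<le> degree q" using q0 by (rule card_poly_roots_bound)
  also note deg
  finally show "card {s::nat. poly f (int s) = v} \<le> degree f" .
qed

lemma exists_thin_exponents:
  fixes f :: "int poly" and a :: nat
  assumes "degree f \<ge> 1" "lead_coeff f > 0" "a \<ge> 2"
    and pos: "\<forall>m::nat. m \<ge> 1 \<longrightarrow> poly f (int m) \<ge> 1"
  defines "h \<equiv> (\<lambda>s. nat (poly f (int s)))"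
  shows "\<exists>C c :: real. \<exists>T :: real \<Rightarrow> nat set. C > 0 \<and> c > 0 \<and> (\<forall>\<^sub>F x in at_top.
     finite (T x) \<and> T x \<subseteq> sums_of_two_squares \<and>
     (\<forall>s\<in>T x. real (a ^ h s) \<le> x / 2) \<and>
     c * (ln x powr (1 / real (degree f)) / ln (ln x) powr (1 / 2)) \<le> real (card (T x)) \<and>
     (\<forall>s'\<in>T x. (\<Sum>s | s \<in> T x \<and> h s' < h s. real (a ^ h s - a ^ h s') / real (totient (a ^ h s - a ^ h s')))
       \<le> C * real (card (T x))))"
proof -
  let ?t = "\<lambda>s s'. real (a ^ h s - a ^ h s') / real (totient (a ^ h s - a ^ h s'))"
  define d where "d = degree f"
  have d: "d \<ge> 1" using assms by (simp add: d_def)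
  obtain C where C: "C > 0" and ev: "\<forall>\<^sub>F M in at_top. \<forall>s'\<in>thin_set M.
     (\<Sum>s | s \<in> thin_set M \<and> h s' < h s. ?t s s')
       \<le> C * real (card (thin_set M))"
    using sum_divide_totient_thin_set_le[OF assms(1-4)] unfolding h_def by (elim exE conjE) (rule that[unfolded h_def]; assumption)
  obtain \<Gamma> :: nat where \<Gamma>: "\<Gamma> > 0" and poly_le: "\<And>n::nat. n \<ge> 1 \<Longrightarrow> \<bar>poly f (int n)\<bar> \<le> int \<Gamma> * int n ^ d"
    using abs_poly_le[of f] unfolding d_def by blast
  define G where "G = real \<Gamma> * ln (real a)"
  have lna: "ln (real a) \<ge> ln 2" using assms(3) by (intro ln_mono) auto
  \<comment> \<open>Gives y x <= (2 ln x)^(1/d) <= 2 ln x, whence ln M <= 2 ln (ln x).\<close>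
  have G: "G \<ge> 1 / 2"
  proof -
    have "1 * (1 / 2) \<le> real \<Gamma> * ln (real a)"
      using \<Gamma> lna ln2_ge_two_thirds by (intro mult_mono) auto
    then show ?thesis by (simp add: G_def)
  qed
  \<comment> \<open>The solution of a^(Gamma y^d) = x/2, so that f(s) <= Gamma s^d keeps every power
    a^f(s) with s <= y at most x/2.\<close>
  define y where "y = (\<lambda>x. (ln (x / 2) / G) powr (1 / real d))"
  define M where "M = (\<lambda>x. nat \<lfloor>y x\<rfloor>)"
  \<comment> \<open>1/(2G) reflects ln (x/2) >= (ln x)/2, sqrt 2 the bound ln M <= 2 ln (ln x), and
    360 = 2 * 180 the rounding y <= 2M.\<close>
  define c where "c = (1 / (2 * G)) powr (1 / real d) / (360 * sqrt 2)"
  have c: "c > 0" using G by (simp add: c_def)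
  have y_lim: "filterlim y at_top at_top"
  proof -
    have "filterlim (\<lambda>x. (ln (x / 2) / G) powr (1 / real d)) at_top at_top"
      using G d by real_asymp
    then show ?thesis by (simp add: y_def)
  qed
  have M_lim: "filterlim M at_top at_top"
    unfolding M_def by (intro filterlim_compose[OF filterlim_nat_sequentially] filterlim_compose[OF filterlim_floor_sequentially] y_lim)
  let ?T = "\<lambda>x. thin_set (M x)"
  have ev1: "\<forall>\<^sub>F x in at_top. \<forall>s'\<in>?T x.
     (\<Sum>s | s \<in> ?T x \<and> h s' < h s. ?t s s')
       \<le> C * real (card (?T x))"
    using ev M_lim by (rule eventually_compose_filterlim)
  have ev2: "\<forall>\<^sub>F x in at_top. real (M x) / (180 * sqrt (ln (real (M x)))) \<le> real (card (?T x))"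
    using card_thin_set_ge' M_lim by (rule eventually_compose_filterlim)
  have ev3: "\<forall>\<^sub>F x in at_top. y x \<ge> 2" using y_lim by (simp add: filterlim_at_top)
  have ev4: "\<forall>\<^sub>F x::real in at_top. x \<ge> 4 \<and> ln x \<ge> exp 1"
  proof (rule eventually_conj)
    show "\<forall>\<^sub>F x::real in at_top. ln x \<ge> exp 1" by real_asymp
  qed (rule eventually_ge_at_top)
  from ev1 ev2 ev3 ev4 have "\<forall>\<^sub>F x in at_top.
     finite (?T x) \<and> ?T x \<subseteq> sums_of_two_squares \<and>
     (\<forall>s\<in>?T x. real (a ^ h s) \<le> x / 2) \<and>
     c * (ln x powr (1 / real d) / ln (ln x) powr (1 / 2)) \<le> real (card (?T x)) \<and>
     (\<forall>s'\<in>?T x. (\<Sum>s | s \<in> ?T x \<and> h s' < h s. ?t s s')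
       \<le> C * real (card (?T x)))"
  proof eventually_elim
    case (elim x)
    have x: "x \<ge> 4" "ln x \<ge> exp 1" "ln x \<ge> 1"
      using elim exp_ge_add_one_self[of "1::real"] by auto
    have M1: "real (M x) \<le> y x" "y x \<le> 2 * real (M x)" "M x \<ge> 2"
    proof -
      have fl: "\<lfloor>y x\<rfloor> \<ge> 2" using elim(3) by simp
      then have eq: "real (M x) = of_int \<lfloor>y x\<rfloor>" by (simp add: M_def)
      show "real (M x) \<le> y x" using eq by simp
      have "y x < real (M x) + 1" using eq by (simp add: real_of_int_floor_add_one_gt)
      moreover show M2: "M x \<ge> 2" using fl unfolding M_def by linarith
      ultimately show "y x \<le> 2 * real (M x)" by simp
    qed
    have lnx2: "ln (x / 2) > 0" using x by simp
    have bound: "real (a ^ h s) \<le> x / 2" if s: "s \<in> ?T x" for s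
    proof -
      have s1: "s \<ge> 1" using thin_set_ge[OF s] by (cases s) auto
      have "int (h s) = poly f (int s)" using pos[rule_format, OF s1] by (simp add: h_def)
      also have "\<dots> \<le> int \<Gamma> * int s ^ d" using poly_le[OF s1] by linarith
      finally have "int (h s) \<le> int (\<Gamma> * s ^ d)" by simp
      then have "h s \<le> \<Gamma> * s ^ d" by (simp only: of_nat_le_iff)
      then have "real (h s) \<le> real (\<Gamma> * s ^ d)" by (rule of_nat_mono)
      also have "\<dots> = real \<Gamma> * real s ^ d" by simp
      also have "\<dots> \<le> real \<Gamma> * y x ^ d"
      proof (intro mult_left_mono power_mono)
        have "real s \<le> real (M x)" using thin_set_le[OF s] by (rule of_nat_mono)
        then show "real s \<le> y x" using M1 by linarith
      qed auto
      also have "y x ^ d = y x powr real d" using elim(3) by (intro powr_realpow[symmetric]) linarith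
      also have "\<dots> = ln (x / 2) / G" using d lnx2 G by (simp add: y_def powr_powr)
      finally have "real (h s) * ln (real a) \<le> real \<Gamma> * (ln (x / 2) / G) * ln (real a)"
        using lna by (intro mult_right_mono) (auto intro: order.trans[of 0 "ln 2"])
      also have "\<dots> = G * (ln (x / 2) / G)" unfolding G_def by (simp only: mult_ac)
      also have "\<dots> = ln (x / 2)" using G by simp
      finally have "exp (real (h s) * ln (real a)) \<le> exp (ln (x / 2))" by simp
      then show ?thesis using assms(3) x by (simp add: exp_of_nat_mult)
    qed
    have lnln: "ln (ln x) \<ge> 1"
      using x(2) ln_mono[of "exp 1" "ln x"] by simp
    have lnM: "ln (real (M x)) \<le> 2 * ln (ln x)"
    proof -
      have "y x \<le> (2 * ln x) powr (1 / real d)" unfolding y_def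
      proof (intro powr_mono2)
        have "ln (x / 2) / G \<le> ln (x / 2) / (1 / 2)" using G lnx2 by (intro divide_left_mono) auto
        also have "\<dots> \<le> 2 * ln x" using x by simp
        finally show "ln (x / 2) / G \<le> 2 * ln x" .
      qed (use lnx2 G in auto)
      also have "\<dots> \<le> (2 * ln x) powr 1"
      proof (rule powr_mono)
        have "exp 1 \<ge> (1::real)" by simp
        then show "1 \<le> 2 * ln x" using x by linarith
      qed (use d in auto)
      also have "\<dots> = 2 * ln x" using x by simp
      finally have "real (M x) \<le> 2 * ln x" using M1 by linarith
      then have "ln (real (M x)) \<le> ln (2 * ln x)" using M1 by (intro ln_mono) auto
      also have "\<dots> = ln 2 + ln (ln x)" using x by (intro ln_mult_pos) (auto intro: less_le_trans[OF exp_gt_zero])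
      also have "\<dots> \<le> 2 * ln (ln x)" using lnln ln_2_less_1 by linarith
      finally show ?thesis .
    qed
    have lnM_pos: "ln (real (M x)) > 0" using M1 by simp
    have "c * (ln x powr (1 / real d) / ln (ln x) powr (1 / 2)) =
        (ln x / (2 * G)) powr (1 / real d) / (360 * sqrt (2 * ln (ln x)))"
    proof -
      have "ln (ln x) powr (1 / 2) = sqrt (ln (ln x))" using lnln by (intro powr_half_sqrt) linarith
      moreover have "0 \<le> ln x" using x by (auto intro: order.trans[OF exp_ge_zero])
      then have "(ln x / (2 * G)) powr (1 / real d) = ln x powr (1 / real d) * (1 / (2 * G)) powr (1 / real d)"
        using G by (simp flip: powr_mult)
      ultimately show ?thesis by (simp add: c_def real_sqrt_mult mult_ac)
    qed
    also have "\<dots> \<le> y x / (360 * sqrt (2 * ln (ln x)))"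
      unfolding y_def
    proof (intro divide_right_mono powr_mono2)
      have "sqrt x * sqrt x = x" using x by simp
      moreover have "2 \<le> sqrt x" using x by (intro real_le_rsqrt) auto
      then have "2 * sqrt x \<le> sqrt x * sqrt x" by (intro mult_right_mono) (use x in auto)
      ultimately have "sqrt x \<le> x / 2" by simp
      then have "ln (sqrt x) \<le> ln (x / 2)" using x by (intro ln_mono) auto
      then have "ln x / 2 \<le> ln (x / 2)" using x by (simp add: ln_sqrt)
      then have "ln x / 2 / G \<le> ln (x / 2) / G" using G by (intro divide_right_mono) auto
      then show "ln x / (2 * G) \<le> ln (x / 2) / G" by simp
    qed (use x G lnln in \<open>auto intro: order.trans[OF exp_ge_zero]\<close>)
    also have "\<dots> \<le> (2 * real (M x)) / (360 * sqrt (2 * ln (ln x)))"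
      using M1 lnln by (intro divide_right_mono) auto
    also have "\<dots> \<le> (2 * real (M x)) / (360 * sqrt (ln (real (M x))))"
      using lnM lnM_pos by (intro divide_left_mono mult_left_mono real_sqrt_le_mono mult_pos_pos) auto
    also have "\<dots> = real (M x) / (180 * sqrt (ln (real (M x))))" by simp
    also note elim(2)
    finally have card: "c * (ln x powr (1 / real d) / ln (ln x) powr (1 / 2)) \<le> real (card (?T x))" .
    show ?case using finite_thin_set thin_set_subset bound card elim(1) by blast
  qed
  then show ?thesis unfolding d_def
    using C c by (intro exI[of _ C] exI[of _ c] exI[of _ "\<lambda>x. ?T x"] conjI)
qed

section \<open>The second moment\<close>

text \<open>Paley--Zygmund: values below t make up at most half of the first moment, and
  Cauchy--Schwarz on the other values bounds the rest.\<close>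

lemma card_large_values_ge:
  fixes r :: "'a \<Rightarrow> real"
  assumes "finite V" "sum r V \<ge> D" "D \<ge> 0" "t \<ge> 0" "t * real (card V) \<le> D / 2"
  shows "(D / 2)\<^sup>2 \<le> real (card {n \<in> V. r n \<ge> t}) * (\<Sum>n\<in>V. (r n)\<^sup>2)"
proof -
  define B where "B = {n \<in> V. r n \<ge> t}"
  have B: "B \<subseteq> V" "finite B" using assms(1) by (auto simp: B_def)
  have "sum r V = sum r (V - B) + sum r B" using B assms(1) by (intro sum.subset_diff)
  moreover have "sum r (V - B) \<le> t * real (card V)"
  proof -
    have "sum r (V - B) \<le> (\<Sum>n\<in>V - B. t)" by (intro sum_mono) (auto simp: B_def)
    also have "\<dots> = t * real (card (V - B))" by simp
    also have "\<dots> \<le> t * real (card V)"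
      using assms(1,4) by (intro mult_left_mono of_nat_mono card_mono) auto
    finally show ?thesis .
  qed
  ultimately have "D / 2 \<le> sum r B" using assms(2,5) by linarith
  then have "(D / 2)\<^sup>2 \<le> (sum r B)\<^sup>2" using assms(3) by (intro power_mono) auto
  also have "\<dots> = (\<Sum>n\<in>B. 1 * r n)\<^sup>2" by simp
  also have "\<dots> \<le> (\<Sum>n\<in>B. 1\<^sup>2) * (\<Sum>n\<in>B. (r n)\<^sup>2)" by (rule Cauchy_Schwarz_ineq_sum)
  also have "\<dots> = real (card B) * (\<Sum>n\<in>B. (r n)\<^sup>2)" by simp
  also have "\<dots> \<le> real (card B) * (\<Sum>n\<in>V. (r n)\<^sup>2)"
    using assms(1) B by (intro mult_left_mono sum_mono2) auto
  finally show ?thesis by (simp add: B_def)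
qed

lemma sum_card_fibres_squared_le:
  fixes g :: "'a \<Rightarrow> 'b"
  assumes "finite E" "finite V"
  shows "(\<Sum>n\<in>V. (real (card {z \<in> E. g z = n}))\<^sup>2) \<le> (\<Sum>z\<in>E. \<Sum>z'\<in>E. of_bool (g z = g z'))"
proof -
  have "(\<Sum>n\<in>V. (real (card {z \<in> E. g z = n}))\<^sup>2) = (\<Sum>n\<in>V. \<Sum>z\<in>E. \<Sum>z'\<in>E. of_bool (g z = n) * of_bool (g z' = n))"
  proof (rule sum.cong[OF refl])
    fix n
    have "real (card {z \<in> E. g z = n}) = (\<Sum>z\<in>E. of_bool (g z = n))"
      using assms(1) by (simp add: of_bool_def sum.If_cases Int_def)
    then show "(real (card {z \<in> E. g z = n}))\<^sup>2 = (\<Sum>z\<in>E. \<Sum>z'\<in>E. of_bool (g z = n) * of_bool (g z' = n))"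
      by (simp only: power2_eq_square sum_product)
  qed
  also have "\<dots> = (\<Sum>z\<in>E. \<Sum>z'\<in>E. \<Sum>n\<in>V. of_bool (g z = n) * of_bool (g z' = n))"
    by (subst sum.swap, rule sum.cong[OF refl], rule sum.swap)
  also have "\<dots> \<le> (\<Sum>z\<in>E. \<Sum>z'\<in>E. of_bool (g z = g z'))"
  proof (intro sum_mono)
    fix z z'
    have "(\<Sum>n\<in>V. of_bool (g z = n) * of_bool (g z' = n)) \<le> (\<Sum>n\<in>V. if n = g z then of_bool (g z = g z') else (0::real))"
      by (rule sum_mono) auto
    also have "\<dots> \<le> of_bool (g z = g z')" using assms(2) by (simp add: sum.delta)
    finally show "(\<Sum>n\<in>V. of_bool (g z = n) * of_bool (g z' = n)) \<le> (of_bool (g z = g z') :: real)" .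
  qed
  finally show ?thesis .
qed

lemma finite_seq_le:
  fixes \<alpha> :: "nat \<Rightarrow> nat"
  assumes "strict_mono_on {1..} \<alpha>"
  shows "finite {k. 1 \<le> k \<and> real (\<alpha> k) \<le> x}"
proof (rule finite_imageD)
  show "finite (\<alpha> ` {k. 1 \<le> k \<and> real (\<alpha> k) \<le> x})"
    by (rule finite_subset[of _ "{..nat \<lfloor>x\<rfloor>}"]) (auto simp: le_nat_floor)
  show "inj_on \<alpha> {k. 1 \<le> k \<and> real (\<alpha> k) \<le> x}"
    using strict_mono_on_imp_inj_on[OF assms] by (rule inj_on_subset) auto
qed

text \<open>By injectivity each k has at most one partner k', and then \<open>\<alpha> k'\<close> is
  \<open>\<alpha> k\<close> plus the shift. Assuming v <= u keeps the shift u - v free of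
  truncation.\<close>

lemma sum_shifted_pairs_le:
  fixes \<alpha> :: "nat \<Rightarrow> nat" and u v :: nat and x :: real
  assumes "strict_mono_on {1..} \<alpha>" "v \<le> u"
  defines "K \<equiv> {k. 1 \<le> k \<and> real (\<alpha> k) \<le> x}"
  shows "(\<Sum>k\<in>K. \<Sum>k'\<in>K. of_bool (\<alpha> k + u = \<alpha> k' + v)) \<le> real (seq_shift_count \<alpha> x (u - v))"
proof -
  have fin: "finite K" unfolding K_def using assms(1) by (rule finite_seq_le)
  have inj: "inj_on \<alpha> {1..}" using assms(1) by (rule strict_mono_on_imp_inj_on)
  let ?E = "\<lambda>k k'. of_bool (\<alpha> k + u = \<alpha> k' + v)"
  have "(\<Sum>k\<in>K. \<Sum>k'\<in>K. ?E k k') \<le> (\<Sum>k\<in>K. of_bool (\<alpha> k + (u - v) \<in> seq_set \<alpha>) :: real)"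
  proof (rule sum_mono)
    fix k assume "k \<in> K"
    show "(\<Sum>k'\<in>K. ?E k k') \<le> (of_bool (\<alpha> k + (u - v) \<in> seq_set \<alpha>) :: real)"
    proof (cases "\<exists>k0\<in>K. \<alpha> k + u = \<alpha> k0 + v")
      case True
      then obtain k0 where k0: "k0 \<in> K" "\<alpha> k + u = \<alpha> k0 + v" by blast
      have "(\<Sum>k'\<in>K. ?E k k') \<le> (\<Sum>k'\<in>K. if k' = k0 then 1 else (0::real))"
      proof (rule sum_mono)
        fix k' assume k': "k' \<in> K"
        have "k' = k0" if "\<alpha> k + u = \<alpha> k' + v"
        proof (rule inj_onD[OF inj])
          show "\<alpha> k' = \<alpha> k0" using that k0 by linarith
        qed (use k0 k' in \<open>simp_all add: K_def\<close>)
        then show "?E k k' \<le> (if k' = k0 then 1 else (0::real))" by auto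
      qed
      also have "\<dots> = 1" using fin k0 by (simp add: sum.delta)
      finally have le1: "(\<Sum>k'\<in>K. ?E k k') \<le> (1::real)" .
      have "\<alpha> k + (u - v) = \<alpha> k0" using k0 assms(2) by linarith
      moreover have "\<alpha> k0 \<in> seq_set \<alpha>" using k0 by (auto simp: seq_set_def K_def)
      ultimately show ?thesis using le1 by simp
    next
      case False
      then have "(\<Sum>k'\<in>K. ?E k k') = (0::real)" by (intro sum.neutral) auto
      then show ?thesis by simp
    qed
  qed
  also have "\<dots> = real (card {k \<in> K. \<alpha> k + (u - v) \<in> seq_set \<alpha>})"
    using fin by (simp add: of_bool_def sum.If_cases Int_def)
  also have "{k \<in> K. \<alpha> k + (u - v) \<in> seq_set \<alpha>} = {n. 1 \<le> n \<and> real (\<alpha> n) \<le> x \<and> \<alpha> n + (u - v) \<in> seq_set \<alpha>}"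
    by (auto simp: K_def)
  finally show ?thesis by (simp add: seq_shift_count_def)
qed

text \<open>Lets the diagonal pairs h s = h s' pass through \<open>sum_shifted_pairs_le\<close> with
  shift 0.\<close>

lemma seq_shift_count_0: "seq_shift_count \<alpha> x 0 = seq_count \<alpha> x"
  unfolding seq_shift_count_def seq_count_def by (rule arg_cong[of _ _ card]) (auto simp: seq_set_def)

text \<open>Stated at a single x, with e standing for \<open>\<eta> x\<close>. Both moments are
  explicit in N = |T|: the first is at least K1 K3 x N / e, the second splits into pairs with equal
  h, controlled by fibres of size d, and the remaining ordered pairs, controlled by
  \<open>avg\<close>; these occur twice by symmetry.\<close>

lemma card_many_representations_ge:
  fixes \<alpha> h :: "nat \<Rightarrow> nat" and a d :: nat and T :: "nat set" and x e K1 K2 K3 K4 C :: real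
  assumes mono: "strict_mono_on {1..} \<alpha>" and ge1: "\<forall>n\<ge>1. \<alpha> n \<ge> 1"
    and K: "K1 > 0" "K2 > 0" "K3 > 0" "K4 > 0" and C: "C > 0" and e: "e > 0" and x: "x \<ge> 2" and a: "a \<ge> 2"
    and count: "K1 * x / e \<le> real (seq_count \<alpha> x)" "real (seq_count \<alpha> x) \<le> K2 * x / e"
    and half: "K3 * real (seq_count \<alpha> x) \<le> real (seq_count \<alpha> (x / 2))"
    and shift: "\<And>r::nat. r \<ge> 1 \<Longrightarrow> real (seq_shift_count \<alpha> x r) \<le> K4 * (real r / real (totient r)) * (x / e\<^sup>2)"
    and T: "finite T" "T \<noteq> {}" "\<And>s. s \<in> T \<Longrightarrow> real (a ^ h s) \<le> x / 2"
    and fibre: "\<And>v. card {s \<in> T. h s = v} \<le> d"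
    and avg: "\<And>s'. s' \<in> T \<Longrightarrow> (\<Sum>s | s \<in> T \<and> h s' < h s. real (a ^ h s - a ^ h s') / real (totient (a ^ h s - a ^ h s')))
       \<le> C * real (card T)"
  defines "N \<equiv> real (card T)"
  shows "(K1 * K3 / 2)\<^sup>2 * x * N \<le> real (card {n. 1 \<le> n \<and> real n \<le> x \<and>
       K1 * K3 * N / (2 * e) \<le> real (card {(k, s). 1 \<le> k \<and> s \<in> T \<and> \<alpha> k + a ^ h s = n})}) *
     (real d * K2 * e + 2 * K4 * C * N)"
proof -
  let ?E = "\<lambda>k s k' s'. of_bool (\<alpha> k + a ^ h s = \<alpha> k' + a ^ h s') :: real"
  let ?t = "\<lambda>s s'. real (a ^ h s - a ^ h s') / real (totient (a ^ h s - a ^ h s'))"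
  define K where "K = {k. 1 \<le> k \<and> real (\<alpha> k) \<le> x}"
  define g where "g = (\<lambda>(k, s). \<alpha> k + a ^ h s)"
  define V where "V = {n::nat. 1 \<le> n \<and> real n \<le> x}"
  define R where "R = (\<lambda>n. real (card {z \<in> K \<times> T. g z = n}))"
  define A where "A = real (seq_count \<alpha> x)"
  define B where "B = (\<lambda>s s'. real (seq_shift_count \<alpha> x (a ^ h s - a ^ h s')))"
  have finK: "finite K" unfolding K_def using mono by (rule finite_seq_le)
  have finV: "finite V" by (rule finite_subset[of _ "{..nat \<lfloor>x\<rfloor>}"]) (auto simp: V_def le_nat_floor)
  have N: "N \<ge> 1" using T by (simp add: N_def Suc_le_eq card_gt_0_iff)
  have R_eq: "real (card {(k, s). 1 \<le> k \<and> s \<in> T \<and> \<alpha> k + a ^ h s = n}) = R n" if "n \<in> V" for n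
  proof -
    have "{(k, s). 1 \<le> k \<and> s \<in> T \<and> \<alpha> k + a ^ h s = n} = {z \<in> K \<times> T. g z = n}"
    proof -
      have "real (\<alpha> k) \<le> x" if "\<alpha> k + a ^ h s = n" for k s
      proof -
        have "real (\<alpha> k) \<le> real n" using that by (intro of_nat_mono) simp
        then show ?thesis using \<open>n \<in> V\<close> by (simp add: V_def)
      qed
      then have iff: "(k, s) \<in> {(k, s). 1 \<le> k \<and> s \<in> T \<and> \<alpha> k + a ^ h s = n} \<longleftrightarrow> (k, s) \<in> {z \<in> K \<times> T. g z = n}" for k s
        unfolding K_def g_def by (simp, blast)
      show ?thesis
      proof (rule Set.set_eqI)
        fix z show "z \<in> {(k, s). 1 \<le> k \<and> s \<in> T \<and> \<alpha> k + a ^ h s = n} \<longleftrightarrow> z \<in> {z \<in> K \<times> T. g z = n}"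
          by (cases z) (simp only: iff)
      qed
    qed
    then show ?thesis by (simp add: R_def)
  qed
  have first: "K1 * K3 * x * N / e \<le> sum R V"
  proof -
    \<comment> \<open>Halving both summands guarantees that the represented number is at most
      x.\<close>
    define K' where "K' = {k. 1 \<le> k \<and> real (\<alpha> k) \<le> x / 2}"
    have K': "K' \<subseteq> K" using x by (auto simp: K'_def K_def)
    have "K1 * K3 * x * N / e = K3 * (K1 * x / e) * N" by simp
    also have "\<dots> \<le> K3 * real (seq_count \<alpha> x) * N"
      using count(1) K N by (intro mult_right_mono mult_left_mono) auto
    also have "\<dots> \<le> real (seq_count \<alpha> (x / 2)) * N" using half N by (intro mult_right_mono) auto
    also have "\<dots> = real (card (K' \<times> T))" by (simp add: seq_count_def K'_def N_def card_cartesian_product)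
    also have "\<dots> \<le> real (card (\<Union>n\<in>V. {z \<in> K \<times> T. g z = n}))"
    proof (intro of_nat_mono card_mono)
      show "finite (\<Union>n\<in>V. {z \<in> K \<times> T. g z = n})" using finV finK T by auto
      show "K' \<times> T \<subseteq> (\<Union>n\<in>V. {z \<in> K \<times> T. g z = n})"
      proof
        fix z assume z: "z \<in> K' \<times> T"
        then obtain k s where ks: "z = (k, s)" "k \<in> K'" "s \<in> T" by auto
        have "real (\<alpha> k) \<le> x / 2" "\<alpha> k \<ge> 1" using ks ge1 by (auto simp: K'_def)
        then have "g z \<in> V" using T(3)[OF ks(3)] ks(1) by (simp add: V_def g_def)
        then show "z \<in> (\<Union>n\<in>V. {z \<in> K \<times> T. g z = n})" using ks K' by auto
      qed
    qed
    also have "card (\<Union>n\<in>V. {z \<in> K \<times> T. g z = n}) = (\<Sum>n\<in>V. card {z \<in> K \<times> T. g z = n})"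
      using finV finK T(1) by (intro card_UN_disjoint) auto
    also have "real \<dots> = sum R V" by (simp add: R_def)
    finally show ?thesis .
  qed
  have pairs: "(\<Sum>k\<in>K. \<Sum>k'\<in>K. ?E k s k' s') \<le>
      of_bool (h s = h s') * A + of_bool (h s' < h s) * B s s' + of_bool (h s < h s') * B s' s" for s s'
  proof (cases "h s' \<le> h s")
    case True
    then have le: "a ^ h s' \<le> a ^ h s" using a by (intro power_increasing) auto
    have "(\<Sum>k\<in>K. \<Sum>k'\<in>K. ?E k s k' s') \<le> B s s'"
      unfolding K_def B_def by (rule sum_shifted_pairs_le[OF mono le])
    also have "\<dots> \<le> of_bool (h s = h s') * A + of_bool (h s' < h s) * B s s' + of_bool (h s < h s') * B s' s"
      using True by (cases "h s = h s'") (auto simp: B_def A_def seq_shift_count_0)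
    finally show ?thesis .
  next
    case False
    then have le: "a ^ h s \<le> a ^ h s'" using a by (intro power_increasing) auto
    have "(\<Sum>k\<in>K. \<Sum>k'\<in>K. ?E k s k' s') =
      (\<Sum>k'\<in>K. \<Sum>k\<in>K. of_bool (\<alpha> k' + a ^ h s' = \<alpha> k + a ^ h s))"
      by (subst sum.swap) (simp add: eq_commute)
    also have "\<dots> \<le> B s' s"
      unfolding K_def B_def by (rule sum_shifted_pairs_le[OF mono le])
    finally show ?thesis using False by simp
  qed
  have offdiag: "(\<Sum>s'\<in>T. \<Sum>s\<in>T. of_bool (h s' < h s) * B s s') \<le> K4 * (x / e\<^sup>2) * C * N * N"
  proof -
    have "(\<Sum>s'\<in>T. \<Sum>s\<in>T. of_bool (h s' < h s) * B s s') \<le> (\<Sum>s'\<in>T. K4 * (x / e\<^sup>2) * (C * N))"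
    proof (rule sum_mono)
      fix s' assume s': "s' \<in> T"
      have "(\<Sum>s\<in>T. of_bool (h s' < h s) * B s s') = (\<Sum>s | s \<in> T \<and> h s' < h s. B s s')"
        using T(1) by (intro sum.mono_neutral_cong_right) auto
      also have "\<dots> \<le> (\<Sum>s | s \<in> T \<and> h s' < h s. K4 * (x / e\<^sup>2) * (?t s s'))"
      proof (rule sum_mono)
        fix s assume "s \<in> {s. s \<in> T \<and> h s' < h s}"
        then have "a ^ h s' < a ^ h s" using a by (intro power_strict_increasing) auto
        then have "B s s' \<le> K4 * (?t s s') * (x / e\<^sup>2)"
          unfolding B_def by (intro shift) simp
        then show "B s s' \<le> K4 * (x / e\<^sup>2) * (?t s s')"
          by (simp only: mult_ac)
      qed
      also have "\<dots> = K4 * (x / e\<^sup>2) * (\<Sum>s | s \<in> T \<and> h s' < h s. ?t s s')"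
        by (rule sum_distrib_left[symmetric])
      also have "\<dots> \<le> K4 * (x / e\<^sup>2) * (C * N)"
        using avg[OF s'] K x unfolding N_def by (intro mult_left_mono) auto
      finally show "(\<Sum>s\<in>T. of_bool (h s' < h s) * B s s') \<le> K4 * (x / e\<^sup>2) * (C * N)" .
    qed
    also have "\<dots> = K4 * (x / e\<^sup>2) * C * N * N" by (simp add: N_def)
    finally show ?thesis .
  qed
  have diag: "(\<Sum>s\<in>T. \<Sum>s'\<in>T. of_bool (h s = h s') * A) \<le> N * (real d * A)"
  proof -
    have "(\<Sum>s\<in>T. \<Sum>s'\<in>T. of_bool (h s = h s') * A) \<le> (\<Sum>s\<in>T. real d * A)"
    proof (rule sum_mono)
      fix s
      have "(\<Sum>s'\<in>T. of_bool (h s = h s') * A) = real (card {s' \<in> T. h s' = h s}) * A"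
        using T(1) by (simp add: sum_distrib_right[symmetric] of_bool_def sum.If_cases Int_def eq_commute)
      also have "\<dots> \<le> real d * A" using fibre[of "h s"] by (intro mult_right_mono) (auto simp: A_def)
      finally show "(\<Sum>s'\<in>T. of_bool (h s = h s') * A) \<le> real d * A" .
    qed
    then show ?thesis by (simp add: N_def)
  qed
  have second: "(\<Sum>n\<in>V. (R n)\<^sup>2) \<le> N * (real d * (K2 * x / e)) + 2 * (K4 * (x / e\<^sup>2) * C * N * N)"
  proof -
    have "(\<Sum>n\<in>V. (R n)\<^sup>2) \<le> (\<Sum>z\<in>K \<times> T. \<Sum>z'\<in>K \<times> T. of_bool (g z = g z'))"
      unfolding R_def using finV finK T(1) by (intro sum_card_fibres_squared_le) auto
    also have "\<dots> = (\<Sum>k\<in>K. \<Sum>s\<in>T. \<Sum>k'\<in>K. \<Sum>s'\<in>T. ?E k s k' s')"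
      by (simp add: sum.cartesian_product' g_def)
    also have "\<dots> = (\<Sum>s\<in>T. \<Sum>s'\<in>T. \<Sum>k\<in>K. \<Sum>k'\<in>K. ?E k s k' s')"
    proof -
      have "(\<Sum>k\<in>K. \<Sum>s\<in>T. \<Sum>k'\<in>K. \<Sum>s'\<in>T. ?E k s k' s' :: real) =
        (\<Sum>s\<in>T. \<Sum>k\<in>K. \<Sum>s'\<in>T. \<Sum>k'\<in>K. ?E k s k' s')"
      proof (subst sum.swap, rule sum.cong[OF refl], rule sum.cong[OF refl])
        fix s k
        show "(\<Sum>k'\<in>K. \<Sum>s'\<in>T. ?E k s k' s' :: real) =
          (\<Sum>s'\<in>T. \<Sum>k'\<in>K. ?E k s k' s')" by (rule sum.swap)
      qed
      also have "\<dots> = (\<Sum>s\<in>T. \<Sum>s'\<in>T. \<Sum>k\<in>K. \<Sum>k'\<in>K. ?E k s k' s')"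
        by (rule sum.cong[OF refl]) (rule sum.swap)
      finally show ?thesis .
    qed
    also have "\<dots> \<le> (\<Sum>s\<in>T. \<Sum>s'\<in>T. of_bool (h s = h s') * A + of_bool (h s' < h s) * B s s' + of_bool (h s < h s') * B s' s)"
      by (intro sum_mono pairs)
    also have "\<dots> = (\<Sum>s\<in>T. \<Sum>s'\<in>T. of_bool (h s = h s') * A) + (\<Sum>s\<in>T. \<Sum>s'\<in>T. of_bool (h s' < h s) * B s s')
        + (\<Sum>s\<in>T. \<Sum>s'\<in>T. of_bool (h s < h s') * B s' s)"
      by (simp only: sum.distrib)
    also have "(\<Sum>s\<in>T. \<Sum>s'\<in>T. of_bool (h s' < h s) * B s s') = (\<Sum>s'\<in>T. \<Sum>s\<in>T. of_bool (h s' < h s) * B s s')"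
      by (rule sum.swap)
    finally have "(\<Sum>n\<in>V. (R n)\<^sup>2) \<le> N * (real d * A) + 2 * (K4 * (x / e\<^sup>2) * C * N * N)"
      using diag offdiag by linarith
    moreover have "N * (real d * A) \<le> N * (real d * (K2 * x / e))"
      using count(2) N unfolding A_def by (intro mult_left_mono) auto
    ultimately show ?thesis by linarith
  qed
  let ?B = "{n. 1 \<le> n \<and> real n \<le> x \<and>
       K1 * K3 * N / (2 * e) \<le> real (card {(k, s). 1 \<le> k \<and> s \<in> T \<and> \<alpha> k + a ^ h s = n})}"
  \<comment> \<open>Half of the guaranteed mean D/x: as V has at most x elements, t |V| <=
    D/2.\<close>
  define t where "t = K1 * K3 * N / (2 * e)"
  define D where "D = K1 * K3 * x * N / e"
  define G where "G = real (card {n \<in> V. t \<le> R n})"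
  have "t \<ge> 0" unfolding t_def using K N e by simp
  have cardV: "real (card V) \<le> x"
  proof -
    have "V \<subseteq> {1..nat \<lfloor>x\<rfloor>}" by (auto simp: V_def le_nat_floor)
    then have "card V \<le> nat \<lfloor>x\<rfloor>" using card_mono[of "{1..nat \<lfloor>x\<rfloor>}" V] by simp
    then have "real (card V) \<le> real (nat \<lfloor>x\<rfloor>)" by (rule of_nat_mono)
    also have "\<dots> \<le> x" using x by simp
    finally show ?thesis .
  qed
  have "(D / 2)\<^sup>2 \<le> G * (\<Sum>n\<in>V. (R n)\<^sup>2)"
    unfolding G_def
  proof (rule card_large_values_ge[OF finV])
    show "D \<le> sum R V" using first by (simp add: D_def)
    show "0 \<le> D" unfolding D_def using K N e x by simp
    have "t * real (card V) \<le> t * x" using cardV \<open>t \<ge> 0\<close> by (intro mult_left_mono) auto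
    also have "t * x = D / 2" by (simp add: t_def D_def mult_ac)
    finally show "t * real (card V) \<le> D / 2" .
  qed (rule \<open>t \<ge> 0\<close>)
  also have "\<dots> \<le> G * (N * (real d * (K2 * x / e)) + 2 * (K4 * (x / e\<^sup>2) * C * N * N))"
    using second by (intro mult_left_mono) (auto simp: G_def)
  also have "\<dots> = x * N / e\<^sup>2 * (G * (real d * K2 * e + 2 * K4 * C * N))"
  proof -
    have eq1: "N * (real d * (K2 * x / e)) = x * N / e\<^sup>2 * (real d * K2 * e)"
      using e by (simp add: power2_eq_square)
    have eq2: "2 * (K4 * (x / e\<^sup>2) * C * N * N) = x * N / e\<^sup>2 * (2 * K4 * C * N)" by simp
    have gen: "G * (q * u + q * v) = q * (G * (u + v))" for q u v :: real by (simp add: algebra_simps)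
    show ?thesis unfolding eq1 eq2 by (rule gen)
  qed
  finally have upper: "(D / 2)\<^sup>2 \<le> x * N / e\<^sup>2 * (G * (real d * K2 * e + 2 * K4 * C * N))" .
  have D_sq: "x * N / e\<^sup>2 * ((K1 * K3 / 2)\<^sup>2 * x * N) = (D / 2)\<^sup>2"
    by (simp add: D_def power_mult_distrib power_divide) (simp add: power2_eq_square)
  have "x * N / e\<^sup>2 * ((K1 * K3 / 2)\<^sup>2 * x * N) \<le> x * N / e\<^sup>2 * (G * (real d * K2 * e + 2 * K4 * C * N))"
    unfolding D_sq by (rule upper)
  moreover have "0 < x * N / e\<^sup>2" using x N e by simp
  ultimately have "(K1 * K3 / 2)\<^sup>2 * x * N \<le> G * (real d * K2 * e + 2 * K4 * C * N)"
    by (rule mult_left_le_imp_le)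
  moreover have "{n \<in> V. t \<le> R n} = ?B"
  proof (rule Set.set_eqI)
    fix n
    show "n \<in> {n \<in> V. t \<le> R n} \<longleftrightarrow> n \<in> ?B"
    proof (cases "n \<in> V")
      case True
      then have "1 \<le> n \<and> real n \<le> x" by (simp add: V_def)
      then show ?thesis using True by (simp only: mem_Collect_eq R_eq[OF True] t_def simp_thms)
    next
      case False
      then have "\<not> (1 \<le> n \<and> real n \<le> x)" by (simp add: V_def)
      then show ?thesis using False by blast
    qed
  qed
  ultimately show ?thesis by (simp only: G_def)
qed

text \<open>Needed to compare \<open>rep_count\<close> with the count over \<open>T\<close>: an
  infinite set would have \<open>card\<close> 0. Finiteness follows from f(s) < a^f(s) <= n and the
  finite fibres of f.\<close>

lemma finite_representations:
  fixes f :: "int poly" and \<alpha> :: "nat \<Rightarrow> nat" and a n :: nat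
  assumes "strict_mono_on {1..} \<alpha>" "degree f \<ge> 1" "a \<ge> 2"
    and "\<forall>m::nat. m \<ge> 1 \<longrightarrow> poly f (int m) \<ge> 1"
  shows "finite {(k, s). 1 \<le> k \<and> s \<in> sums_of_two_squares \<and> \<alpha> k + a ^ nat (poly f (int s)) = n}"
proof (rule finite_subset)
  let ?S = "\<Union>v\<in>{0..int n}. {s::nat. poly f (int s) = v}"
  show "finite ({k. 1 \<le> k \<and> real (\<alpha> k) \<le> real n} \<times> ?S)"
    using finite_seq_le[OF assms(1)] card_poly_fibre_le(1)[OF assms(2)] by blast
  show "{(k, s). 1 \<le> k \<and> s \<in> sums_of_two_squares \<and> \<alpha> k + a ^ nat (poly f (int s)) = n} \<subseteq>
     {k. 1 \<le> k \<and> real (\<alpha> k) \<le> real n} \<times> ?S"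
  proof
    fix z assume "z \<in> {(k, s). 1 \<le> k \<and> s \<in> sums_of_two_squares \<and> \<alpha> k + a ^ nat (poly f (int s)) = n}"
    then obtain k s where z: "z = (k, s)"
      and ks: "1 \<le> k" "s \<in> sums_of_two_squares" "\<alpha> k + a ^ nat (poly f (int s)) = n" by blast
    have "s \<ge> 1" using ks(2) by (simp add: sums_of_two_squares_def)
    then have pos: "poly f (int s) \<ge> 1" using assms(4) by blast
    have "nat (poly f (int s)) < 2 ^ nat (poly f (int s))" by (rule less_exp)
    also have "\<dots> \<le> a ^ nat (poly f (int s))" using assms(3) by (intro power_mono) auto
    also have "\<dots> \<le> n" using ks(3) by linarith
    finally have "poly f (int s) \<le> int n" using pos by linarith
    then have "s \<in> ?S" using pos by auto
    moreover have "\<alpha> k \<le> n" using ks(3) by linarith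
    ultimately show "z \<in> {k. 1 \<le> k \<and> real (\<alpha> k) \<le> real n} \<times> ?S" using ks z by simp
  qed
qed

theorem theorem1p10:
  fixes a :: nat and f :: "int poly" and K1 K2 K3 K4 :: real
  assumes "K1 > 0" "K2 > 0" "K3 > 0" "K4 > 0"
    and "a \<ge> 2"
    and "degree f \<ge> 1"
    and "lead_coeff f > 0"
    and "content f = 1"
    and "\<forall>m::nat. m \<ge> 1 \<longrightarrow> poly f (int m) \<ge> 1"
  shows "\<exists>x0 c1 c2 :: real. x0 > 0 \<and> c1 > 0 \<and> c2 > 0 \<and>
    (\<forall>(\<eta> :: real \<Rightarrow> real) (\<alpha> :: nat \<Rightarrow> nat).
      (\<forall>x\<ge>2. \<eta> x > 0) \<longrightarrow>
      strict_mono_on {1..} \<alpha> \<longrightarrow>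
      (\<forall>n\<ge>1. \<alpha> n \<ge> 1) \<longrightarrow>
      (\<forall>x\<ge>2. K1 * x / \<eta> x \<le> real (seq_count \<alpha> x) \<and> real (seq_count \<alpha> x) \<le> K2 * x / \<eta> x) \<longrightarrow>
      (\<forall>x\<ge>2. real (seq_count \<alpha> (x / 2)) \<ge> K3 * real (seq_count \<alpha> x)) \<longrightarrow>
      (\<forall>x\<ge>2. \<forall>r::nat. r \<ge> 1 \<longrightarrow>
        real (seq_shift_count \<alpha> x r) \<le> K4 * (real r / real (totient r)) * (x / (\<eta> x)\<^sup>2)) \<longrightarrow>
      (\<forall>x\<ge>x0.
        real (card {n::nat. 1 \<le> n \<and> real n \<le> x \<and>
            real (rep_count \<alpha> a f n) \<ge>
              c1 * (ln x powr (1 / real (degree f)) / (\<eta> x * ln (ln x) powr (1 / 2)))})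
          \<ge> c2 * x * (ln x powr (1 / real (degree f)) /
              (ln x powr (1 / real (degree f)) + \<eta> x * ln (ln x) powr (1 / 2)))))"
proof -
  define h where "h = (\<lambda>s. nat (poly f (int s)))"
  let ?t = "\<lambda>s s'. real (a ^ h s - a ^ h s') / real (totient (a ^ h s - a ^ h s'))"
  let ?L = "\<lambda>x. ln x powr (1 / real (degree f))" and ?q = "\<lambda>x::real. ln (ln x) powr (1 / 2)"
  let ?good = "\<lambda>(C::real) c (T :: real \<Rightarrow> nat set) x. finite (T x) \<and> T x \<subseteq> sums_of_two_squares \<and>
     (\<forall>s\<in>T x. real (a ^ h s) \<le> x / 2) \<and>
     c * (?L x / ?q x) \<le> real (card (T x)) \<and>
     (\<forall>s'\<in>T x. (\<Sum>s | s \<in> T x \<and> h s' < h s. ?t s s')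
       \<le> C * real (card (T x)))"
  define d where "d = degree f"
  \<comment> \<open>These depend on \<open>a\<close> and \<open>f\<close> only and are fixed before
    the sequence and \<open>\<eta>\<close> appear, which gives the uniformity of x0, c1 and
    c2.\<close>
  obtain C c :: real and T :: "real \<Rightarrow> nat set" where C: "C > 0" and c: "c > 0" and ev: "\<forall>\<^sub>F x in at_top.
     ?good C c T x"
    using exists_thin_exponents[OF assms(6,7,5,9)] unfolding h_def by (elim exE conjE) (rule that[unfolded h_def]; assumption)
  obtain X where X: "\<And>x. x \<ge> X \<Longrightarrow>
     ?good C c T x"
    using ev unfolding eventually_at_top_linorder by blast
  \<comment> \<open>From x >= 16 on, ln x >= 4 ln 2 > 1, so ln (ln x) is positive and the quotient L
    / q is meaningful.\<close>
  define x0 where "x0 = max X 16"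
  define Kmax where "Kmax = real d * K2 + 2 * K4 * C"
  define c1 where "c1 = K1 * K3 * c / 2"
  define c2 where "c2 = (K1 * K3 / 2)\<^sup>2 * min c 1 / Kmax"
  have Kmax: "Kmax > 0" unfolding Kmax_def using assms C by (intro add_nonneg_pos) auto
  have pos: "x0 > 0" "c1 > 0" "c2 > 0" using assms c Kmax by (auto simp: x0_def c1_def c2_def)
  have main: "c2 * x * (?L x / (?L x + \<eta> x * ?q x))
      \<le> real (card {n::nat. 1 \<le> n \<and> real n \<le> x \<and>
            real (rep_count \<alpha> a f n) \<ge> c1 * (?L x / (\<eta> x * ?q x))})"
    if \<eta>: "\<forall>x\<ge>2. \<eta> x > 0" and mono: "strict_mono_on {1..} \<alpha>" and ge1: "\<forall>n\<ge>1. \<alpha> n \<ge> 1"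
      and count: "\<forall>x\<ge>2. K1 * x / \<eta> x \<le> real (seq_count \<alpha> x) \<and> real (seq_count \<alpha> x) \<le> K2 * x / \<eta> x"
      and half: "\<forall>x\<ge>2. real (seq_count \<alpha> (x / 2)) \<ge> K3 * real (seq_count \<alpha> x)"
      and shift: "\<forall>x\<ge>2. \<forall>r::nat. r \<ge> 1 \<longrightarrow>
        real (seq_shift_count \<alpha> x r) \<le> K4 * (real r / real (totient r)) * (x / (\<eta> x)\<^sup>2)"
      and x: "x \<ge> x0" for \<eta> :: "real \<Rightarrow> real" and \<alpha> :: "nat \<Rightarrow> nat" and x :: real
  proof -
    have x2: "x \<ge> 2" and x16: "x \<ge> 16" and xX: "x \<ge> X" using x by (auto simp: x0_def)
    define e where "e = \<eta> x"
    define L where "L = ?L x"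
    define q where "q = ?q x"
    define N where "N = real (card (T x))"
    define R where "R = (\<lambda>n. card {(k, s). 1 \<le> k \<and> s \<in> T x \<and> \<alpha> k + a ^ h s = n})"
    define V1 where "V1 = {n. 1 \<le> n \<and> real n \<le> x \<and> K1 * K3 * N / (2 * e) \<le> real (R n)}"
    define V2 where "V2 = {n::nat. 1 \<le> n \<and> real n \<le> x \<and> c1 * (L / (e * q)) \<le> real (rep_count \<alpha> a f n)}"
    have e: "e > 0" using \<eta> x2 by (simp add: e_def)
    have lnx: "ln x > 1"
    proof -
      have "ln (16::real) = 4 * ln 2" using ln_realpow[of 2 4] by simp
      moreover have "ln 16 \<le> ln x" using x16 by (intro ln_mono) auto
      ultimately show ?thesis using ln2_ge_two_thirds by linarith
    qed
    then have L: "L > 0" and q: "q > 0" by (auto simp: L_def q_def)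
    have T: "finite (T x)" "T x \<subseteq> sums_of_two_squares" "\<And>s. s \<in> T x \<Longrightarrow> real (a ^ h s) \<le> x / 2"
      and N_ge: "c * (L / q) \<le> N"
      and avg: "\<And>s'. s' \<in> T x \<Longrightarrow> (\<Sum>s | s \<in> T x \<and> h s' < h s. ?t s s')
       \<le> C * real (card (T x))"
      using X[OF xX] unfolding L_def q_def N_def by blast+
    have "c * (L / q) > 0" using c L q by simp
    then have N: "N > 0" using N_ge by linarith
    then have Tne: "T x \<noteq> {}" by (auto simp: N_def)
    have fibre: "card {s \<in> T x. h s = v} \<le> d" for v
    \<comment> \<open>\<open>nat\<close> sends every nonpositive value of f to 0, so the fibre over
      0 is not a fibre of f; it is empty by positivity of f.\<close>
    proof (cases "v = 0")
      case True
      have "{s \<in> T x. h s = v} = {}"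
      proof -
        have "h s \<noteq> v" if "s \<in> T x" for s
        proof -
          have "s \<ge> 1" using that T(2) by (auto simp: sums_of_two_squares_def)
          then have "poly f (int s) \<ge> 1" using assms(9) by blast
          then show ?thesis using True by (simp add: h_def)
        qed
        then show ?thesis by blast
      qed
      then show ?thesis by (simp only: card.empty le0)
    next
      case False
      have "{s \<in> T x. h s = v} \<subseteq> {s. poly f (int s) = int v}" using False by (auto simp: h_def)
      then have "card {s \<in> T x. h s = v} \<le> card {s::nat. poly f (int s) = int v}"
        by (intro card_mono card_poly_fibre_le(1) assms(6))
      also have "\<dots> \<le> d" unfolding d_def by (intro card_poly_fibre_le(2) assms(6))
      finally show ?thesis .
    qed
    have core: "(K1 * K3 / 2)\<^sup>2 * x * N \<le> real (card V1) * (real d * K2 * e + 2 * K4 * C * N)"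
      unfolding V1_def R_def N_def
    proof (rule card_many_representations_ge[OF mono ge1 assms(1-4) C e x2 assms(5)])
      show "K1 * x / e \<le> real (seq_count \<alpha> x)" "real (seq_count \<alpha> x) \<le> K2 * x / e"
        using count x2 by (auto simp: e_def)
      show "K3 * real (seq_count \<alpha> x) \<le> real (seq_count \<alpha> (x / 2))" using half x2 by blast
      show "real (seq_shift_count \<alpha> x r) \<le> K4 * (real r / real (totient r)) * (x / e\<^sup>2)" if "r \<ge> 1" for r
        using shift x2 that unfolding e_def by blast
    qed (use T Tne fibre avg in auto)
    have "V1 \<subseteq> V2"
    proof
      fix n assume n: "n \<in> V1"
      have "R n \<le> rep_count \<alpha> a f n"
        unfolding R_def rep_count_def h_def
        using T(2) by (intro card_mono finite_representations[OF mono assms(6,5,9)]) auto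
      then have "real (R n) \<le> real (rep_count \<alpha> a f n)" by (rule of_nat_mono)
      moreover have "c1 * (L / (e * q)) \<le> K1 * K3 * N / (2 * e)"
      proof -
        have "c1 * (L / (e * q)) = K1 * K3 / (2 * e) * (c * (L / q))" by (simp add: c1_def)
        also have "\<dots> \<le> K1 * K3 / (2 * e) * N" using N_ge assms e by (intro mult_left_mono) auto
        finally show ?thesis by simp
      qed
      ultimately show "n \<in> V2" using n unfolding V1_def V2_def by auto
    qed
    moreover have "finite V2" by (rule finite_subset[of _ "{..nat \<lfloor>x\<rfloor>}"]) (auto simp: V2_def le_nat_floor)
    ultimately have V12: "real (card V1) \<le> real (card V2)" by (intro of_nat_mono card_mono)
    have "(K1 * K3 / 2)\<^sup>2 * x * N \<le> real (card V2) * (Kmax * (e + N))"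
    proof -
      have "real d * K2 * e + 2 * K4 * C * N \<le> Kmax * e + Kmax * N"
        unfolding Kmax_def using assms C e N by (intro add_mono mult_right_mono) auto
      then have "real (card V1) * (real d * K2 * e + 2 * K4 * C * N) \<le> real (card V2) * (Kmax * (e + N))"
        using V12 assms C e N by (intro mult_mono) (auto simp: distrib_left)
      then show ?thesis using core by linarith
    qed
    then have "(K1 * K3 / 2)\<^sup>2 * x * N / (Kmax * (e + N)) \<le> real (card V2)"
      using Kmax e N by (simp add: pos_divide_le_eq)
    moreover have "c2 * x * (L / (L + e * q)) \<le> (K1 * K3 / 2)\<^sup>2 * x * N / (Kmax * (e + N))"
    proof -
      \<comment> \<open>This is N/(e + N) >= min c 1 * L/(L + e q) with denominators cleared: the
        term with e uses N >= c L / q, the term with N uses min c 1 <= 1.\<close>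
      have "min c 1 * L * (e + N) \<le> N * (L + e * q)"
      proof -
        have "min c 1 * L * e \<le> c * L * e" using L e by (intro mult_right_mono) auto
        also have "\<dots> = c * (L / q) * (e * q)" using q by simp
        also have "\<dots> \<le> N * (e * q)" using N_ge e q by (intro mult_right_mono) auto
        finally have "min c 1 * L * e \<le> N * (e * q)" .
        moreover have "min c 1 * (L * N) \<le> 1 * (L * N)" using L N by (intro mult_right_mono) auto
        ultimately show ?thesis by (simp add: algebra_simps)
      qed
      then have "min c 1 * (L / (L + e * q)) \<le> N / (e + N)"
        using L e q N by (simp add: field_simps add_pos_pos)
      then have "(K1 * K3 / 2)\<^sup>2 * x / Kmax * (min c 1 * (L / (L + e * q))) \<le> (K1 * K3 / 2)\<^sup>2 * x / Kmax * (N / (e + N))"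
        using x2 Kmax by (intro mult_left_mono) auto
      then show ?thesis by (simp add: c2_def mult_ac)
    qed
    ultimately show ?thesis unfolding V2_def L_def q_def e_def by linarith
  qed
  show ?thesis
    by (intro exI[of _ x0] exI[of _ c1] exI[of _ c2] conjI pos allI impI) (rule main; assumption)
qed

end
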